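(* For $n\geq 18$, $\overline{p}(n)$ is ratio log-convex; that is, for every integer $n \geq 18$, $$\log\overline{p}(n+2)-3\log\overline{p}(n+1)+3\log\overline{p}(n)-\log\overline{p}(n-1)\geq 0.$$
   Context: An overpartition of a positive integer $n$ is a nonincreasing sequence of positive integers with sum $n$ in which the first occurrence of each number may be overlined. $\overline{p}(n)$ denotes the number of overpartitions of $n$, with $\overline{p}(0)=1$. A sequence $\{a_n\}_{n\geq k}$ of positive reals is called ratio log-convex if $\{a_{n+1}/a_n\}_{n\geq k}$ is log-convex, equivalently if $\log a_{n+2}-3\log a_{n+1}+3\log a_n-\log a_{n-1}\geq 0$ for all $n\geq k+1$. *)

theory Defs
  imports Complex_Main
begin

text \<open>
  A part is a pair of its size and a flag telling whether it is overlined.  A part that has an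
  earlier part of the same size is not a first occurrence, so its flag has to be off.
\<close>

definition overpartition :: "nat \<Rightarrow> (nat \<times> bool) list \<Rightarrow> bool" where
  "overpartition n xs \<longleftrightarrow>
     sorted_wrt (\<ge>) (map fst xs) \<and>
     (\<forall>x \<in> set xs. fst x > 0) \<and>
     sum_list (map fst xs) = n \<and>
     (\<forall>i j. i < j \<and> j < length xs \<and> fst (xs ! i) = fst (xs ! j) \<longrightarrow> \<not> snd (xs ! j))"

definition num_overpartitions :: "nat \<Rightarrow> nat" where
  "num_overpartitions n = card {xs. overpartition n xs}"

definition log_convex_from :: "nat \<Rightarrow> (nat \<Rightarrow> real) \<Rightarrow> bool" where
  "log_convex_from k a \<longleftrightarrow>
     (\<forall>n\<ge>k. a n > 0) \<and> (\<forall>n\<ge>k + 1. (a n)\<^sup>2 \<le> a (n - 1) * a (n + 1))"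

definition ratio_log_convex_from :: "nat \<Rightarrow> (nat \<Rightarrow> real) \<Rightarrow> bool" where
  "ratio_log_convex_from k a \<longleftrightarrow>
     (\<forall>n\<ge>k. a n > 0) \<and> log_convex_from k (\<lambda>n. a (n + 1) / a n)"

text \<open>The set being counted is finite, so \<^const>\<open>card\<close> has its usual meaning.\<close>

lemma finite_overpartitions: "finite {xs. overpartition n xs}"
proof (rule finite_subset)
  have len: "length xs \<le> sum_list (map fst xs)"
    if "\<forall>x \<in> set xs. fst x > 0" for xs :: "(nat \<times> bool) list"
    using that by (induction xs) auto
  have mem: "fst x \<le> sum_list (map fst xs)"
    if "x \<in> set xs" for x and xs :: "(nat \<times> bool) list"
    using that by (intro member_le_sum_list) auto
  show "{xs. overpartition n xs} \<subseteq> {xs. set xs \<subseteq> {..n} \<times> UNIV \<and> length xs \<le> n}"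
    using len mem by (fastforce simp: overpartition_def)
  show "finite {xs. set xs \<subseteq> {..n} \<times> (UNIV :: bool set) \<and> length xs \<le> n}"
    by (rule finite_lists_length_le) simp
qed

lemma num_overpartitions_0: "num_overpartitions 0 = 1"
proof -
  have "xs = []" if "overpartition 0 xs" for xs
    using that by (cases xs) (auto simp: overpartition_def)
  moreover have "overpartition 0 []"
    by (simp add: overpartition_def)
  ultimately have "{xs. overpartition 0 xs} = {[]}"
    by auto
  then show ?thesis
    by (simp add: num_overpartitions_def)
qed

text \<open>
  The logarithmic form at \<open>n\<close> involves \<open>a (n - 1)\<close>, hence the shift between the starting index of
  the sequence and the range of the inequality.
\<close>

lemma ratio_log_convex_from_iff:
  assumes pos: "\<And>n. n \<ge> k \<Longrightarrow> a n > 0"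
  shows "ratio_log_convex_from k a \<longleftrightarrow>
    (\<forall>n\<ge>k + 1. ln (a (n + 2)) - 3 * ln (a (n + 1)) + 3 * ln (a n) - ln (a (n - 1)) \<ge> 0)"
proof -
  have "((a (n + 1) / a n)\<^sup>2 \<le> a (n - 1 + 1) / a (n - 1) * (a (n + 1 + 1) / a (n + 1))) \<longleftrightarrow>
    ln (a (n + 2)) - 3 * ln (a (n + 1)) + 3 * ln (a n) - ln (a (n - 1)) \<ge> 0"
    (is "?l \<le> ?r \<longleftrightarrow> _") if n: "n \<ge> k + 1" for n
  proof -
    have p: "a (n - 1) > 0" "a n > 0" "a (n + 1) > 0" "a (n + 2) > 0"
      using n by (auto intro!: pos)
    have r: "?r = a n / a (n - 1) * (a (n + 2) / a (n + 1))"
      using n by simp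
    have "?l \<le> ?r \<longleftrightarrow> ln ?l \<le> ln ?r"
      unfolding r using p by (subst ln_le_cancel_iff) auto
    also have "ln ?l = 2 * (ln (a (n + 1)) - ln (a n))"
      using p by (simp add: ln_realpow ln_div)
    also have "ln ?r = ln (a n) - ln (a (n - 1)) + (ln (a (n + 2)) - ln (a (n + 1)))"
      unfolding r using p by (simp add: ln_mult ln_div)
    finally show ?thesis
      by (auto simp: algebra_simps)
  qed
  then show ?thesis
    using pos by (auto simp: ratio_log_convex_from_def log_convex_from_def)
qed

end

theory Submission
  imports
    Defs
    "HOL-Complex_Analysis.Complex_Analysis"
    "HOL-Probability.Distributions"
    "HOL-Real_Asymp.Real_Asymp"
begin

text \<open>
  The generating function of overpartitions is \<open>P(q) = \<Prod>(1 + q\<^sup>i) / (1 - q\<^sup>i)\<close>, which by Gauss is the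
  reciprocal of the theta series \<open>\<Sum>(-1)\<^sup>k q^(k\<^sup>2)\<close>.  The theta transformation, obtained for real
  arguments as a limit of a binomial identity (Polya) and extended by analytic continuation, shows
  that \<open>P(e^(-t))\<close> agrees with \<open>M(t) = sqrt (t / \<pi>) / 2 * exp (\<pi>\<^sup>2 / (4 t))\<close> up to a bounded error near
  \<open>t = 0\<close>.  Away from \<open>t = 0\<close>, comparing the logarithms of the factors of the product termwise gives
  \<open>|P(q)| \<le> P(|q|) exp (2 Re (1 / (1 - q)) - 2 / (1 - |q|))\<close>, which is exponentially smaller.  On the
  circle \<open>|t| = t0\<close> the coefficient integral of \<open>M\<close> turns into a Gaussian integral via
  \<open>s = sin (\<phi> / 2)\<close>, so with \<open>x = \<pi> sqrt n\<close> the number of overpartitions of \<open>n\<close> is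
  \<open>e^x / (8 n) (1 - 1 / x)\<close> up to an exponentially small relative error.  The third derivative of the
  logarithm of this main term is about \<open>3 \<pi> / 8 n^(-5/2)\<close>, which dominates the error for \<open>n \<ge> 901\<close>.  The
  remaining cases are computed from the recurrence that Gauss's identity provides.
\<close>

section \<open>Overpartitions and their generating function\<close>

text \<open>The third difference of the logarithm is only of order n^(-5/2), so the asymptotic
  formula is needed with a much smaller relative error and explicit constants, which decide how many
  cases are left to compute. The coefficient integral runs over Re t = t0, |Im t| <= pi, where t0 =
  pi^2 / (2 x) is the saddle point of n t + pi^2 / (4 t). This exponent is real on the circle |t| =
  t0, hence the middle of the segment is pushed onto an arc. The cut at the angle pi / 3, that is at
  |Im t| = sqrt 3 t0, is a compromise: up to there |t| <= 2 t0 and the theta transformation is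
  accurate, the two connecting rays cost e^(5 x / 8), and the outer pieces of the segment cost e^(18
  x / 25), which is the worst contribution. The factor 1 - 1 / x is the dominant part of the Bessel
  function of order 3 / 2, elementary because M contains a half-integral power of t. The relative
  error is about n e^(-7 x / 25); from n = 900 on it is small against n^(-5/2).\<close>

definition overpartitions_le :: "nat \<Rightarrow> nat \<Rightarrow> (nat \<times> bool) list set" where
  "overpartitions_le k n = {xs. overpartition n xs \<and> (\<forall>x \<in> set xs. fst x \<le> k)}"

lemma overpartition_Cons_iff:
  "overpartition n (x # xs) \<longleftrightarrow>
     0 < fst x \<and> fst x \<le> n \<and> overpartition (n - fst x) xs \<and>
     (\<forall>y \<in> set xs. fst y \<le> fst x \<and> (fst y = fst x \<longrightarrow> \<not> snd y))"
proof -
  have *: "(\<forall>i j. i < j \<and> j < length (x # xs) \<and> fst ((x # xs) ! i) = fst ((x # xs) ! j) \<longrightarrow> \<not> snd ((x # xs) ! j))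
     \<longleftrightarrow> (\<forall>i j. i < j \<and> j < length xs \<and> fst (xs ! i) = fst (xs ! j) \<longrightarrow> \<not> snd (xs ! j)) \<and>
        (\<forall>y \<in> set xs. fst y = fst x \<longrightarrow> \<not> snd y)" (is "?l \<longleftrightarrow> ?r1 \<and> ?r2")
  proof safe
    fix i j assume ?l "i < j" "j < length xs" "fst (xs ! i) = fst (xs ! j)" "snd (xs ! j)"
    then show False using \<open>?l\<close>[rule_format, of "Suc i" "Suc j"] by auto
  next
    fix a b assume ?l "(a, b) \<in> set xs" "fst (a, b) = fst x" "snd (a, b)"
    then obtain j where "j < length xs" "xs ! j = (a, b)" by (auto simp: in_set_conv_nth)
    then show False using \<open>?l\<close>[rule_format, of 0 "Suc j"] \<open>snd (a, b)\<close> \<open>fst (a, b) = fst x\<close> by auto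
  next
    fix i j assume a: ?r1 ?r2 "i < j" "j < length (x # xs)"
      "fst ((x # xs) ! i) = fst ((x # xs) ! j)" "snd ((x # xs) ! j)"
    then show False by (cases i; cases j) auto
  qed
  show ?thesis unfolding overpartition_def * by auto
qed

lemma finite_overpartitions_le [simp]: "finite (overpartitions_le k n)"
  using finite_overpartitions[of n] by (rule rev_finite_subset) (auto simp: overpartitions_le_def)

lemma overpartition_le_sum: "overpartition n xs \<Longrightarrow> x \<in> set xs \<Longrightarrow> fst x \<le> n"
  unfolding overpartition_def using member_le_sum_list[of "fst x" "map fst xs"] by auto

lemma overpartitions_le_0: "overpartitions_le 0 n = (if n = 0 then {[]} else {})"
proof -
  have "xs = [] \<and> n = 0" if "xs \<in> overpartitions_le 0 n" for xs
    using that by (cases xs) (auto simp: overpartitions_le_def overpartition_def)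
  moreover have "[] \<in> overpartitions_le 0 0" by (auto simp: overpartitions_le_def overpartition_def)
  ultimately show ?thesis by auto
qed

abbreviation num_le :: "nat \<Rightarrow> nat \<Rightarrow> nat" where
  "num_le k n \<equiv> card (overpartitions_le k n)"

lemma num_overpartitions_eq_num_le: "n \<le> k \<Longrightarrow> num_overpartitions n = num_le k n"
  unfolding num_overpartitions_def overpartitions_le_def
proof (rule arg_cong[of _ _ card], intro equalityI subsetI)
  fix xs assume "n \<le> k" "xs \<in> {xs. overpartition n xs}"
  then show "xs \<in> {xs. overpartition n xs \<and> (\<forall>x\<in>set xs. fst x \<le> k)}"
    using overpartition_le_sum[of n xs] by force
qed auto

lemma num_le_le_num_overpartitions: "num_le k n \<le> num_overpartitions n"
  unfolding num_overpartitions_def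
  by (rule card_mono) (auto simp: overpartitions_le_def finite_overpartitions)

text \<open>The lists that may follow a first part of size \<open>k\<close>: the only occurrence of
  \<open>k\<close> that could be overlined has then been spent.\<close>

definition plain_max :: "nat \<Rightarrow> nat \<Rightarrow> (nat \<times> bool) list set" where
  "plain_max k n = {xs \<in> overpartitions_le k n. (k, True) \<notin> set xs}"

lemma overpartitions_le_Suc_eq:
  "overpartitions_le (Suc k) n = overpartitions_le k n \<union>
     (if n > k then (\<lambda>(b, xs). (Suc k, b) # xs) ` (UNIV \<times> plain_max (Suc k) (n - Suc k)) else {})"
  (is "?l = ?r")
proof (intro equalityI subsetI)
  fix xs assume xs: "xs \<in> ?l"
  show "xs \<in> ?r"
  proof (cases "\<exists>b ys. xs = (Suc k, b) # ys")
    case True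
    then obtain b ys where e: "xs = (Suc k, b) # ys" by blast
    then have "ys \<in> plain_max (Suc k) (n - Suc k)" "n > k"
      using xs by (auto simp: overpartitions_le_def plain_max_def overpartition_Cons_iff)
    then show ?thesis by (auto simp: e)
  next
    case False
    have "fst x \<le> k" if x: "x \<in> set xs" for x
    proof (cases xs)
      case (Cons y ys)
      have "fst y \<le> Suc k" "fst y \<noteq> Suc k"
        using xs Cons False by (auto simp: overpartitions_le_def) (metis prod.collapse)
      moreover have "fst x \<le> fst y" using xs x Cons by (auto simp: overpartitions_le_def overpartition_Cons_iff)
      ultimately show ?thesis by auto
    qed (use x in auto)
    then show ?thesis using xs by (auto simp: overpartitions_le_def)
  qed
next
  fix xs assume "xs \<in> ?r"
  then show "xs \<in> ?l"
    by (auto simp: overpartitions_le_def plain_max_def overpartition_Cons_iff split: if_splits)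
qed

lemma plain_max_Suc_eq:
  "plain_max (Suc k) n = overpartitions_le k n \<union>
     (if n > k then (\<lambda>xs. (Suc k, False) # xs) ` plain_max (Suc k) (n - Suc k) else {})"
proof -
  have "(Suc k, True) \<notin> set xs" if "xs \<in> overpartitions_le k n" for xs
    using that by (force simp: overpartitions_le_def)
  then show ?thesis
    unfolding plain_max_def[of _ n] overpartitions_le_Suc_eq
    by (auto simp: plain_max_def)
qed

text \<open>Coefficient form of (1 - q^(k+1)) Q_(k+1) = (1 + q^(k+1)) Q_k for the generating
  functions Q_k. Splitting off a leading part k + 1 yields one relation for all lists
  (\<open>A\<close>) and one for the plain ones (\<open>B\<close>); eliminating
  \<open>plain_max\<close> between them gives the claim.\<close>

lemma num_le_Suc:
  "num_le (Suc k) n = num_le k n + (if n > k then num_le k (n - Suc k) + num_le (Suc k) (n - Suc k) else 0)"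
proof -
  have fin: "finite (plain_max (Suc k) m)" for m unfolding plain_max_def by auto
  have A: "num_le (Suc k) m = num_le k m + (if m > k then 2 * card (plain_max (Suc k) (m - Suc k)) else 0)" for m
  proof -
    have "card ((\<lambda>(b, xs). (Suc k, b) # xs) ` (UNIV \<times> plain_max (Suc k) (m - Suc k))) = 2 * card (plain_max (Suc k) (m - Suc k))"
      by (subst card_image) (auto simp: inj_on_def card_cartesian_product)
    then show ?thesis unfolding overpartitions_le_Suc_eq
      by (subst card_Un_disjoint) (auto simp: fin, auto simp: overpartitions_le_def)
  qed
  have B: "card (plain_max (Suc k) m) = num_le k m + (if m > k then card (plain_max (Suc k) (m - Suc k)) else 0)" for m
  proof -
    have "card ((\<lambda>xs. (Suc k, False) # xs) ` plain_max (Suc k) (m - Suc k)) = card (plain_max (Suc k) (m - Suc k))"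
      by (subst card_image) (auto simp: inj_on_def)
    then show ?thesis by (subst plain_max_Suc_eq, subst card_Un_disjoint) (auto simp: fin, auto simp: overpartitions_le_def)
  qed
  show ?thesis using A[of n] A[of "n - Suc k"] B[of "n - Suc k"] by auto
qed

lemma num_le_0: "num_le 0 n = (if n = 0 then 1 else 0)"
  by (simp add: overpartitions_le_0)

section \<open>Generating functions as finite products, and their limit\<close>

definition euler_quot :: "nat \<Rightarrow> 'a::real_normed_field \<Rightarrow> 'a" where
  "euler_quot k z = (\<Prod>i=1..k. (1 + z ^ i) / (1 - z ^ i))"

lemma norm_power_lt_1: "norm (z::'a::real_normed_field) < 1 \<Longrightarrow> i > 0 \<Longrightarrow> norm (z ^ i) < 1"
  by (simp add: norm_power power_less_one_iff)

lemma one_minus_power_nz: "norm (z::'a::real_normed_field) < 1 \<Longrightarrow> i > 0 \<Longrightarrow> 1 - z ^ i \<noteq> 0"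
  using norm_power_lt_1[of z i] by auto

lemma sums_shift_if:
  fixes f :: "nat \<Rightarrow> 'a::real_normed_field"
  assumes "(\<lambda>n. f n * z ^ n) sums s"
  shows "(\<lambda>n. (if n \<ge> m then f (n - m) else 0) * z ^ n) sums (z ^ m * s)"
proof -
  have "(\<lambda>n. z ^ m * (f n * z ^ n)) sums (z ^ m * s)" by (rule sums_mult[OF assms])
  then have "(\<lambda>n. (\<lambda>n. (if n \<ge> m then f (n - m) else 0) * z ^ n) (n + m)) sums (z ^ m * s)"
    by (simp add: power_add mult_ac)
  then show ?thesis by (subst (asm) sums_iff_shift) simp
qed

text \<open>Convergence has to be secured before the recurrence in \<open>k\<close> can be applied
  to whole series. On partial sums the shifted sums lose their last terms, which are nonnegative, so
  the recurrence survives as an inequality; dividing by \<open>1 - r ^ Suc k > 0\<close> keeps its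
  direction.\<close>

lemma num_le_psum_le:
  fixes r :: real
  assumes r: "0 \<le> r" "r < 1"
  shows "(\<Sum>n<N. num_le k n * r ^ n) \<le> euler_quot k r"
proof (induction k)
  case 0
  have "(\<Sum>n<N. num_le 0 n * r ^ n) = (\<Sum>n<N. if n = 0 then 1 else 0)"
    by (intro sum.cong) (auto simp: num_le_0)
  also have "\<dots> \<le> 1" by (subst sum.delta) auto
  finally show ?case by (simp add: euler_quot_def)
next
  case (Suc k)
  define S where "S = (\<lambda>j. \<Sum>n<N. num_le j n * r ^ n)"
  have shift: "(\<Sum>n<N. (if n > k then num_le j (n - Suc k) else 0) * r ^ n) \<le> r ^ Suc k * S j" for j
  proof -
    have "(\<Sum>n<N. (if n > k then num_le j (n - Suc k) else 0) * r ^ n)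
        = (\<Sum>n\<in>{Suc k..<N}. num_le j (n - Suc k) * r ^ n)"
      by (intro sum.mono_neutral_cong_right) auto
    also have "\<dots> = (\<Sum>n\<in>{..<N - Suc k}. num_le j n * r ^ (n + Suc k))"
      by (rule sum.reindex_bij_witness[of _ "\<lambda>n. n + Suc k" "\<lambda>n. n - Suc k"]) auto
    also have "\<dots> \<le> (\<Sum>n\<in>{..<N}. num_le j n * r ^ (n + Suc k))"
      by (intro sum_mono2) (use r in auto)
    also have "\<dots> = r ^ Suc k * S j"
      by (simp add: S_def sum_distrib_left power_add mult_ac)
    finally show ?thesis .
  qed
  have "S (Suc k) = (\<Sum>n<N. num_le k n * r ^ n + (if n > k then num_le k (n - Suc k) else 0) * r ^ n +
      (if n > k then num_le (Suc k) (n - Suc k) else 0) * r ^ n)"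
    unfolding S_def by (intro sum.cong refl, subst num_le_Suc) (auto simp: ring_distribs)
  also have "\<dots> \<le> S k + r ^ Suc k * S k + r ^ Suc k * S (Suc k)"
    unfolding sum.distrib by (intro add_mono shift) (simp add: S_def)
  finally have "S (Suc k) * (1 - r ^ Suc k) \<le> S k * (1 + r ^ Suc k)" by (simp add: algebra_simps)
  moreover have pos: "1 - r ^ Suc k > 0" using r norm_power_lt_1[of r "Suc k"] by (simp add: power_abs del: power_Suc)
  ultimately have "S (Suc k) \<le> S k * ((1 + r ^ Suc k) / (1 - r ^ Suc k))"
    by (simp add: pos_le_divide_eq del: power_Suc)
  also have "\<dots> \<le> euler_quot k r * ((1 + r ^ Suc k) / (1 - r ^ Suc k))"
    using Suc.IH r pos by (intro mult_right_mono divide_nonneg_pos) (auto simp: S_def simp del: power_Suc)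
  finally show ?case by (simp add: euler_quot_def S_def del: power_Suc)
qed

lemma num_le_sums:
  fixes z :: complex
  assumes z: "norm z < 1"
  shows "(\<lambda>n. of_nat (num_le k n) * z ^ n) sums euler_quot k z"
proof -
  have "summable (\<lambda>n. norm (of_nat (num_le k n) * z ^ n))" for k
    by (rule summableI_nonneg_bounded[where x = "euler_quot k (norm z)"])
       (use num_le_psum_le[of "norm z"] z in \<open>auto simp: norm_mult norm_power\<close>)
  then have sm: "summable (\<lambda>n. of_nat (num_le k n) * z ^ n)" for k
    by (rule summable_norm_cancel)
  define S where "S = (\<lambda>k. \<Sum>n. of_nat (num_le k n) * z ^ n)"
  have sums: "(\<lambda>n. of_nat (num_le k n) * z ^ n) sums S k" for k
    unfolding S_def using sm by (rule summable_sums)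
  have "S k = euler_quot k z"
  proof (induction k)
    case 0
    have "(\<lambda>n. of_nat (num_le 0 n) * z ^ n) = (\<lambda>n. if n = 0 then 1 else 0)"
      by (auto simp: num_le_0)
    then show ?case using sums_single[of 0 "\<lambda>_. 1::complex"] sums[of 0]
      by (auto simp: euler_quot_def sums_iff)
  next
    case (Suc k)
    have "(\<lambda>n. of_nat (num_le k n) * z ^ n +
        (if n \<ge> Suc k then of_nat (num_le k (n - Suc k)) else 0) * z ^ n +
        (if n \<ge> Suc k then of_nat (num_le (Suc k) (n - Suc k)) else 0) * z ^ n) sums
        (S k + z ^ Suc k * S k + z ^ Suc k * S (Suc k))"
      by (intro sums_add sums sums_shift_if)
    also have "(\<lambda>n. of_nat (num_le k n) * z ^ n +
        (if n \<ge> Suc k then of_nat (num_le k (n - Suc k)) else 0) * z ^ n +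
        (if n \<ge> Suc k then of_nat (num_le (Suc k) (n - Suc k)) else 0) * z ^ n) =
        (\<lambda>n. of_nat (num_le (Suc k) n) * z ^ n)"
      by (rule ext, subst num_le_Suc) (auto simp: ring_distribs)
    finally have "S (Suc k) = S k + z ^ Suc k * S k + z ^ Suc k * S (Suc k)"
      using sums[of "Suc k"] sums_unique2 by blast
    moreover have "1 - z ^ Suc k \<noteq> 0" using z by (intro one_minus_power_nz) auto
    ultimately have "S (Suc k) = S k * ((1 + z ^ Suc k) / (1 - z ^ Suc k))"
      by (simp add: divide_simps del: power_Suc) (simp add: algebra_simps del: power_Suc)
    then show ?case by (simp add: Suc.IH euler_quot_def del: power_Suc)
  qed
  then show ?thesis using sums[of k] by simp
qed

text \<open>Crude, but uniform in \<open>k\<close>, which is what makes the unrestricted series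
  converge. It comes from 1 + u <= e^u in each factor and a geometric series in the
  exponent.\<close>

lemma euler_quot_le:
  fixes r :: real
  assumes r: "0 \<le> r" "r < 1"
  shows "euler_quot k r \<le> exp (2 / (1 - r)\<^sup>2)"
proof -
  have "euler_quot k r \<le> (\<Prod>i=1..k. exp (2 * r ^ i / (1 - r)))"
    unfolding euler_quot_def
  proof (intro prod_mono conjI)
    fix i assume i: "i \<in> {1..k}"
    have ri: "0 \<le> r ^ i" "r ^ i \<le> r" using r i power_decreasing[of 1 i r] by auto
    show "0 \<le> (1 + r ^ i) / (1 - r ^ i)" using ri r by auto
    have "(1 + r ^ i) / (1 - r ^ i) = 1 + 2 * r ^ i / (1 - r ^ i)" using ri r by (simp add: field_simps)
    also have "\<dots> \<le> 1 + 2 * r ^ i / (1 - r)" using ri r by (intro add_left_mono divide_left_mono mult_pos_pos) auto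
    also have "\<dots> \<le> exp (2 * r ^ i / (1 - r))" by (rule exp_ge_add_one_self)
    finally show "(1 + r ^ i) / (1 - r ^ i) \<le> exp (2 * r ^ i / (1 - r))" .
  qed
  also have "\<dots> = exp (\<Sum>i=1..k. 2 * r ^ i / (1 - r))" by (simp add: exp_sum)
  also have "\<dots> \<le> exp (2 / (1 - r)\<^sup>2)"
  proof -
    have "(\<Sum>i=1..k. r ^ i) \<le> (\<Sum>i<Suc k. r ^ i)" by (intro sum_mono2) (use r in auto)
    also have "\<dots> \<le> (\<Sum>i. r ^ i)" by (rule sum_le_suminf) (use r in auto)
    also have "\<dots> = 1 / (1 - r)" using r by (simp add: suminf_geometric)
    finally have "2 * (\<Sum>i=1..k. r ^ i) / (1 - r) \<le> 2 * (1 / (1 - r)) / (1 - r)"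
      using r by (intro divide_right_mono mult_left_mono) auto
    then show ?thesis by (simp add: power2_eq_square sum_distrib_left sum_divide_distrib)
  qed
  finally show ?thesis .
qed

lemma summable_num_overpartitions:
  fixes r :: real
  assumes r: "0 \<le> r" "r < 1"
  shows "summable (\<lambda>n. num_overpartitions n * r ^ n)"
proof (rule summableI_nonneg_bounded)
  fix N
  \<comment> \<open>Below \<open>N\<close> the bound \<open>N\<close> on the parts is no
    restriction, so the uniform estimate applies with \<open>k = N\<close>.\<close>
  have "(\<Sum>n<N. num_overpartitions n * r ^ n) = (\<Sum>n<N. num_le N n * r ^ n)"
    by (intro sum.cong refl) (auto simp: num_overpartitions_eq_num_le)
  also have "\<dots> \<le> exp (2 / (1 - r)\<^sup>2)"
    using num_le_psum_le[OF r] euler_quot_le[OF r] order_trans by blast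
  finally show "(\<Sum>n<N. num_overpartitions n * r ^ n) \<le> exp (2 / (1 - r)\<^sup>2)" .
qed (use r in auto)

definition ovp_fps :: "complex fps" where
  "ovp_fps = Abs_fps (\<lambda>n. of_nat (num_overpartitions n))"

definition ovp_gf :: "complex \<Rightarrow> complex" where
  "ovp_gf = eval_fps ovp_fps"

lemma ovp_fps_conv_radius: "fps_conv_radius ovp_fps \<ge> 1"
  unfolding fps_conv_radius_def
proof (rule conv_radius_geI_ex)
  fix r :: real assume r: "0 < r" "ereal r < 1"
  have "summable (\<lambda>n. complex_of_real (num_overpartitions n * r ^ n))"
    using summable_num_overpartitions[of r] r by (intro summable_of_real) auto
  then show "\<exists>z. norm z = r \<and> summable (\<lambda>n. fps_nth ovp_fps n * z ^ n)"
    using r by (intro exI[of _ "of_real r"]) (simp add: ovp_fps_def)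
qed

lemma ovp_gf_sums: "norm z < 1 \<Longrightarrow> (\<lambda>n. of_nat (num_overpartitions n) * z ^ n) sums ovp_gf z"
proof -
  assume "norm z < 1"
  then have "ereal (norm z) < fps_conv_radius ovp_fps"
    using ovp_fps_conv_radius by (metis ereal_less(3) less_le_trans)
  from sums_eval_fps[OF this] show ?thesis by (simp add: ovp_gf_def ovp_fps_def)
qed

text \<open>Dominated convergence for series. The passage from products to the generating function,
  Gauss's identity and both sides of the theta transformation are limits of this kind; the last two
  are dominated only from some index \<open>N\<close> on.\<close>

lemma tannery_sequence:
  fixes a :: "nat \<Rightarrow> nat \<Rightarrow> 'a::{real_normed_algebra, banach}"
  assumes "\<And>k. (\<lambda>n. a k n) \<longlonglongrightarrow> b k"
    and "\<And>k n. n \<ge> N \<Longrightarrow> norm (a k n) \<le> M k" and "summable M"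
  shows "summable b" "(\<lambda>n. \<Sum>k. a k n) \<longlonglongrightarrow> suminf b"
proof -
  have "\<forall>\<^sub>F (k, n) in sequentially \<times>\<^sub>F sequentially. norm (a k n) \<le> M k"
    unfolding eventually_prod_filter
    using assms(2) by (intro exI[of _ "\<lambda>_. True"] exI[of _ "\<lambda>n. n \<ge> N"]) (auto simp: eventually_at_top_linorder)
  from tannerys_theorem[OF assms(1) this assms(3)]
  show "summable b" "(\<lambda>n. \<Sum>k. a k n) \<longlonglongrightarrow> suminf b"
    by (auto intro: summable_norm_cancel)
qed

lemma euler_quot_tendsto:
  assumes z: "norm z < 1"
  shows "(\<lambda>k. euler_quot k z) \<longlonglongrightarrow> ovp_gf z"
proof -
  have "((\<lambda>k. \<Sum>n. of_nat (num_le k n) * z ^ n) \<longlonglongrightarrow> (\<Sum>n. of_nat (num_overpartitions n) * z ^ n))"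
  proof (rule tannery_sequence(2)[where M = "\<lambda>n. num_overpartitions n * norm z ^ n" and N = 0])
    show "(\<lambda>k. of_nat (num_le k n) * z ^ n) \<longlonglongrightarrow> of_nat (num_overpartitions n) * z ^ n" for n
      by (rule tendsto_eventually, rule eventually_mono[OF eventually_ge_at_top[of n]])
         (auto simp: num_overpartitions_eq_num_le)
    show "norm (of_nat (num_le n k) * z ^ k) \<le> num_overpartitions k * norm z ^ k" for n k
      by (auto simp: norm_mult norm_power num_le_le_num_overpartitions mult_right_mono)
  qed (use summable_num_overpartitions[of "norm z"] z in auto)
  then show ?thesis using num_le_sums[OF z] ovp_gf_sums[OF z] by (simp add: sums_iff)
qed

section \<open>Gauss's identity\<close>

definition qpoch :: "complex \<Rightarrow> nat \<Rightarrow> complex" where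
  "qpoch q n = (\<Prod>i=1..n. 1 - q ^ i)"

lemma qpoch_0 [simp]: "qpoch q 0 = 1" by (simp add: qpoch_def)

lemma qpoch_Suc: "qpoch q (Suc n) = qpoch q n * (1 - q ^ Suc n)"
  by (simp add: qpoch_def)

lemma qpoch_nz: "norm q < 1 \<Longrightarrow> qpoch q n \<noteq> 0"
  using one_minus_power_nz[of q] by (force simp: qpoch_def)

definition int_sign :: "int \<Rightarrow> complex" where
  "int_sign r = (if even r then 1 else -1)"

lemma sum_int_reflect:
  fixes f :: "int \<Rightarrow> 'a::comm_monoid_add"
  shows "(\<Sum>r\<in>{a..b}. f r) = (\<Sum>r\<in>{a..b}. f (a + b - r))"
  by (rule sum.reindex_bij_witness[where i = "\<lambda>r. a + b - r" and j = "\<lambda>r. a + b - r"]) auto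

lemma sum_int_even:
  fixes f :: "int \<Rightarrow> complex"
  assumes "\<And>r. 0 \<le> r \<Longrightarrow> r \<le> int n \<Longrightarrow> f (- r) = f r"
  shows "(\<Sum>r\<in>{-int n..int n}. f r) = f 0 + 2 * (\<Sum>k<n. f (int (Suc k)))"
  using assms
proof (induction n)
  case (Suc n)
  have "{-int (Suc n)..int (Suc n)} = insert (int (Suc n)) (insert (- int (Suc n)) {-int n..int n})" by auto
  then have "(\<Sum>r\<in>{-int (Suc n)..int (Suc n)}. f r) = 2 * f (int (Suc n)) + (\<Sum>r\<in>{-int n..int n}. f r)"
    unfolding \<open>_ = insert _ _\<close> by (subst sum.insert; (subst sum.insert)?) (use Suc.prems[of "int (Suc n)"] in \<open>auto simp del: of_nat_Suc\<close>)
  moreover have "(\<Sum>r\<in>{-int n..int n}. f r) = f 0 + 2 * (\<Sum>k<n. f (int (Suc k)))"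
    using Suc.prems by (intro Suc.IH) auto
  ultimately show ?case by (simp add: algebra_simps)
qed auto

context
  fixes q :: complex
  assumes q: "norm q < 1"
begin

text \<open>Multiplied by \<open>qpoch q (2 * n)\<close>, this is the Gaussian binomial coefficient
  of 2 n over n + r with weight (-1)^r q^(r^2). It is meaningful for |r| <= n only, since
  \<open>nat\<close> truncates negative arguments.\<close>

definition gauss_term :: "nat \<Rightarrow> int \<Rightarrow> complex" where
  "gauss_term n r = int_sign r * q ^ nat (r * r) / (qpoch q (nat (int n - r)) * qpoch q (nat (int n + r)))"

lemma qpoch_nat_step: "k > 0 \<Longrightarrow> qpoch q (nat k) = qpoch q (nat (k - 1)) * (1 - q ^ nat k)"
proof -
  assume "k > 0"
  then have "nat k = Suc (nat (k - 1))" by simp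
  then show ?thesis by (simp only: qpoch_Suc)
qed

text \<open>The summand is odd under \<open>r \<mapsto> 1 - r\<close>, apart from its vanishing term at \<open>r = - n\<close>.\<close>

lemma gauss_term_antisym:
  "(\<Sum>r\<in>{-int n..int n}. gauss_term n r * (q ^ nat (int n - r) * (1 - q ^ nat (int n + r)))) = 0"
  (is "(\<Sum>r\<in>_. ?U r) = 0")
proof -
  \<comment> \<open>\<open>V\<close> is \<open>?U\<close> with 1 - q^(n+r) cancelled against the
    last factor of the second \<open>qpoch\<close>. Under r -> 1 - r the exponent stays fixed and
    the two \<open>qpoch\<close> trade places, so only the sign changes.\<close>
  define V where "V = (\<lambda>r::int. int_sign r * q ^ nat (r * r - r + int n) / (qpoch q (nat (int n - r)) * qpoch q (nat (int n + r - 1))))"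
  have UV: "?U r = V r" if r: "r \<in> {1 - int n..int n}" for r
  proof -
    have "q ^ nat (r * r) * q ^ nat (int n - r) = q ^ nat (r * r - r + int n)"
      using r by (simp flip: power_add nat_add_distrib add: algebra_simps)
    moreover have "qpoch q (nat (int n + r)) = qpoch q (nat (int n + r - 1)) * (1 - q ^ nat (int n + r))"
      using r by (intro qpoch_nat_step) auto
    moreover have "1 - q ^ nat (int n + r) \<noteq> 0" using r by (intro one_minus_power_nz q) auto
    ultimately have "?U r = int_sign r * (q ^ nat (r * r) * q ^ nat (int n - r)) /
        (qpoch q (nat (int n - r)) * qpoch q (nat (int n + r - 1)))"
      by (simp add: gauss_term_def mult_ac)
    also have "\<dots> = V r"
      unfolding \<open>q ^ nat (r * r) * q ^ nat (int n - r) = _\<close> by (simp add: V_def)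
    finally show ?thesis .
  qed
  have "(\<Sum>r\<in>{-int n..int n}. ?U r) = (\<Sum>r\<in>{1-int n..int n}. ?U r)"
  proof (cases "n = 0")
    case False
    show ?thesis
    proof (rule sum.mono_neutral_right)
      show "\<forall>i\<in>{- int n..int n} - {1 - int n..int n}. ?U i = 0"
      proof
        fix i assume "i \<in> {- int n..int n} - {1 - int n..int n}"
        then have "i = - int n" by auto
        then show "?U i = 0" by simp
      qed
    qed auto
  qed auto
  also have "\<dots> = (\<Sum>r\<in>{1-int n..int n}. V r)" by (intro sum.cong UV) auto
  also have "\<dots> = 0"
  proof -
    have "V (1 - r) = - V r" for r
    proof -
      have "(1 - r) * (1 - r) - (1 - r) = r * r - r" by (simp add: algebra_simps)
      then show ?thesis by (auto simp: V_def int_sign_def mult.commute algebra_simps)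
    qed
    then have "(\<Sum>r\<in>{1-int n..int n}. V r) = - (\<Sum>r\<in>{1-int n..int n}. V r)"
      by (subst sum_int_reflect) (simp add: sum_negf)
    then show ?thesis by simp
  qed
  finally show ?thesis .
qed

text \<open>Multiplying the summand by (1 - a)(1 - b), with a = q^(n-r) and b = q^(n+r), lowers n by
  one. As a b = q^(2n), this factor equals 1 - q^(2n) - a (1 - b) - b (1 - a), and the last two
  corrections sum to zero by antisymmetry. So the sum for n times 1 - q^(2n) is the sum for n -
  1.\<close>

lemma gauss_term_sum:
  "(\<Sum>r\<in>{-int n..int n}. gauss_term n r) = 1 / (\<Prod>i=1..n. 1 - q ^ (2 * i))"
proof (induction n)
  case 0
  show ?case by (simp add: gauss_term_def int_sign_def)
next
  case (Suc m)
  define n where "n = Suc m"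
  let ?I = "{-int n..int n}"
  have step: "gauss_term n r * ((1 - q ^ nat (int n - r)) * (1 - q ^ nat (int n + r))) =
      (if r \<in> {-int m..int m} then gauss_term m r else 0)" if r: "r \<in> ?I" for r
  proof (cases "r \<in> {-int m..int m}")
    case True
    have "qpoch q (nat (int n + r)) = qpoch q (nat (int m + r)) * (1 - q ^ nat (int n + r))"
         "qpoch q (nat (int n - r)) = qpoch q (nat (int m - r)) * (1 - q ^ nat (int n - r))"
      using qpoch_nat_step[of "int n + r"] qpoch_nat_step[of "int n - r"] True by (auto simp: n_def)
    moreover have "1 - q ^ nat (int n + r) \<noteq> 0" "1 - q ^ nat (int n - r) \<noteq> 0"
      using True by (intro one_minus_power_nz q; simp add: n_def)+
    ultimately show ?thesis using True qpoch_nz[OF q] by (simp add: gauss_term_def)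
  next
    case False
    then have "r = int n \<or> r = - int n" using r by (auto simp: n_def)
    then show ?thesis using False by auto
  qed
  have pw: "q ^ nat (int n - r) * q ^ nat (int n + r) = q ^ (2 * n)" if "r \<in> ?I" for r
    using that by (simp flip: power_add nat_add_distrib) (simp add: nat_mult_distrib)
  have reflect: "(\<Sum>r\<in>?I. f r) = (\<Sum>r\<in>?I. f (- r))" for f :: "int \<Rightarrow> complex"
    using sum_int_reflect[of f "- int n" "int n"] by simp
  have sym: "gauss_term n (- r) = gauss_term n r" for r
    by (simp add: gauss_term_def int_sign_def mult.commute)
  have "(\<Sum>r\<in>?I. gauss_term n r * (q ^ nat (int n + r) * (1 - q ^ nat (int n - r)))) = 0"
    using gauss_term_antisym[of n] by (subst reflect) (simp add: sym)
  then have "(\<Sum>r\<in>?I. gauss_term n r) * (1 - q ^ (2 * n)) =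
      (\<Sum>r\<in>?I. gauss_term n r) * (1 - q ^ (2 * n))
       - (\<Sum>r\<in>?I. gauss_term n r * (q ^ nat (int n - r) * (1 - q ^ nat (int n + r))))
       - (\<Sum>r\<in>?I. gauss_term n r * (q ^ nat (int n + r) * (1 - q ^ nat (int n - r))))"
    using gauss_term_antisym[of n] by simp
  also have "\<dots> = (\<Sum>r\<in>?I. gauss_term n r * (1 - q ^ (2 * n)
       - q ^ nat (int n - r) * (1 - q ^ nat (int n + r)) - q ^ nat (int n + r) * (1 - q ^ nat (int n - r))))"
    unfolding sum_distrib_right sum_subtractf[symmetric]
    by (rule sum.cong[OF refl]) algebra
  also have "\<dots> = (\<Sum>r\<in>?I. gauss_term n r * ((1 - q ^ nat (int n - r)) * (1 - q ^ nat (int n + r))))"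
  proof (intro sum.cong refl)
    fix r assume "r \<in> ?I"
    from pw[OF this] show "gauss_term n r * (1 - q ^ (2 * n)
       - q ^ nat (int n - r) * (1 - q ^ nat (int n + r)) - q ^ nat (int n + r) * (1 - q ^ nat (int n - r)))
       = gauss_term n r * ((1 - q ^ nat (int n - r)) * (1 - q ^ nat (int n + r)))"
      by (intro arg_cong[of _ _ "\<lambda>x. _ * x"]) (simp add: algebra_simps)
  qed
  also have "\<dots> = (\<Sum>r\<in>?I. if r \<in> {-int m..int m} then gauss_term m r else 0)"
    by (intro sum.cong refl step)
  also have "\<dots> = (\<Sum>r\<in>{-int m..int m}. gauss_term m r)"
    by (intro sum.mono_neutral_cong_right) (auto simp: n_def)
  finally have "(\<Sum>r\<in>?I. gauss_term n r) * (1 - q ^ (2 * n)) = 1 / (\<Prod>i=1..m. 1 - q ^ (2 * i))"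
    unfolding Suc.IH .
  moreover have "1 - q ^ (2 * n) \<noteq> 0" by (intro one_minus_power_nz q) (auto simp: n_def)
  ultimately have "(\<Sum>r\<in>?I. gauss_term n r) = 1 / (\<Prod>i=1..m. 1 - q ^ (2 * i)) / (1 - q ^ (2 * n))"
    by (metis nonzero_mult_div_cancel_right)
  then show ?case by (simp add: n_def del: power_Suc)
qed

text \<open>Multiplying by \<open>(qpoch q n)\<^sup>2\<close> normalises the middle term to 1, pairs
  r with -r, and turns the product side into the product of (1 - q^i) / (1 + q^i).\<close>

lemma gauss_finite:
  "1 + 2 * (\<Sum>k<n. (-1) ^ Suc k * q ^ (Suc k)\<^sup>2 * (qpoch q n)\<^sup>2 / (qpoch q (n - Suc k) * qpoch q (n + Suc k)))
    = 1 / euler_quot n q"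
proof -
  define P where "P = (\<Prod>i=1..n. 1 - q ^ (2 * i))"
  have sgn: "int_sign (int (Suc k)) = (-1) ^ Suc k" for k
    by (cases "even k") (auto simp: int_sign_def)
  have "(qpoch q n)\<^sup>2 * (\<Sum>r\<in>{-int n..int n}. gauss_term n r) = (qpoch q n)\<^sup>2 *
     (gauss_term n 0 + 2 * (\<Sum>k<n. gauss_term n (int (Suc k))))"
    by (subst sum_int_even) (auto simp: gauss_term_def int_sign_def mult.commute)
  also have "\<dots> = 1 + 2 * (\<Sum>k<n. (qpoch q n)\<^sup>2 * gauss_term n (int (Suc k)))"
    using qpoch_nz[OF q, of n] by (simp add: gauss_term_def int_sign_def ring_distribs sum_distrib_left mult_ac power2_eq_square)
  also have "(\<Sum>k<n. (qpoch q n)\<^sup>2 * gauss_term n (int (Suc k))) =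
     (\<Sum>k<n. (-1) ^ Suc k * q ^ (Suc k)\<^sup>2 * (qpoch q n)\<^sup>2 / (qpoch q (n - Suc k) * qpoch q (n + Suc k)))"
  proof (intro sum.cong refl)
    fix k assume k: "k \<in> {..<n}"
    have "nat (int n - int (Suc k)) = n - Suc k" "nat (int n + int (Suc k)) = n + Suc k"
         "nat (int (Suc k) * int (Suc k)) = (Suc k)\<^sup>2"
      by (simp only: nat_diff_distrib nat_int nat_int_add of_nat_mult[symmetric] power2_eq_square)+
    then show "(qpoch q n)\<^sup>2 * gauss_term n (int (Suc k)) =
      (-1) ^ Suc k * q ^ (Suc k)\<^sup>2 * (qpoch q n)\<^sup>2 / (qpoch q (n - Suc k) * qpoch q (n + Suc k))"
      unfolding gauss_term_def sgn by (simp only: times_divide_eq_right mult_ac)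
  qed
  also have "(qpoch q n)\<^sup>2 * (\<Sum>r\<in>{-int n..int n}. gauss_term n r) = (\<Prod>i=1..n. (1 - q ^ i) ^ 2 / (1 - q ^ (2 * i)))"
    by (subst gauss_term_sum) (simp add: qpoch_def prod_dividef prod_power_distrib)
  also have "\<dots> = (\<Prod>i=1..n. inverse ((1 + q ^ i) / (1 - q ^ i)))"
  proof (intro prod.cong refl)
    fix i assume "i \<in> {1..n}"
    then have "1 - q ^ i \<noteq> 0" by (intro one_minus_power_nz q) auto
    moreover have "1 - q ^ (2 * i) = (1 - q ^ i) * (1 + q ^ i)"
      by (simp only: mult_2 power_add) (simp add: algebra_simps)
    ultimately show "(1 - q ^ i)\<^sup>2 / (1 - q ^ (2 * i)) = inverse ((1 + q ^ i) / (1 - q ^ i))"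
      by (simp add: power2_eq_square)
  qed
  also have "\<dots> = 1 / euler_quot n q" unfolding euler_quot_def inverse_eq_divide[of "prod _ _", symmetric] by (rule prod_inversef[unfolded o_def])
  finally show ?thesis by simp
qed

lemma qpoch_tendsto: "\<exists>L. qpoch q \<longlonglongrightarrow> L \<and> L \<noteq> 0"
proof -
  have "summable (\<lambda>i. norm (q ^ Suc i))"
    using q summable_geometric[of "norm q"] by (simp add: norm_mult norm_power summable_mult)
  then have "abs_convergent_prod (\<lambda>i. 1 - q ^ Suc i)"
    by (subst abs_convergent_prod_conv_summable) simp
  then have "convergent_prod (\<lambda>i. 1 - q ^ Suc i)"
    by (rule abs_convergent_prod_imp_convergent_prod)
  moreover have "1 - q ^ Suc i \<noteq> 0" for i by (intro one_minus_power_nz q) auto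
  ultimately obtain L where L: "(\<lambda>n. \<Prod>i\<le>n. 1 - q ^ Suc i) \<longlonglongrightarrow> L" "L \<noteq> 0"
    using convergent_prod_iff_nz_lim[of "\<lambda>i. 1 - q ^ Suc i"] by blast
  have "(\<Prod>i\<le>n. 1 - q ^ Suc i) = qpoch q (Suc n)" for n
    unfolding qpoch_def lessThan_Suc_atMost[symmetric]
    by (rule prod.reindex_bij_witness[of _ "\<lambda>i. i - 1" Suc]) auto
  then show ?thesis using L filterlim_sequentially_Suc[of "qpoch q" "nhds L"] by auto
qed

lemma summable_power_square: "summable (\<lambda>k. norm q ^ (Suc k)\<^sup>2)"
proof (rule summable_comparison_test'[where N = 0])
  show "norm (norm q ^ (Suc k)\<^sup>2) \<le> norm q ^ k" for k
  proof -
    have "k \<le> (Suc k)\<^sup>2" by (simp add: power2_eq_square)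
    then show ?thesis using q by (simp add: power_decreasing)
  qed
qed (use q in simp)

text \<open>Since \<open>qpoch q\<close> has a nonzero limit \<open>L\<close>, each quotient tends
  to L^2 / (L L) = 1. Both \<open>qpoch q\<close> and its inverse are bounded, so the terms are
  dominated by a multiple of |q|^((k+1)^2).\<close>

lemma gauss_limit:
  "(\<lambda>n. \<Sum>k<n. (-1) ^ Suc k * q ^ (Suc k)\<^sup>2 * (qpoch q n)\<^sup>2 / (qpoch q (n - Suc k) * qpoch q (n + Suc k)))
     \<longlonglongrightarrow> (\<Sum>k. (-1) ^ Suc k * q ^ (Suc k)\<^sup>2)"
proof -
  define a where "a = (\<lambda>k n. if k < n then (-1) ^ Suc k * q ^ (Suc k)\<^sup>2 *
     ((qpoch q n)\<^sup>2 / (qpoch q (n - Suc k) * qpoch q (n + Suc k))) else 0)"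
  obtain L where L: "qpoch q \<longlonglongrightarrow> L" "L \<noteq> 0" using qpoch_tendsto by blast
  obtain B where B: "\<And>n. norm (qpoch q n) \<le> B"
    using convergent_imp_Bseq[OF convergentI[OF L(1)]] unfolding Bseq_def by blast
  have "(\<lambda>n. inverse (qpoch q n)) \<longlonglongrightarrow> inverse L" by (intro tendsto_inverse L)
  from convergent_imp_Bseq[OF convergentI[OF this]]
  obtain C where C: "\<And>n. norm (inverse (qpoch q n)) \<le> C" unfolding Bseq_def by blast
  have B0: "B \<ge> 0" "C \<ge> 0" using B[of 0] C[of 0] norm_ge_zero order_trans by blast+
  have "(\<lambda>n. \<Sum>k. a k n) \<longlonglongrightarrow> (\<Sum>k. (-1) ^ Suc k * q ^ (Suc k)\<^sup>2)"
  proof (rule tannery_sequence(2)[where N = 0 and M = "\<lambda>k. norm q ^ (Suc k)\<^sup>2 * (B\<^sup>2 * (C * C))"])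
    fix k
    have "(\<lambda>n. qpoch q (n - Suc k)) \<longlonglongrightarrow> L" "(\<lambda>n. qpoch q (n + Suc k)) \<longlonglongrightarrow> L"
      using LIMSEQ_offset[of "\<lambda>n. qpoch q (n - Suc k)" "Suc k" L] L(1) LIMSEQ_ignore_initial_segment[OF L(1), of "Suc k"]
      by auto
    then have "(\<lambda>n. (-1) ^ Suc k * q ^ (Suc k)\<^sup>2 *
     ((qpoch q n)\<^sup>2 / (qpoch q (n - Suc k) * qpoch q (n + Suc k)))) \<longlonglongrightarrow> (-1) ^ Suc k * q ^ (Suc k)\<^sup>2 * (L\<^sup>2 / (L * L))"
      using L by (intro tendsto_intros) auto
    then have *: "(\<lambda>n. (-1) ^ Suc k * q ^ (Suc k)\<^sup>2 *
     ((qpoch q n)\<^sup>2 / (qpoch q (n - Suc k) * qpoch q (n + Suc k)))) \<longlonglongrightarrow> (-1) ^ Suc k * q ^ (Suc k)\<^sup>2"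
      using L(2) by (simp add: power2_eq_square)
    show "(\<lambda>n. a k n) \<longlonglongrightarrow> (-1) ^ Suc k * q ^ (Suc k)\<^sup>2"
      by (rule Lim_transform_eventually[OF *], rule eventually_mono[OF eventually_gt_at_top[of k]])
         (simp add: a_def)
  next
    fix k n
    have "norm (a k n) \<le> norm q ^ (Suc k)\<^sup>2 * norm ((qpoch q n)\<^sup>2 * (inverse (qpoch q (n - Suc k)) * inverse (qpoch q (n + Suc k))))"
      by (simp add: a_def norm_mult norm_divide norm_power norm_inverse divide_inverse)
    also have "\<dots> \<le> norm q ^ (Suc k)\<^sup>2 * (B\<^sup>2 * (C * C))"
      unfolding norm_mult norm_power by (intro mult_left_mono mult_mono power_mono B C mult_nonneg_nonneg zero_le_power) (use B0 in auto)
    finally show "norm (a k n) \<le> norm q ^ (Suc k)\<^sup>2 * (B\<^sup>2 * (C * C))" .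
  qed (intro summable_mult2 summable_power_square)
  moreover have "(\<Sum>k. a k n) = (\<Sum>k<n. (-1) ^ Suc k * q ^ (Suc k)\<^sup>2 * (qpoch q n)\<^sup>2 / (qpoch q (n - Suc k) * qpoch q (n + Suc k)))" for n
    by (subst suminf_finite[where N = "{..<n}"]) (auto simp: a_def)
  ultimately show ?thesis by simp
qed

theorem gauss_identity:
  "(1 + 2 * (\<Sum>k. (-1) ^ Suc k * q ^ (Suc k)\<^sup>2)) * ovp_gf q = 1"
proof -
  let ?E = "\<lambda>n. 1 + 2 * (\<Sum>k<n. (-1) ^ Suc k * q ^ (Suc k)\<^sup>2 * (qpoch q n)\<^sup>2 / (qpoch q (n - Suc k) * qpoch q (n + Suc k)))"
  have "(\<lambda>n. ?E n * euler_quot n q) \<longlonglongrightarrow> (1 + 2 * (\<Sum>k. (-1) ^ Suc k * q ^ (Suc k)\<^sup>2)) * ovp_gf q"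
    by (intro tendsto_intros gauss_limit euler_quot_tendsto q)
  moreover have "?E n * euler_quot n q = (if euler_quot n q = 0 then 0 else 1)" for n
    unfolding gauss_finite by simp
  moreover have "euler_quot n q \<noteq> 0" for n
  proof -
    have "1 + q ^ i \<noteq> 0" if "i > 0" for i
      using norm_power_lt_1[OF q that] by (metis add_eq_0_iff norm_minus_cancel norm_one less_irrefl)
    then show ?thesis using one_minus_power_nz[OF q] by (auto simp: euler_quot_def)
  qed
  ultimately have "(\<lambda>n. 1 :: complex) \<longlonglongrightarrow> (1 + 2 * (\<Sum>k. (-1) ^ Suc k * q ^ (Suc k)\<^sup>2)) * ovp_gf q"
    by simp
  then show ?thesis using LIMSEQ_unique tendsto_const by blast
qed

end

section \<open>The theta transformation\<close>

lemma cis_pi_int: "cis (pi * of_int n) = int_sign n"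
  by (simp add: complex_eq_iff int_sign_def)

text \<open>If \<open>l\<close> divides \<open>d\<close>, all terms equal (-1)^(d/l); otherwise the
  sum is a constant times a full geometric sum of a nontrivial \<open>l\<close>-th root of unity.
  Odd multiples of pi / l are used because they produce the alternating signs of the theta
  series.\<close>

lemma sum_cis_odd:
  fixes d :: int
  assumes l: "l \<ge> 1"
  shows "(\<Sum>k<l. cis (pi * real (2 * k + 1) / real l * of_int d)) =
    (if int l dvd d then of_nat l * int_sign (d div int l) else 0)"
proof (cases "int l dvd d")
  case True
  then obtain e where e: "d = int l * e" by blast
  have "cis (pi * real (2 * k + 1) / real l * of_int d) = int_sign e" for k
  proof -
    have "pi * real (2 * k + 1) / real l * of_int d = pi * of_int (int (2 * k + 1) * e)"
      using l by (simp add: e)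
    then have "cis (pi * real (2 * k + 1) / real l * of_int d) = int_sign (int (2 * k + 1) * e)"
      by (simp only: cis_pi_int)
    also have "\<dots> = int_sign e" by (simp add: int_sign_def)
    finally show ?thesis .
  qed
  then show ?thesis using e l by simp
next
  case False
  define w where "w = cis (2 * pi * of_int d / real l)"
  have "w \<noteq> 1"
  proof
    assume "w = 1"
    then have "cos (2 * pi * of_int d / real l) = 1" by (simp add: w_def complex_eq_iff)
    then obtain n :: int where "2 * pi * of_int d / real l = of_int n * 2 * pi" using cos_one_2pi_int by blast
    then have "real_of_int d = of_int (int l * n)" using l by (simp add: field_simps)
    then have "d = int l * n" by (simp only: of_int_eq_iff)
    with False show False by simp
  qed
  moreover have "w ^ l = 1"
  proof -
    have "w ^ l = cis (pi * of_int (2 * d))"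
      using l unfolding w_def Complex.DeMoivre by (intro arg_cong[of _ _ cis]) simp
    then show ?thesis unfolding cis_pi_int by (simp add: int_sign_def)
  qed
  ultimately have "(\<Sum>k<l. w ^ k) = 0" by (simp add: sum_gp_strict)
  have "(\<Sum>k<l. cis (pi * real (2 * k + 1) / real l * of_int d)) = (\<Sum>k<l. cis (pi * of_int d / real l) * w ^ k)"
  proof (intro sum.cong refl)
    fix k
    have "pi * real (2 * k + 1) / real l * of_int d = pi * of_int d / real l + real k * (2 * pi * of_int d / real l)"
      by (simp add: ring_distribs add_divide_distrib mult_ac)
    then show "cis (pi * real (2 * k + 1) / real l * of_int d) = cis (pi * of_int d / real l) * w ^ k"
      unfolding w_def Complex.DeMoivre by (simp only: cis_mult)
  qed
  also have "\<dots> = 0" unfolding sum_distrib_left[symmetric] \<open>(\<Sum>k<l. w ^ k) = 0\<close> by simp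
  finally show ?thesis using False by simp
qed

text \<open>Binomial expansion of (e^(ix/2) + e^(-ix/2))^(2m). The even exponent keeps the
  frequencies \<open>d\<close> integral although the angle is halved.\<close>

lemma two_cos_power:
  "complex_of_real ((2 * cos (x / 2)) ^ (2 * m)) =
     (\<Sum>d\<in>{-int m..int m}. of_nat ((2 * m) choose nat (int m + d)) * cis (x * of_int d))"
proof -
  have "complex_of_real (2 * cos (x / 2)) = cis (x / 2) + cis (- (x / 2))"
    by (simp add: complex_eq_iff)
  then have "complex_of_real ((2 * cos (x / 2)) ^ (2 * m)) = (cis (x / 2) + cis (- (x / 2))) ^ (2 * m)"
    by (simp only: of_real_power)
  also have "\<dots> = (\<Sum>a\<le>2 * m. of_nat ((2 * m) choose a) * cis (x / 2) ^ a * cis (- (x / 2)) ^ (2 * m - a))"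
    by (rule binomial_ring)
  also have "\<dots> = (\<Sum>d\<in>{-int m..int m}. of_nat ((2 * m) choose nat (int m + d)) * cis (x * of_int d))"
  proof (rule sum.reindex_bij_witness[of _ "\<lambda>d. nat (int m + d)" "\<lambda>a. int a - int m"])
    fix a assume a: "a \<in> {..2 * m}"
    have "real a * (x / 2) + real (2 * m - a) * - (x / 2) = x * of_int (int a - int m)"
      using a by (simp add: of_nat_diff algebra_simps)
    moreover have "nat (int m + (int a - int m)) = a" by simp
    ultimately show "of_nat ((2 * m) choose nat (int m + (int a - int m))) * cis (x * of_int (int a - int m)) =
      of_nat ((2 * m) choose a) * cis (x / 2) ^ a * cis (- (x / 2)) ^ (2 * m - a)"
      unfolding Complex.DeMoivre by (simp only: cis_mult mult.assoc)
  qed auto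
  finally show ?thesis .
qed

lemma sum_multiples:
  fixes f :: "nat \<Rightarrow> 'a::comm_monoid_add"
  assumes l: "l \<ge> 1" and f: "\<And>k. k > m \<Longrightarrow> f k = 0"
  shows "(\<Sum>k<m. if l dvd Suc k then f (Suc k) else 0) = (\<Sum>j<m. f (l * Suc j))"
proof -
  have "(\<Sum>k<m. if l dvd Suc k then f (Suc k) else 0) = (\<Sum>k\<in>{k. k < m \<and> l dvd Suc k}. f (Suc k))"
    by (intro sum.mono_neutral_cong_right) auto
  also have "\<dots> = (\<Sum>j\<in>{j. l * Suc j \<le> m}. f (l * Suc j))"
  proof (rule sum.reindex_bij_witness[of _ "\<lambda>j. l * Suc j - 1" "\<lambda>k. Suc k div l - 1"])
    fix k assume "k \<in> {k. k < m \<and> l dvd Suc k}"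
    then obtain c where c: "Suc k = l * c" "k < m" by auto
    have "c > 0" using c(1) by (cases c) auto
    then have "l * Suc (Suc k div l - 1) = Suc k" using l c(1) by simp
    then show "l * Suc (Suc k div l - 1) - 1 = k" "Suc k div l - 1 \<in> {j. l * Suc j \<le> m}"
      "f (l * Suc (Suc k div l - 1)) = f (Suc k)" using c(2) by simp_all
  next
    fix j assume j: "j \<in> {j. l * Suc j \<le> m}"
    have "Suc (l * Suc j - 1) = l * Suc j" using l by simp
    then show "Suc (l * Suc j - 1) div l - 1 = j" "l * Suc j - 1 \<in> {k. k < m \<and> l dvd Suc k}"
      using j l by auto
  qed
  also have "\<dots> = (\<Sum>j<m. f (l * Suc j))"
  proof (intro sum.mono_neutral_left)
    have "Suc j \<le> l * Suc j" for j using l by (metis mult_le_mono1 nat_mult_1)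
    then show "{j. l * Suc j \<le> m} \<subseteq> {..<m}" by (auto simp: Suc_le_eq intro: less_le_trans)
  qed (use f in auto)
  finally show ?thesis .
qed

text \<open>The finite form of the theta transformation. Summed over the \<open>l\<close> angles,
  the expansion of the cosine powers keeps only the frequencies divisible by \<open>l\<close>. When
  \<open>m\<close> grows like l^2, the left side becomes the dual Gaussian series and the binomial
  coefficients on the right, divided by the central one, become Gaussians as well.\<close>

lemma choose_cos_identity:
  assumes l: "l \<ge> 1"
  shows "(\<Sum>k<l. (2 * cos (pi * real (2 * k + 1) / real l / 2)) ^ (2 * m)) =
    real l * (real ((2 * m) choose m) + 2 * (\<Sum>j<m. (-1) ^ Suc j * real ((2 * m) choose (m + l * Suc j))))"
proof -
  define F where "F = (\<lambda>d. of_nat ((2 * m) choose nat (int m + d)) *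
    (if int l dvd d then of_nat l * int_sign (d div int l) else (0::complex)))"
  have Feven: "F (- d) = F d" if d: "0 \<le> d" "d \<le> int m" for d
  proof -
    have "nat (int m - d) = 2 * m - nat (int m + d)" "nat (int m + d) \<le> 2 * m" using d by auto
    then have "(2 * m) choose nat (int m - d) = (2 * m) choose nat (int m + d)"
      using binomial_symmetric by metis
    moreover have "int_sign (- d div int l) = int_sign (d div int l)" if "int l dvd d"
      using that l by (auto simp: int_sign_def dvd_neg_div)
    ultimately show ?thesis by (simp add: F_def)
  qed
  have "complex_of_real (\<Sum>k<l. (2 * cos (pi * real (2 * k + 1) / real l / 2)) ^ (2 * m)) =
     (\<Sum>k<l. (\<Sum>d\<in>{-int m..int m}. of_nat ((2 * m) choose nat (int m + d)) * cis (pi * real (2 * k + 1) / real l * of_int d)))"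
    unfolding of_real_sum two_cos_power ..
  also have "\<dots> = (\<Sum>d\<in>{-int m..int m}. F d)"
    unfolding F_def sum_cis_odd[OF l, symmetric] by (subst sum.swap) (simp only: sum_distrib_left)
  also have "\<dots> = F 0 + 2 * (\<Sum>k<m. F (int (Suc k)))"
    by (rule sum_int_even) (rule Feven)
  also have "F 0 = of_nat l * of_nat ((2 * m) choose m)" by (simp add: F_def int_sign_def)
  also have "(\<Sum>k<m. F (int (Suc k))) = (\<Sum>k<m. if l dvd Suc k then
     of_nat l * (int_sign (int (Suc k div l)) * of_nat ((2 * m) choose (m + Suc k))) else 0)"
  proof (intro sum.cong refl)
    fix k
    have "nat (int m + int (Suc k)) = m + Suc k" by simp
    then show "F (int (Suc k)) = (if l dvd Suc k then
     of_nat l * (int_sign (int (Suc k div l)) * of_nat ((2 * m) choose (m + Suc k))) else 0)"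
      unfolding F_def int_dvd_int_iff zdiv_int by (simp del: of_nat_Suc)
  qed
  also have "\<dots> = (\<Sum>j<m. of_nat l * (int_sign (int (l * Suc j div l)) * of_nat ((2 * m) choose (m + l * Suc j))))"
    by (rule sum_multiples[OF l]) simp
  also have "\<dots> = of_real (real l * (\<Sum>j<m. (-1) ^ Suc j * real ((2 * m) choose (m + l * Suc j))))"
  proof -
    have "l * Suc j div l = Suc j" for j using l by simp
    moreover have "int_sign (int (Suc j)) = (-1) ^ Suc j" for j
      by (cases "even j") (auto simp: int_sign_def)
    ultimately show ?thesis by (simp only: of_real_mult of_real_sum sum_distrib_left of_real_power) simp
  qed
  also have "of_nat l * of_nat ((2 * m) choose m) + 2 * \<dots> = complex_of_real (real l * (real ((2 * m) choose m) + 2 * (\<Sum>j<m. (-1) ^ Suc j * real ((2 * m) choose (m + l * Suc j)))))"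
    by (simp add: ring_distribs)
  finally show ?thesis by (simp only: of_real_eq_iff)
qed

section \<open>Asymptotics of binomial coefficients and of cosine powers\<close>

lemma central_choose_wallis:
  "real ((2 * n) choose n) ^ 2 * (\<Prod>k=1..n. (4*real k^2) / (4*real k^2 - 1)) * (2 * real n + 1) = 16 ^ n"
proof (induction n)
  case (Suc n)
  define C where "C = real ((2 * n) choose n)"
  have "Suc n * ((2 * Suc n) choose Suc n) = 2 * (2 * n + 1) * ((2 * n) choose n)"
  proof -
    have "Suc n * ((2 * n + 2) choose Suc n) = (2 * n + 2) * ((2 * n + 1) choose n)"
      using Suc_times_binomial[of n "2 * n + 1"] by simp
    moreover have "Suc n * ((2 * n + 1) choose n) = (2 * n + 1) * ((2 * n) choose n)"
      using Suc_times_binomial_add[of n n] binomial_symmetric[of n "2*n+1"] Suc_times_binomial[of n "2 * n"] by simp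
    ultimately have "Suc n * (Suc n * ((2 * n + 2) choose Suc n)) = Suc n * (2 * (2 * n + 1) * ((2 * n) choose n))"
      by (simp add: algebra_simps)
    then show ?thesis by (simp only: mult_left_cancel[OF Suc_neq_Zero] nat_mult_eq_cancel1[OF zero_less_Suc]) simp
  qed
  then have "real (Suc n) * real ((2 * Suc n) choose Suc n) = 2 * (2 * real n + 1) * C"
    unfolding C_def by (metis (no_types, opaque_lifting) of_nat_mult of_nat_add of_nat_numeral of_nat_1)
  then have "real ((2 * Suc n) choose Suc n) = 2 * (2 * real n + 1) * C / (real n + 1)" by (simp add: field_simps)
  then have "real ((2 * Suc n) choose Suc n) ^ 2 * (\<Prod>k=1..Suc n. (4*real k^2) / (4*real k^2 - 1)) * (2 * real (Suc n) + 1)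
    = (2 * (2 * real n + 1) * C / (real n + 1))\<^sup>2 * ((\<Prod>k=1..n. (4*real k^2) / (4*real k^2 - 1)) * ((4*real (Suc n)^2) / (4*real (Suc n)^2 - 1))) * (2 * real (Suc n) + 1)"
    by simp
  also have "4 * real (Suc n)^2 - 1 = (2 * real n + 1) * (2 * real n + 3)" by (simp add: power2_eq_square algebra_simps)
  also have "(2 * (2 * real n + 1) * C / (real n + 1))\<^sup>2 * ((\<Prod>k=1..n. (4*real k^2) / (4*real k^2 - 1)) * ((4*real (Suc n)^2) / ((2 * real n + 1) * (2 * real n + 3)))) * (2 * real (Suc n) + 1)
     = 16 * (C\<^sup>2 * (\<Prod>k=1..n. (4*real k^2) / (4*real k^2 - 1)) * (2 * real n + 1))"
  proof -
    have "(2 * u * C / w)\<^sup>2 * (P * ((4 * w\<^sup>2) / (u * v))) * v = 16 * (C\<^sup>2 * P * u)"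
      if "u \<noteq> 0" "v \<noteq> 0" "w \<noteq> 0" for u v w P :: real
      using that by (simp add: field_simps power2_eq_square)
    from this[of "2 * real n + 1" "2 * real n + 3" "real n + 1"]
    have "(2 * (2 * real n + 1) * C / (real n + 1))\<^sup>2 * (P * ((4 * (real n + 1)\<^sup>2) / ((2 * real n + 1) * (2 * real n + 3)))) * (2 * real n + 3)
      = 16 * (C\<^sup>2 * P * (2 * real n + 1))" for P by simp
    moreover have "real (Suc n) = real n + 1" "2 * (real n + 1) + 1 = 2 * real n + 3" by simp_all
    ultimately show ?thesis by (simp only:)
  qed
  also have "\<dots> = 16 ^ Suc n" using Suc unfolding C_def by simp
  finally show ?case .
qed auto

text \<open>The preceding exact identity expresses the square of the central coefficient by a
  partial Wallis product, so the limit follows from Wallis's formula without Stirling's.\<close>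

lemma central_choose_asymp: "(\<lambda>n. sqrt (real n) * real ((2 * n) choose n) / 4 ^ n) \<longlonglongrightarrow> 1 / sqrt pi"
proof -
  define W where "W = (\<lambda>n. \<Prod>k=1..n. (4*real k^2) / (4*real k^2 - 1))"
  have "4 * real k ^ 2 / (4 * real k ^ 2 - 1) > 0" if "k \<ge> 1" for k
  proof -
    have "real k ^ 2 \<ge> 1" using that by simp
    then have "4 * real k ^ 2 > 0" "4 * real k ^ 2 - 1 > 0" by linarith+
    then show ?thesis by simp
  qed
  then have W0: "W n > 0" for n unfolding W_def by (intro prod_pos) auto
  have "(\<lambda>n. sqrt (real n / (2 * real n + 1) * inverse (W n))) \<longlonglongrightarrow> sqrt (1 / 2 * inverse (pi / 2))"
  proof (intro tendsto_real_sqrt tendsto_mult tendsto_inverse)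
    show "(\<lambda>n. real n / (2 * real n + 1)) \<longlonglongrightarrow> 1 / 2" by real_asymp
    show "W \<longlonglongrightarrow> pi / 2" unfolding W_def by (rule wallis)
  qed auto
  moreover have "sqrt (real n / (2 * real n + 1) * inverse (W n)) = sqrt (real n) * real ((2 * n) choose n) / 4 ^ n" for n
  proof -
    have "(real ((2 * n) choose n) / 4 ^ n)\<^sup>2 = inverse (W n) / (2 * real n + 1)"
    proof -
      have "(4 ^ n :: real)\<^sup>2 = 16 ^ n" by (simp add: power2_eq_square flip: power_mult_distrib)
      moreover have "real ((2 * n) choose n) ^ 2 * W n * (2 * real n + 1) = 16 ^ n"
        using central_choose_wallis[of n] by (simp only: W_def)
      ultimately have "(real ((2 * n) choose n) / 4 ^ n)\<^sup>2 = X / (X * W n * (2 * real n + 1))"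
        if "X = real ((2 * n) choose n) ^ 2" for X
        by (simp only: power_divide that)
      from this[OF refl] show ?thesis using W0[of n] by (simp add: divide_simps)
    qed
    then have "real ((2 * n) choose n) / 4 ^ n = sqrt (inverse (W n) / (2 * real n + 1))"
      by (metis abs_of_nonneg divide_nonneg_nonneg of_nat_0_le_iff real_sqrt_abs zero_le_numeral zero_le_power)
    then have "sqrt (real n) * (real ((2 * n) choose n) / 4 ^ n) = sqrt (real n * (inverse (W n) / (2 * real n + 1)))"
      by (simp only: real_sqrt_mult)
    then show ?thesis by (simp add: field_simps)
  qed
  ultimately show ?thesis by (simp add: real_sqrt_divide)
qed

lemma choose_ratio:
  assumes "a \<le> m"
  shows "real ((2 * m) choose (m + a)) / real ((2 * m) choose m) = (\<Prod>i<a. real (m - i) / real (m + a - i))"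
proof -
  have *: "fact (m + a) = fact m * (\<Prod>i<a. m + a - i)" for m a :: nat
    by (induction a) (simp_all add: prod.lessThan_Suc_shift algebra_simps del: prod.lessThan_Suc)
  have A: "(fact m :: real) = fact (m - a) * (\<Prod>i<a. real (m - i))"
    using arg_cong[OF *[of "m - a" a], of real] assms by simp
  have B: "(fact (m + a) :: real) = fact m * (\<Prod>i<a. real (m + a - i))"
    using arg_cong[OF *[of m a], of real] by simp
  have "real ((2 * m) choose (m + a)) = fact (2 * m) / (fact (m + a) * fact (m - a))"
    using assms binomial_fact[of "m + a" "2 * m"] by (simp add: mult_2)
  moreover have "real ((2 * m) choose m) = fact (2 * m) / (fact m * fact m)"
    using binomial_fact[of m "2 * m"] by (simp add: mult_2)
  ultimately have "real ((2 * m) choose (m + a)) / real ((2 * m) choose m) = (fact m / fact (m - a)) / (fact (m + a) / fact m)"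
    by (simp add: field_simps)
  also have "fact m / fact (m - a) = (\<Prod>i<a. real (m - i))" by (subst A) simp
  also have "fact (m + a) / fact m = (\<Prod>i<a. real (m + a - i))" by (subst B) simp
  finally show ?thesis by (simp add: prod_dividef)
qed

text \<open>The factors (m - i) / (m + a - i) of the ratio decrease in i; their values at i = 0 and
  i = a bound the product. When a / m tends to 0 and a^2 / m to c, both bounds tend to
  e^(-c).\<close>

lemma choose_ratio_bounds:
  assumes "a \<le> m"
  shows "real ((2 * m) choose (m + a)) / real ((2 * m) choose m) \<le> (real m / real (m + a)) ^ a"
    and "(real (m - a) / real m) ^ a \<le> real ((2 * m) choose (m + a)) / real ((2 * m) choose m)"
proof -
  have "(\<Prod>i<a. real (m - i) / real (m + a - i)) \<le> (\<Prod>i<a. real m / real (m + a))"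
    using assms by (intro prod_mono) (auto simp: of_nat_diff field_simps)
  then show "real ((2 * m) choose (m + a)) / real ((2 * m) choose m) \<le> (real m / real (m + a)) ^ a"
    unfolding choose_ratio[OF assms] by simp
  have "(\<Prod>i<a. real (m - a) / real m) \<le> (\<Prod>i<a. real (m - i) / real (m + a - i))"
  proof (intro prod_mono conjI)
    fix i assume "i \<in> {..<a}"
    then have i: "i < a" by simp
    have "0 \<le> real (a - i) * real a" by simp
    then have "real (m - a) * real (m + a - i) \<le> real (m - i) * real m"
      using assms i by (simp add: of_nat_diff algebra_simps)
    then show "real (m - a) / real m \<le> real (m - i) / real (m + a - i)"
      using assms i by (simp add: divide_simps)
  qed auto
  then show "(real (m - a) / real m) ^ a \<le> real ((2 * m) choose (m + a)) / real ((2 * m) choose m)"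
    unfolding choose_ratio[OF assms] by simp
qed

text \<open>The function e^(x^2/2) cos x is nonincreasing because x cos x <= sin x. Besides
  dominating the cosine sums, the bound later keeps the cosine away from 1 on the outer pieces of
  the contour.\<close>

lemma cos_le_exp:
  assumes "0 \<le> x" "x \<le> pi / 2"
  shows "cos x \<le> exp (- x\<^sup>2 / 2)"
proof -
  have 1: "x * cos x \<le> sin x" if "0 \<le> x" "x \<le> pi / 2" for x
  proof -
    have "sin 0 - 0 * cos 0 \<le> sin x - x * cos x"
    proof (rule DERIV_nonneg_imp_nondecreasing[OF that(1)])
      fix y assume y: "0 \<le> y" "y \<le> x"
      have "((\<lambda>x. sin x - x * cos x) has_real_derivative y * sin y) (at y)"
        by (auto intro!: derivative_eq_intros)
      moreover have "y * sin y \<ge> 0" using y that by (intro mult_nonneg_nonneg sin_ge_zero) auto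
      ultimately show "\<exists>d. ((\<lambda>x. sin x - x * cos x) has_real_derivative d) (at y) \<and> 0 \<le> d" by blast
    qed
    then show ?thesis by simp
  qed
  have "exp (x\<^sup>2 / 2) * cos x \<le> exp (0\<^sup>2 / 2) * cos 0"
  proof (rule DERIV_nonpos_imp_nonincreasing[OF assms(1)])
    fix y assume y: "0 \<le> y" "y \<le> x"
    have "((\<lambda>x. exp (x\<^sup>2 / 2) * cos x) has_real_derivative exp (y\<^sup>2 / 2) * (y * cos y - sin y)) (at y)"
      by (auto intro!: derivative_eq_intros simp: algebra_simps)
    moreover have "exp (y\<^sup>2 / 2) * (y * cos y - sin y) \<le> 0"
      using 1[of y] y assms by (simp add: mult_le_0_iff)
    ultimately show "\<exists>d. ((\<lambda>x. exp (x\<^sup>2 / 2) * cos x) has_real_derivative d) (at y) \<and> d \<le> 0" by blast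
  qed
  then show ?thesis by (simp add: exp_minus field_simps)
qed

text \<open>The reflection x -> pi - x pairs the angles, and the even power removes the sign. All
  remaining angles lie in the first quadrant, where \<open>cos_le_exp\<close> applies.\<close>

lemma sum_cos_fold:
  assumes "n \<ge> 1"
  shows "(\<Sum>k<2 * n. cos (pi * real (2 * k + 1) / real (2 * n) / 2) ^ (2 * m)) =
    2 * (\<Sum>k<n. cos (pi * real (2 * k + 1) / real (2 * n) / 2) ^ (2 * m))"
proof -
  define f where "f = (\<lambda>k. cos (pi * real (2 * k + 1) / real (2 * n) / 2) ^ (2 * m))"
  have reflect: "f (2 * n - Suc k) = f k" if "k < 2 * n" for k
  proof -
    have "pi * real (2 * (2 * n - Suc k) + 1) / real (2 * n) / 2 = pi - pi * real (2 * k + 1) / real (2 * n) / 2"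
      using that assms by (simp add: of_nat_diff field_simps)
    then show ?thesis unfolding f_def by (simp only: cos_pi_minus power_mult power2_minus)
  qed
  have "(\<Sum>k<2 * n. f k) = (\<Sum>k<n. f k) + (\<Sum>k=n..<2 * n. f k)"
    by (subst sum.union_disjoint[symmetric]) (auto intro!: sum.cong)
  also have "(\<Sum>k=n..<2 * n. f k) = (\<Sum>k<n. f k)"
    by (rule sum.reindex_bij_witness[of _ "\<lambda>k. 2 * n - Suc k" "\<lambda>k. 2 * n - Suc k"]) (auto simp: reflect)
  finally show ?thesis by (simp add: f_def)
qed

text \<open>Reduces to ln (1 + x) / x -> 1, a limit at a punctured point, which is why
  \<open>y\<close> must avoid 0. The companion for the cosine uses ln (cos x) / x^2 -> -1/2 in the
  same way.\<close>

lemma one_plus_powr_limit: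
  fixes y :: "nat \<Rightarrow> real"
  assumes y: "y \<longlonglongrightarrow> 0" and nz: "\<And>n. y n \<noteq> 0" and ay: "(\<lambda>n. real (a n) * y n) \<longlonglongrightarrow> c"
  shows "(\<lambda>n. (1 + y n) ^ a n) \<longlonglongrightarrow> exp c"
proof -
  have "((\<lambda>x::real. ln (1 + x) / x) \<longlongrightarrow> 1) (at 0)" by real_asymp
  moreover have "filterlim y (at 0) sequentially" using y nz by (simp add: filterlim_at)
  ultimately have "(\<lambda>n. ln (1 + y n) / y n) \<longlonglongrightarrow> 1" by (rule filterlim_compose)
  then have *: "(\<lambda>n. exp (real (a n) * y n * (ln (1 + y n) / y n))) \<longlonglongrightarrow> exp (c * 1)"
    by (intro tendsto_intros ay)
  have "eventually (\<lambda>n. y n > -1) sequentially" using order_tendstoD(1)[OF y, of "-1"] by simp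
  then have "eventually (\<lambda>n. exp (real (a n) * y n * (ln (1 + y n) / y n)) = (1 + y n) ^ a n) sequentially"
  proof eventually_elim
    case (elim n)
    then show ?case using nz[of n] by (simp add: exp_of_nat_mult)
  qed
  from Lim_transform_eventually[OF * this] show ?thesis by simp
qed

lemma cos_power_limit:
  fixes x :: "nat \<Rightarrow> real"
  assumes x: "x \<longlonglongrightarrow> 0" and nz: "\<And>n. x n \<noteq> 0" and ax: "(\<lambda>n. real (a n) * (x n)\<^sup>2) \<longlonglongrightarrow> c"
  shows "(\<lambda>n. cos (x n) ^ (2 * a n)) \<longlonglongrightarrow> exp (- c)"
proof -
  have "((\<lambda>x::real. ln (cos x) / x\<^sup>2) \<longlongrightarrow> -1/2) (at 0)" by real_asymp
  moreover have "filterlim x (at 0) sequentially" using x nz by (simp add: filterlim_at)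
  ultimately have "(\<lambda>n. ln (cos (x n)) / (x n)\<^sup>2) \<longlonglongrightarrow> -1/2" by (rule filterlim_compose)
  then have *: "(\<lambda>n. exp (2 * (real (a n) * (x n)\<^sup>2) * (ln (cos (x n)) / (x n)\<^sup>2))) \<longlonglongrightarrow> exp (2 * c * (-1/2))"
    by (intro tendsto_exp tendsto_mult tendsto_const ax)
  have "(\<lambda>n. cos (x n)) \<longlonglongrightarrow> cos 0" by (intro tendsto_intros x)
  then have "eventually (\<lambda>n. cos (x n) > 0) sequentially" by (rule order_tendstoD) simp
  then have "eventually (\<lambda>n. exp (2 * (real (a n) * (x n)\<^sup>2) * (ln (cos (x n)) / (x n)\<^sup>2)) = cos (x n) ^ (2 * a n)) sequentially"
  proof eventually_elim
    case (elim n)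
    have "2 * (real (a n) * (x n)\<^sup>2) * (ln (cos (x n)) / (x n)\<^sup>2) = real (2 * a n) * ln (cos (x n))"
      using nz[of n] by simp
    then show ?case using elim by (simp only: exp_of_nat_mult exp_ln)
  qed
  from Lim_transform_eventually[OF * this] show ?thesis by simp
qed

context
  fixes s :: real
  assumes s: "s > 0"
begin

text \<open>The value of \<open>m\<close> that goes with \<open>l = 2 * n\<close> in the cosine
  identity. With a = 2 n (j + 1) the quotient a^2 / m tends to (j + 1)^2 / s, and m times the square
  of the angle pi (k + 1/2) / (2 n) tends to pi^2 (k + 1/2)^2 s.\<close>

definition sq_floor :: "nat \<Rightarrow> nat" where "sq_floor n = nat \<lfloor>4 * s * (real n)\<^sup>2\<rfloor>"

lemma sq_floor_bounds: "real (sq_floor n) \<le> 4 * s * (real n)\<^sup>2" "4 * s * (real n)\<^sup>2 - 1 \<le> real (sq_floor n)"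
proof -
  have "4 * s * (real n)\<^sup>2 \<ge> 0" using s by simp
  then have "real (sq_floor n) = of_int \<lfloor>4 * s * (real n)\<^sup>2\<rfloor>" unfolding sq_floor_def by simp
  then show "real (sq_floor n) \<le> 4 * s * (real n)\<^sup>2" "4 * s * (real n)\<^sup>2 - 1 \<le> real (sq_floor n)" by linarith+
qed

lemma sq_floor_limit: "(\<lambda>n. real (sq_floor n) / (real n)\<^sup>2) \<longlonglongrightarrow> 4 * s"
proof (rule tendsto_sandwich)
  show "\<forall>\<^sub>F n in sequentially. (4 * s * (real n)\<^sup>2 - 1) / (real n)\<^sup>2 \<le> real (sq_floor n) / (real n)\<^sup>2"
    by (intro always_eventually allI divide_right_mono sq_floor_bounds) auto
  show "\<forall>\<^sub>F n in sequentially. real (sq_floor n) / (real n)\<^sup>2 \<le> (4 * s * (real n)\<^sup>2) / (real n)\<^sup>2"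
    by (intro always_eventually allI divide_right_mono sq_floor_bounds) auto
  show "(\<lambda>n. (4 * s * (real n)\<^sup>2 - 1) / (real n)\<^sup>2) \<longlonglongrightarrow> 4 * s"
       "(\<lambda>n. (4 * s * (real n)\<^sup>2) / (real n)\<^sup>2) \<longlonglongrightarrow> 4 * s" using s by real_asymp+
qed

lemma sq_floor_inf: "filterlim sq_floor at_top sequentially"
proof -
  have "filterlim (\<lambda>n. 4 * s * (real n)\<^sup>2 - 1) at_top sequentially" using s by real_asymp
  then have "filterlim (\<lambda>n. real (sq_floor n)) at_top sequentially"
    by (rule filterlim_at_top_mono) (auto intro!: always_eventually sq_floor_bounds)
  then show ?thesis by (simp add: filterlim_real_sequentially filterlim_sequentially_iff_filterlim_real)
qed

lemma sq_floor_eventually: "\<exists>N. \<forall>n\<ge>N. n \<ge> 1 \<and> sq_floor n \<ge> 1 \<and> 2 * s * (real n)\<^sup>2 \<le> real (sq_floor n)"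
proof -
  have "eventually (\<lambda>n. real (sq_floor n) / (real n)\<^sup>2 > 2 * s) sequentially"
    using order_tendstoD(1)[OF sq_floor_limit, of "2 * s"] s by simp
  moreover have "eventually (\<lambda>n. sq_floor n \<ge> 1) sequentially"
    using sq_floor_inf by (auto simp: filterlim_at_top)
  moreover note eventually_ge_at_top[of 1]
  ultimately have "eventually (\<lambda>n. n \<ge> 1 \<and> sq_floor n \<ge> 1 \<and> 2 * s * (real n)\<^sup>2 \<le> real (sq_floor n)) sequentially"
    by eventually_elim (auto simp: field_simps)
  then show ?thesis by (simp add: eventually_sequentially)
qed

text \<open>Each ratio is squeezed between the two bounds of \<open>choose_ratio_bounds\<close>,
  which share their limit. Domination comes from the upper one: (m / (m + a))^a <= exp (- a^2 / (m +
  a)).\<close>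

lemma choose_side_limit:
  "(\<lambda>n. \<Sum>j<sq_floor n. (-1) ^ Suc j * (real ((2 * sq_floor n) choose (sq_floor n + 2 * n * Suc j)) / real ((2 * sq_floor n) choose sq_floor n)))
     \<longlonglongrightarrow> (\<Sum>j. (-1) ^ Suc j * exp (- (real (Suc j))\<^sup>2 / s))"
proof -
  obtain N where N: "\<And>n. n \<ge> N \<Longrightarrow> n \<ge> 1 \<and> sq_floor n \<ge> 1 \<and> 2 * s * (real n)\<^sup>2 \<le> real (sq_floor n)" using sq_floor_eventually by blast
  define R where "R = (\<lambda>j n. real ((2 * sq_floor n) choose (sq_floor n + 2 * n * Suc j)) / real ((2 * sq_floor n) choose sq_floor n))"
  have "(\<lambda>n. \<Sum>j. (-1) ^ Suc j * R j n) \<longlonglongrightarrow> (\<Sum>j. (-1) ^ Suc j * exp (- (real (Suc j))\<^sup>2 / s))"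
  proof (rule tannery_sequence(2)[where N = N and M = "\<lambda>j. exp (- 1 / (2 * s)) ^ j"])
    fix j n assume n: "n \<ge> N"
    show "norm ((- 1) ^ Suc j * R j n) \<le> exp (- 1 / (2 * s)) ^ j"
    proof (cases "2 * n * Suc j \<le> sq_floor n")
      case True
      define a where "a = 2 * n * Suc j"
      define m where "m = sq_floor n"
      have m: "m \<ge> 1" "a \<le> m" "n \<ge> 1" "real m \<le> 4 * s * (real n)\<^sup>2" using N[OF n] True sq_floor_bounds by (auto simp: m_def a_def)
      have "R j n \<le> (real m / real (m + a)) ^ a"
        unfolding R_def a_def[symmetric] m_def[symmetric] by (rule choose_ratio_bounds m)+
      also have "\<dots> \<le> exp (- real a / real (m + a)) ^ a"
      proof (intro power_mono)
        have "real m / real (m + a) = 1 + (- real a / real (m + a))" using m by (simp add: field_simps)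
        also have "\<dots> \<le> exp (- real a / real (m + a))" by (rule exp_ge_add_one_self)
        finally show "real m / real (m + a) \<le> exp (- real a / real (m + a))" .
      qed auto
      also have "\<dots> = exp (- ((real a)\<^sup>2 / real (m + a)))"
        unfolding exp_of_nat_mult[symmetric] by (simp add: power2_eq_square)
      also have "\<dots> \<le> exp (- (real j / (2 * s)))"
      proof -
        \<comment> \<open>The Gaussian decay in \<open>j\<close> is weakened to a geometric one.
          From a <= m and m <= 4 s n^2 the denominator m + a is at most 8 s n^2.\<close>
        have "real j / (2 * s) \<le> (real (Suc j))\<^sup>2 / (2 * s)"
          using s by (intro divide_right_mono) (auto simp: power2_eq_square algebra_simps)
        also have "\<dots> = (real a)\<^sup>2 / (8 * s * (real n)\<^sup>2)"
          using m s by (simp add: a_def field_simps power2_eq_square)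
        also have "\<dots> \<le> (real a)\<^sup>2 / real (m + a)"
          using m s by (intro divide_left_mono mult_pos_pos) auto
        finally show ?thesis by simp
      qed
      also have "\<dots> = exp (- 1 / (2 * s)) ^ j" unfolding exp_of_nat_mult[symmetric] by simp
      finally have "R j n \<le> exp (- 1 / (2 * s)) ^ j" .
      moreover have "norm ((- 1) ^ Suc j * R j n) = R j n"
        unfolding norm_mult norm_power by (simp add: R_def)
      ultimately show ?thesis by simp
    next
      case False
      then have "R j n = 0" by (simp add: R_def binomial_eq_0)
      then show ?thesis by simp
    qed
  next
    show "summable (\<lambda>j. exp (- 1 / (2 * s)) ^ j)" using s by (intro summable_geometric) simp
  next
    fix j
    define a where "a = (\<lambda>n. 2 * n * Suc j)"
    \<comment> \<open>The index is shifted by \<open>N + 1\<close> so that \<open>a\<close> and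
      \<open>sq_floor\<close> are positive throughout and the quotients are nonzero.\<close>
    have am0: "(\<lambda>n. real (a (n + N + 1)) / real (sq_floor (n + N + 1))) \<longlonglongrightarrow> 0"
    proof -
      have "(\<lambda>n. 2 * real (Suc j) / real n * inverse (real (sq_floor n) / (real n)\<^sup>2)) \<longlonglongrightarrow> 0 * inverse (4 * s)"
        by (intro tendsto_mult tendsto_inverse sq_floor_limit) (use s in real_asymp, use s in simp)
      then have "(\<lambda>n. 2 * real (Suc j) / real n * inverse (real (sq_floor n) / (real n)\<^sup>2)) \<longlonglongrightarrow> 0" by simp
      moreover have "2 * real (Suc j) / real n * inverse (real (sq_floor n) / (real n)\<^sup>2) = real (a n) / real (sq_floor n)" for n
        by (cases "n = 0"; cases "sq_floor n = 0") (simp_all add: a_def field_simps power2_eq_square)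
      ultimately have "(\<lambda>n. real (a n) / real (sq_floor n)) \<longlonglongrightarrow> 0" by simp
      from LIMSEQ_ignore_initial_segment[OF this, of "N + 1"] show ?thesis by (simp add: add.assoc)
    qed
    have a2: "(\<lambda>n. (real (a (n + N + 1)))\<^sup>2 / real (sq_floor (n + N + 1))) \<longlonglongrightarrow> (real (Suc j))\<^sup>2 / s"
    proof -
      have "(\<lambda>n. 4 * (real (Suc j))\<^sup>2 * inverse (real (sq_floor n) / (real n)\<^sup>2)) \<longlonglongrightarrow> 4 * (real (Suc j))\<^sup>2 * inverse (4 * s)"
        by (intro tendsto_mult tendsto_inverse sq_floor_limit tendsto_const) (use s in simp)
      moreover have "4 * (real (Suc j))\<^sup>2 * inverse (real (sq_floor n) / (real n)\<^sup>2) = (real (a n))\<^sup>2 / real (sq_floor n)" for n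
        by (simp add: a_def field_simps power2_eq_square)
      moreover have "4 * (real (Suc j))\<^sup>2 * inverse (4 * s) = (real (Suc j))\<^sup>2 / s" using s by (simp add: field_simps)
      ultimately have "(\<lambda>n. (real (a n))\<^sup>2 / real (sq_floor n)) \<longlonglongrightarrow> (real (Suc j))\<^sup>2 / s" by (simp only:)
      from LIMSEQ_ignore_initial_segment[OF this, of "N + 1"] show ?thesis by (simp add: add.assoc)
    qed
    have m1: "sq_floor (n + N + 1) \<ge> 1" for n using N[of "n + N + 1"] by simp
    have a1: "a (n + N + 1) > 0" for n by (simp add: a_def)
    have ev: "eventually (\<lambda>n. a (n + N + 1) \<le> sq_floor (n + N + 1)) sequentially"
    proof -
      have "eventually (\<lambda>n. real (a (n + N + 1)) / real (sq_floor (n + N + 1)) < 1) sequentially"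
        using order_tendstoD(2)[OF am0, of 1] by simp
      then show ?thesis
      proof eventually_elim
        case (elim n)
        then show ?case using m1[of n] by (simp add: divide_less_eq)
      qed
    qed
    have up: "(\<lambda>n. (real (sq_floor (n + N + 1)) / real (sq_floor (n + N + 1) + a (n + N + 1))) ^ a (n + N + 1)) \<longlonglongrightarrow> exp (- ((real (Suc j))\<^sup>2 / s))"
    proof -
      have "(\<lambda>n. inverse ((1 + real (a (n + N + 1)) / real (sq_floor (n + N + 1))) ^ a (n + N + 1))) \<longlonglongrightarrow> inverse (exp ((real (Suc j))\<^sup>2 / s))"
      proof (intro tendsto_inverse one_plus_powr_limit am0)
        show "(\<lambda>n. real (a (n + N + 1)) * (real (a (n + N + 1)) / real (sq_floor (n + N + 1)))) \<longlonglongrightarrow> (real (Suc j))\<^sup>2 / s"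
          using a2 by (simp add: power2_eq_square)
        show "real (a (n + N + 1)) / real (sq_floor (n + N + 1)) \<noteq> 0" for n using m1[of n] a1[of n] by simp
      qed auto
      moreover have "inverse ((1 + real (a (n + N + 1)) / real (sq_floor (n + N + 1))) ^ a (n + N + 1)) =
        (real (sq_floor (n + N + 1)) / real (sq_floor (n + N + 1) + a (n + N + 1))) ^ a (n + N + 1)" for n
      proof -
        have "inverse (1 + real (a (n + N + 1)) / real (sq_floor (n + N + 1))) = real (sq_floor (n + N + 1)) / real (sq_floor (n + N + 1) + a (n + N + 1))"
          using m1[of n] by (simp add: divide_simps)
        then show ?thesis by (simp only: power_inverse[symmetric])
      qed
      ultimately show ?thesis by (simp add: exp_minus)
    qed
    have low: "(\<lambda>n. (1 + - (real (a (n + N + 1)) / real (sq_floor (n + N + 1)))) ^ a (n + N + 1)) \<longlonglongrightarrow> exp (- ((real (Suc j))\<^sup>2 / s))"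
    proof (rule one_plus_powr_limit)
      show "(\<lambda>n. - (real (a (n + N + 1)) / real (sq_floor (n + N + 1)))) \<longlonglongrightarrow> 0" using tendsto_minus[OF am0] by simp
      show "(\<lambda>n. real (a (n + N + 1)) * - (real (a (n + N + 1)) / real (sq_floor (n + N + 1)))) \<longlonglongrightarrow> - ((real (Suc j))\<^sup>2 / s)"
        using tendsto_minus[OF a2] by (simp add: power2_eq_square)
      show "- (real (a (n + N + 1)) / real (sq_floor (n + N + 1))) \<noteq> 0" for n using m1[of n] a1[of n] by simp
    qed
    have "(\<lambda>n. R j (n + N + 1)) \<longlonglongrightarrow> exp (- ((real (Suc j))\<^sup>2 / s))"
    proof (rule tendsto_sandwich[OF _ _ low up])
      show "\<forall>\<^sub>F n in sequentially. (1 + - (real (a (n + N + 1)) / real (sq_floor (n + N + 1)))) ^ a (n + N + 1) \<le> R j (n + N + 1)"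
        using ev
      proof eventually_elim
        case (elim n)
        have "1 + - (real (a (n + N + 1)) / real (sq_floor (n + N + 1))) = real (sq_floor (n + N + 1) - a (n + N + 1)) / real (sq_floor (n + N + 1))"
          using m1[of n] elim by (simp add: of_nat_diff diff_divide_distrib)
        then show ?case using choose_ratio_bounds(2)[OF elim] by (simp only: R_def a_def)
      qed
      show "\<forall>\<^sub>F n in sequentially. R j (n + N + 1) \<le> (real (sq_floor (n + N + 1)) / real (sq_floor (n + N + 1) + a (n + N + 1))) ^ a (n + N + 1)"
        using ev
      proof eventually_elim
        case (elim n)
        then show ?case using choose_ratio_bounds(1)[OF elim] by (simp only: R_def a_def)
      qed
    qed
    then have "R j \<longlonglongrightarrow> exp (- ((real (Suc j))\<^sup>2 / s))"
      using LIMSEQ_offset[of "R j" "N + 1"] by (simp add: add.assoc)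
    then show "(\<lambda>n. (- 1) ^ Suc j * R j n) \<longlonglongrightarrow> (-1) ^ Suc j * exp (- (real (Suc j))\<^sup>2 / s)"
      by (intro tendsto_mult tendsto_const) simp
  qed
  moreover have "eventually (\<lambda>n. (\<Sum>j. (-1) ^ Suc j * R j n) = (\<Sum>j<sq_floor n. (-1) ^ Suc j * R j n)) sequentially"
  proof (rule eventually_mono[OF eventually_ge_at_top[of 1]])
    fix n :: nat assume n: "n \<ge> 1"
    show "(\<Sum>j. (-1) ^ Suc j * R j n) = (\<Sum>j<sq_floor n. (-1) ^ Suc j * R j n)"
    proof (rule suminf_finite)
      fix j assume "j \<notin> {..<sq_floor n}"
      moreover have "Suc j \<le> 2 * n * Suc j" using n mult_le_mono1[of 1 "2 * n" "Suc j"] by simp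
      ultimately have "sq_floor n < 2 * n * Suc j" by simp
      then show "(-1) ^ Suc j * R j n = 0" by (simp add: R_def binomial_eq_0)
    qed auto
  qed
  ultimately show ?thesis unfolding R_def by (rule Lim_transform_eventually)
qed

text \<open>Terms converge by \<open>cos_power_limit\<close>. For domination,
  \<open>cos_le_exp\<close> gives exp (- m x^2), and m >= 2 s n^2, (k + 1/2)^2 >= k and pi^2 / 2 >=
  1 leave the geometric majorant e^(-s k).\<close>

lemma cos_side_limit:
  "(\<lambda>n. \<Sum>k<n. cos (pi * real (2 * k + 1) / real (2 * n) / 2) ^ (2 * sq_floor n))
     \<longlonglongrightarrow> (\<Sum>k. exp (- (pi\<^sup>2 * (real k + 1 / 2)\<^sup>2 * s)))"
proof -
  obtain N where N: "\<And>n. n \<ge> N \<Longrightarrow> n \<ge> 1 \<and> sq_floor n \<ge> 1 \<and> 2 * s * (real n)\<^sup>2 \<le> real (sq_floor n)" using sq_floor_eventually by blast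
  define x where "x = (\<lambda>k n. pi * real (2 * k + 1) / real (2 * n) / 2)"
  define f where "f = (\<lambda>k n. if k < n then cos (x k n) ^ (2 * sq_floor n) else 0)"
  have "(\<lambda>n. \<Sum>k. f k n) \<longlonglongrightarrow> (\<Sum>k. exp (- (pi\<^sup>2 * (real k + 1 / 2)\<^sup>2 * s)))"
  proof (rule tannery_sequence(2)[where N = N and M = "\<lambda>k. exp (- s) ^ k"])
    fix k n assume n: "n \<ge> N"
    show "norm (f k n) \<le> exp (- s) ^ k"
    proof (cases "k < n")
      case True
      have "real (2 * k + 1) / real (2 * n) \<le> 1" using True by simp
      then have "pi * (real (2 * k + 1) / real (2 * n)) \<le> pi * 1" by (intro mult_left_mono) auto
      then have x: "0 \<le> x k n" "x k n \<le> pi / 2" by (auto simp: x_def)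
      then have c: "0 \<le> cos (x k n)" by (intro cos_ge_zero) auto
      then have "norm (f k n) = cos (x k n) ^ (2 * sq_floor n)" using True by (simp add: f_def)
      also have "\<dots> \<le> exp (- (x k n)\<^sup>2 / 2) ^ (2 * sq_floor n)" by (intro power_mono cos_le_exp x c)
      also have "\<dots> = exp (- (real (sq_floor n) * (x k n)\<^sup>2))" unfolding exp_of_nat_mult[symmetric] by simp
      also have "\<dots> \<le> exp (- (s * real k))"
      proof -
        have "s * real k * 1 \<le> s * (real k + 1 / 2)\<^sup>2 * (pi\<^sup>2 / 2)"
        proof (intro mult_mono)
          show "real k \<le> (real k + 1 / 2)\<^sup>2" by (simp add: power2_eq_square algebra_simps)
          have "3 ^ 2 \<le> pi ^ 2" using pi_gt3 by (intro power_mono) auto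
          then show "1 \<le> pi\<^sup>2 / 2" by simp
        qed (use s in auto)
        also have "\<dots> = 2 * s * (real n)\<^sup>2 * (x k n)\<^sup>2"
          using True by (simp add: x_def field_simps power2_eq_square)
        also have "\<dots> \<le> real (sq_floor n) * (x k n)\<^sup>2" using N[OF n] by (intro mult_right_mono) auto
        finally show ?thesis by simp
      qed
      also have "\<dots> = exp (- s) ^ k" unfolding exp_of_nat_mult[symmetric] by (simp add: mult_ac)
      finally show ?thesis .
    qed (auto simp: f_def)
  next
    show "summable (\<lambda>k. exp (- s) ^ k)" using s by (intro summable_geometric) simp
  next
    fix k
    have "(\<lambda>n. cos (x k (Suc n)) ^ (2 * sq_floor (Suc n))) \<longlonglongrightarrow> exp (- (pi\<^sup>2 * (real k + 1 / 2)\<^sup>2 * s))"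
    proof (rule cos_power_limit)
      show "(\<lambda>n. x k (Suc n)) \<longlonglongrightarrow> 0" unfolding x_def by real_asymp
      show "x k (Suc n) \<noteq> 0" for n by (simp add: x_def)
      have "(\<lambda>n. real (sq_floor n) / (real n)\<^sup>2 * (pi\<^sup>2 * (real k + 1 / 2)\<^sup>2 / 4)) \<longlonglongrightarrow> 4 * s * (pi\<^sup>2 * (real k + 1 / 2)\<^sup>2 / 4)"
        by (intro tendsto_mult sq_floor_limit tendsto_const)
      from LIMSEQ_Suc[OF this]
      have "(\<lambda>n. real (sq_floor (Suc n)) / (real (Suc n))\<^sup>2 * (pi\<^sup>2 * (real k + 1 / 2)\<^sup>2 / 4)) \<longlonglongrightarrow> pi\<^sup>2 * (real k + 1 / 2)\<^sup>2 * s" by (simp add: mult_ac)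
      moreover have "real (sq_floor (Suc n)) / (real (Suc n))\<^sup>2 * (pi\<^sup>2 * (real k + 1 / 2)\<^sup>2 / 4) = real (sq_floor (Suc n)) * (x k (Suc n))\<^sup>2" for n
      proof -
        have "x k (Suc n) = pi * (real k + 1 / 2) / 2 / real (Suc n)" unfolding x_def by (simp add: field_simps)
        then show ?thesis by (simp only: power_divide power_mult_distrib) simp
      qed
      ultimately show "(\<lambda>n. real (sq_floor (Suc n)) * (x k (Suc n))\<^sup>2) \<longlonglongrightarrow> pi\<^sup>2 * (real k + 1 / 2)\<^sup>2 * s" by simp
    qed
    then have *: "(\<lambda>n. cos (x k n) ^ (2 * sq_floor n)) \<longlonglongrightarrow> exp (- (pi\<^sup>2 * (real k + 1 / 2)\<^sup>2 * s))"
      by (rule LIMSEQ_imp_Suc)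
    show "(\<lambda>n. f k n) \<longlonglongrightarrow> exp (- (pi\<^sup>2 * (real k + 1 / 2)\<^sup>2 * s))"
      by (rule Lim_transform_eventually[OF *], rule eventually_mono[OF eventually_gt_at_top[of k]])
         (simp add: f_def)
  qed
  moreover have "(\<Sum>k. f k n) = (\<Sum>k<n. cos (x k n) ^ (2 * sq_floor n))" for n
    by (subst suminf_finite[where N = "{..<n}"]) (auto simp: f_def)
  ultimately show ?thesis by (simp add: x_def)
qed

text \<open>The finite identity is divided by 4^m and the central coefficient is factored out. Its
  normalised size \<open>D n\<close> tends to 1 / sqrt (pi s), so both sides converge.\<close>

theorem theta_transformation_real:
  "1 + 2 * (\<Sum>j. (-1) ^ Suc j * exp (- (real (Suc j))\<^sup>2 / s)) =
     2 * sqrt (pi * s) * (\<Sum>k. exp (- (pi\<^sup>2 * (real k + 1 / 2)\<^sup>2 * s)))"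
proof -
  define A where "A = (\<lambda>n. (\<Sum>j<sq_floor n. (-1) ^ Suc j * (real ((2 * sq_floor n) choose (sq_floor n + 2 * n * Suc j)) / real ((2 * sq_floor n) choose sq_floor n))))"
  define B where "B = (\<lambda>n. \<Sum>k<n. cos (pi * real (2 * k + 1) / real (2 * n) / 2) ^ (2 * sq_floor n))"
  define D where "D = (\<lambda>n. 2 * real n * real ((2 * sq_floor n) choose sq_floor n) / 4 ^ sq_floor n)"
  have eq: "D n * (1 + 2 * A n) = 2 * B n" if n: "n \<ge> 1" for n
  proof -
    define C where "C = real ((2 * sq_floor n) choose sq_floor n)"
    have C: "C > 0" by (simp add: C_def)
    have "(2 * c) ^ (2 * sq_floor n) = 4 ^ sq_floor n * c ^ (2 * sq_floor n)" for c :: real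
      by (simp add: power_mult_distrib power_mult)
    then have "(\<Sum>k<2 * n. (2 * cos (pi * real (2 * k + 1) / real (2 * n) / 2)) ^ (2 * sq_floor n)) = 4 ^ sq_floor n * (2 * B n)"
      unfolding B_def sum_cos_fold[OF n, symmetric] by (simp only: sum_distrib_left)
    moreover have "real ((2 * sq_floor n) choose sq_floor n) + 2 * (\<Sum>j<sq_floor n. (-1) ^ Suc j * real ((2 * sq_floor n) choose (sq_floor n + 2 * n * Suc j))) = C * (1 + 2 * A n)"
      using C unfolding A_def C_def by (simp add: ring_distribs sum_distrib_left)
    ultimately have "4 ^ sq_floor n * (2 * B n) = real (2 * n) * (C * (1 + 2 * A n))"
      using choose_cos_identity[of "2 * n" "sq_floor n"] n by simp
    then show ?thesis unfolding D_def C_def[symmetric] by (simp add: field_simps)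
  qed
  have "D \<longlonglongrightarrow> 1 / sqrt (pi * s)"
  proof -
    have "(\<lambda>n. sqrt (real (sq_floor n)) * real ((2 * sq_floor n) choose sq_floor n) / 4 ^ sq_floor n) \<longlonglongrightarrow> 1 / sqrt pi"
      using filterlim_compose[OF central_choose_asymp sq_floor_inf] by simp
    then have "(\<lambda>n. (sqrt (real (sq_floor n)) * real ((2 * sq_floor n) choose sq_floor n) / 4 ^ sq_floor n) * (2 * inverse (sqrt (real (sq_floor n) / (real n)\<^sup>2)))) \<longlonglongrightarrow> (1 / sqrt pi) * (2 * inverse (sqrt (4 * s)))"
      by (intro tendsto_mult tendsto_inverse tendsto_real_sqrt sq_floor_limit tendsto_const) (use s in auto)
    also have "(1 / sqrt pi) * (2 * inverse (sqrt (4 * s))) = 1 / sqrt (pi * s)"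
      by (simp add: real_sqrt_mult field_simps)
    finally have *: "(\<lambda>n. (sqrt (real (sq_floor n)) * real ((2 * sq_floor n) choose sq_floor n) / 4 ^ sq_floor n) * (2 * inverse (sqrt (real (sq_floor n) / (real n)\<^sup>2)))) \<longlonglongrightarrow> 1 / sqrt (pi * s)" .
    obtain N where N: "\<And>n. n \<ge> N \<Longrightarrow> n \<ge> 1 \<and> sq_floor n \<ge> 1 \<and> 2 * s * (real n)\<^sup>2 \<le> real (sq_floor n)" using sq_floor_eventually by blast
    show ?thesis
    proof (rule Lim_transform_eventually[OF *], rule eventually_mono[OF eventually_ge_at_top[of N]])
      fix n assume "n \<ge> N"
      then show "(sqrt (real (sq_floor n)) * real ((2 * sq_floor n) choose sq_floor n) / 4 ^ sq_floor n) * (2 * inverse (sqrt (real (sq_floor n) / (real n)\<^sup>2))) = D n"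
        using N[of n] by (simp add: D_def real_sqrt_divide field_simps)
    qed
  qed
  moreover have "(\<lambda>n. 1 + 2 * A n) \<longlonglongrightarrow> 1 + 2 * (\<Sum>j. (-1) ^ Suc j * exp (- (real (Suc j))\<^sup>2 / s))"
    unfolding A_def by (intro tendsto_intros choose_side_limit)
  ultimately have "(\<lambda>n. D n * (1 + 2 * A n)) \<longlonglongrightarrow> 1 / sqrt (pi * s) * (1 + 2 * (\<Sum>j. (-1) ^ Suc j * exp (- (real (Suc j))\<^sup>2 / s)))"
    by (rule tendsto_mult)
  then have "(\<lambda>n. 2 * B n) \<longlonglongrightarrow> 1 / sqrt (pi * s) * (1 + 2 * (\<Sum>j. (-1) ^ Suc j * exp (- (real (Suc j))\<^sup>2 / s)))"
    by (rule Lim_transform_eventually) (use eq in \<open>auto intro!: eventually_mono[OF eventually_ge_at_top[of 1]]\<close>)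
  moreover have "(\<lambda>n. 2 * B n) \<longlonglongrightarrow> 2 * (\<Sum>k. exp (- (pi\<^sup>2 * (real k + 1 / 2)\<^sup>2 * s)))"
    unfolding B_def by (intro tendsto_mult tendsto_const cos_side_limit)
  ultimately have "1 / sqrt (pi * s) * (1 + 2 * (\<Sum>j. (-1) ^ Suc j * exp (- (real (Suc j))\<^sup>2 / s))) = 2 * (\<Sum>k. exp (- (pi\<^sup>2 * (real k + 1 / 2)\<^sup>2 * s)))"
    by (rule LIMSEQ_unique)
  then show ?thesis using s by (simp add: field_simps)
qed

end

section \<open>The dual series over triangular numbers, and analytic continuation\<close>

definition triangular :: "nat \<Rightarrow> nat" where "triangular k = k * (k + 1) div 2"

lemma triangular_0 [simp]: "triangular 0 = 0" by (simp add: triangular_def)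

lemma triangular_Suc: "triangular (Suc k) = triangular k + Suc k"
proof -
  have "Suc k * (Suc k + 1) = k * (k + 1) + Suc k * 2" by simp
  then have "Suc k * (Suc k + 1) div 2 = (k * (k + 1) + Suc k * 2) div 2" by (simp only:)
  also have "\<dots> = Suc k + k * (k + 1) div 2" by (rule div_mult_self1) simp
  finally show ?thesis by (simp add: triangular_def)
qed

lemma real_triangular: "real (triangular k) = real k * (real k + 1) / 2"
  by (induction k) (simp_all add: triangular_Suc field_simps)

lemma strict_mono_triangular: "strict_mono triangular"
  by (rule strict_monoI_Suc) (simp add: triangular_Suc)

text \<open>Since pi^2 (k + 1/2)^2 / t = pi^2 / (4 t) + (2 pi^2 / t) \<open>triangular k\<close>,
  the dual series is its leading exponential times a power series in w = exp (- 2 pi^2 / t).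
  Coefficients 0 and 1 make its holomorphy immediate and bound it by a geometric series.\<close>

definition tri_fps :: "complex fps" where
  "tri_fps = Abs_fps (\<lambda>n. if n \<in> range triangular then 1 else 0)"

definition tri_gf :: "complex \<Rightarrow> complex" where "tri_gf = eval_fps tri_fps"

lemma tri_fps_conv_radius: "fps_conv_radius tri_fps \<ge> 1"
  unfolding fps_conv_radius_def
proof (rule conv_radius_geI_ex)
  fix r :: real assume r: "0 < r" "ereal r < 1"
  have "summable (\<lambda>n. fps_nth tri_fps n * of_real r ^ n)"
    by (rule summable_comparison_test'[of "\<lambda>n. r ^ n" 0]) (use r in \<open>auto simp: tri_fps_def norm_power\<close>)
  then show "\<exists>z. norm z = r \<and> summable (\<lambda>n. fps_nth tri_fps n * z ^ n)"
    using r by (intro exI[of _ "of_real r"]) simp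
qed

lemma tri_gf_sums:
  assumes "norm z < 1"
  shows "(\<lambda>n. (if n \<in> range triangular then 1 else 0) * z ^ n) sums tri_gf z"
proof -
  have "ereal (norm z) < fps_conv_radius tri_fps"
    using tri_fps_conv_radius assms by (metis ereal_less(3) less_le_trans)
  from sums_eval_fps[OF this] show ?thesis by (simp add: tri_gf_def tri_fps_def)
qed

lemma tri_gf_sums': "norm z < 1 \<Longrightarrow> (\<lambda>k. z ^ triangular k) sums tri_gf z"
  using tri_gf_sums[of z]
    sums_mono_reindex[OF strict_mono_triangular, of "\<lambda>n. (if n \<in> range triangular then 1 else 0) * z ^ n" "tri_gf z"]
  by simp

lemma holomorphic_tri_gf: "tri_gf holomorphic_on ball 0 1"
  unfolding tri_gf_def
proof (rule holomorphic_on_eval_fps, rule subsetI)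
  fix z :: complex assume "z \<in> ball 0 1"
  then have "ereal (norm z) < fps_conv_radius tri_fps"
    using tri_fps_conv_radius by (metis ereal_less(3) less_le_trans mem_ball_0)
  then show "z \<in> eball 0 (fps_conv_radius tri_fps)" by (simp add: in_eball_iff)
qed

lemma holomorphic_ovp_gf: "ovp_gf holomorphic_on ball 0 1"
  unfolding ovp_gf_def
proof (rule holomorphic_on_eval_fps, rule subsetI)
  fix z :: complex assume "z \<in> ball 0 1"
  then have "ereal (norm z) < fps_conv_radius ovp_fps"
    using ovp_fps_conv_radius by (metis ereal_less(3) less_le_trans mem_ball_0)
  then show "z \<in> eball 0 (fps_conv_radius ovp_fps)" by (simp add: in_eball_iff)
qed

lemma tri_gf_minus_1_bound:
  assumes "norm z < 1"
  shows "norm (tri_gf z - 1) \<le> norm z / (1 - norm z)"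
proof -
  let ?f = "\<lambda>n. (if n \<in> range triangular then 1 else 0) * z ^ n"
  have "0 \<in> range triangular" using triangular_0 by (metis rangeI)
  then have "(\<lambda>n. ?f (Suc n)) sums (tri_gf z - 1)"
    using sums_split_initial_segment[OF tri_gf_sums[OF assms], of 1] by simp
  moreover have "(\<lambda>n. norm z ^ Suc n) sums (norm z / (1 - norm z))"
    using sums_mult[OF geometric_sums[of "norm z"], of "norm z"] assms by (simp add: power_commutes)
  ultimately show ?thesis
    by (rule norm_sums_le) (auto simp: norm_mult norm_power)
qed

lemma norm_tri_gf_ge_1:
  assumes "0 \<le> r" "r < 1"
  shows "norm (tri_gf (complex_of_real r)) \<ge> 1"
proof -
  have "(\<lambda>k. complex_of_real r ^ triangular k) sums tri_gf (of_real r)"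
    by (rule tri_gf_sums') (use assms in auto)
  from sums_Re[OF this] have s: "(\<lambda>k. r ^ triangular k) sums Re (tri_gf (of_real r))"
    by (simp flip: of_real_power)
  have "(\<Sum>k<1. r ^ triangular k) \<le> (\<Sum>k. r ^ triangular k)"
    using s assms by (intro sum_le_suminf) (auto simp: sums_iff)
  then have "1 \<le> Re (tri_gf (of_real r))" using s by (simp add: sums_iff)
  then show ?thesis using complex_Re_le_cmod order_trans by blast
qed

lemma Re_of_real_mult: "Re (of_real a * z) = a * Re z"
  by simp

definition main_fun :: "complex \<Rightarrow> complex" where
  "main_fun t = csqrt t / (2 * sqrt pi) * exp (of_real (pi\<^sup>2) / (4 * t))"

text \<open>By Gauss's identity \<open>ovp_gf\<close> is the reciprocal of the alternating theta
  series \<open>T\<close>; the transformation at \<open>s = 1 / t\<close> rewrites \<open>T\<close>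
  as the reciprocal of the main function times the triangular series.\<close>

lemma ovp_gf_transformation_real:
  assumes t: "t > 0"
  shows "ovp_gf (exp (- of_real t)) * tri_gf (exp (- of_real (2 * pi\<^sup>2) / of_real t)) = main_fun (of_real t)"
proof -
  define q where "q = exp (- t)"
  define w where "w = exp (- (2 * pi\<^sup>2) / t)"
  have q: "0 < q" "q < 1" and w: "0 < w" "w < 1" using t by (auto simp: q_def w_def)
  define T where "T = 1 + 2 * (\<Sum>j. (-1) ^ Suc j * exp (- (real (Suc j))\<^sup>2 / (1 / t)))"
  have T: "of_real T * ovp_gf (of_real q) = 1"
  proof -
    have "summable (\<lambda>j. norm (of_real q :: complex) ^ (Suc j)\<^sup>2)"
      by (rule summable_power_square) (use q in auto)
    then have "summable (\<lambda>j. norm ((-1) ^ Suc j * q ^ (Suc j)\<^sup>2))" using q by (simp only: norm_mult norm_power) simp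
    then have "summable (\<lambda>j. (-1) ^ Suc j * q ^ (Suc j)\<^sup>2)" by (rule summable_norm_cancel)
    then have "(\<lambda>j. (-1) ^ Suc j * q ^ (Suc j)\<^sup>2) sums (\<Sum>j. (-1) ^ Suc j * q ^ (Suc j)\<^sup>2)" by (rule summable_sums)
    then have "(\<lambda>j. complex_of_real ((-1) ^ Suc j * q ^ (Suc j)\<^sup>2)) sums of_real (\<Sum>j. (-1) ^ Suc j * q ^ (Suc j)\<^sup>2)" by (rule sums_of_real)
    then have "(\<Sum>j. (-1) ^ Suc j * complex_of_real q ^ (Suc j)\<^sup>2) = of_real (\<Sum>j. (-1) ^ Suc j * q ^ (Suc j)\<^sup>2)"
      by (simp add: sums_iff)
    moreover have "q ^ (Suc j)\<^sup>2 = exp (- (real (Suc j))\<^sup>2 / (1 / t))" for j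
      unfolding q_def exp_of_nat_mult[symmetric] by simp
    ultimately have "of_real T = 1 + 2 * (\<Sum>j. (-1) ^ Suc j * complex_of_real q ^ (Suc j)\<^sup>2)"
      by (simp add: T_def)
    then show ?thesis using gauss_identity[of "of_real q"] q by simp
  qed
  have "T = 2 * sqrt (pi * (1 / t)) * (\<Sum>k. exp (- (pi\<^sup>2 * (real k + 1 / 2)\<^sup>2 * (1 / t))))"
    unfolding T_def using t by (intro theta_transformation_real) auto
  also have "(\<Sum>k. exp (- (pi\<^sup>2 * (real k + 1 / 2)\<^sup>2 * (1 / t)))) = (\<Sum>k. exp (- pi\<^sup>2 / (4 * t)) * w ^ triangular k)"
  proof (intro arg_cong[of _ _ suminf] ext)
    fix k
    have "exp (- pi\<^sup>2 / (4 * t)) * w ^ triangular k = exp (- pi\<^sup>2 / (4 * t) + real (triangular k) * (- (2 * pi\<^sup>2) / t))"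
      unfolding w_def exp_of_nat_mult[symmetric] mult_exp_exp ..
    also have "- pi\<^sup>2 / (4 * t) + real (triangular k) * (- (2 * pi\<^sup>2) / t) = - (pi\<^sup>2 * (real k + 1 / 2)\<^sup>2 * (1 / t))"
      using t by (simp add: real_triangular field_simps power2_eq_square)
    finally show "exp (- (pi\<^sup>2 * (real k + 1 / 2)\<^sup>2 * (1 / t))) = exp (- pi\<^sup>2 / (4 * t)) * w ^ triangular k" ..
  qed
  also have "\<dots> = exp (- pi\<^sup>2 / (4 * t)) * (\<Sum>k. w ^ triangular k)"
  proof (rule suminf_mult)
    show "summable (\<lambda>k. w ^ triangular k)"
      using sums_Re[OF tri_gf_sums'[of "of_real w"]] w by (auto simp: sums_iff simp flip: of_real_power)
  qed
  finally have T2: "T = 2 * sqrt (pi / t) * exp (- pi\<^sup>2 / (4 * t)) * (\<Sum>k. w ^ triangular k)" by simp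
  have tri: "tri_gf (of_real w) = of_real (\<Sum>k. w ^ triangular k)"
  proof -
    have s: "(\<lambda>k. complex_of_real w ^ triangular k) sums tri_gf (of_real w)"
      by (rule tri_gf_sums') (use w in auto)
    from sums_Re[OF this] have "summable (\<lambda>k. w ^ triangular k)" by (auto simp: sums_iff simp flip: of_real_power)
    then have "(\<lambda>k. complex_of_real (w ^ triangular k)) sums of_real (\<Sum>k. w ^ triangular k)"
      by (intro sums_of_real summable_sums)
    with s show ?thesis by (simp add: sums_iff)
  qed
  have main: "main_fun (of_real t) = of_real (1 / (2 * sqrt (pi / t) * exp (- pi\<^sup>2 / (4 * t))))"
  proof -
    have "csqrt (of_real t) = of_real (sqrt t)" using t of_real_sqrt[of t] by simp
    moreover have "exp (of_real (pi\<^sup>2) / (4 * of_real t)) = complex_of_real (exp (pi\<^sup>2 / (4 * t)))"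
      by (simp add: exp_of_real[symmetric])
    moreover have "1 / (2 * sqrt (pi / t) * exp (- pi\<^sup>2 / (4 * t))) = sqrt t / (2 * sqrt pi) * exp (pi\<^sup>2 / (4 * t))"
      using t by (simp add: real_sqrt_divide exp_minus field_simps)
    ultimately show ?thesis unfolding main_fun_def by (simp only: of_real_mult of_real_divide of_real_numeral)
  qed
  have "of_real (2 * sqrt (pi / t) * exp (- pi\<^sup>2 / (4 * t))) * (tri_gf (of_real w) * ovp_gf (of_real q)) = 1"
    using T unfolding T2 tri by (simp only: of_real_mult mult.assoc)
  then have "ovp_gf (of_real q) * tri_gf (of_real w) = main_fun (of_real t)"
    unfolding main using t by (simp add: field_simps)
  moreover have "exp (- of_real t) = complex_of_real q" "exp (- of_real (2 * pi\<^sup>2) / of_real t) = complex_of_real w"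
    by (simp_all add: q_def w_def exp_of_real[symmetric])
  ultimately show ?thesis by simp
qed

lemma holomorphic_main_fun: "main_fun holomorphic_on {t. Re t > 0}"
  unfolding main_fun_def by (intro holomorphic_intros) (auto simp: complex_nonpos_Reals_iff)

lemma Re_one_over_pos: "Re t > 0 \<Longrightarrow> Re (1 / t) > 0"
  by (simp add: Re_divide zero_less_divide_iff sum_power2_gt_zero_iff)

lemma exp_inv_eq: "- of_real (2 * pi\<^sup>2) / t = - (of_real (2 * pi\<^sup>2) * (1 / t))" for t :: complex
  by simp

lemma norm_exp_inv: "norm (exp (- of_real (2 * pi\<^sup>2) / t)) = exp (- (2 * pi\<^sup>2) * Re (1 / t))" for t :: complex
  unfolding exp_inv_eq norm_exp_eq_Re by (simp only: Re_complex_of_real Re_of_real_mult uminus_complex.sel) simp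

text \<open>Both sides are holomorphic in the right half-plane, the principal square root included,
  and agree on the positive axis, which accumulates at 1.\<close>

lemma ovp_gf_transformation:
  assumes t: "Re t > 0"
  shows "ovp_gf (exp (- t)) * tri_gf (exp (- of_real (2 * pi\<^sup>2) / t)) = main_fun t"
proof -
  define S where "S = {t. Re t > 0}"
  define H where "H = (\<lambda>t. ovp_gf (exp (- t)) * tri_gf (exp (- of_real (2 * pi\<^sup>2) / t)) - main_fun t)"
  have "H t = 0"
  proof (rule analytic_continuation[where f = H and S = S and U = "complex_of_real ` {0<..}" and \<xi> = 1])
    have 1: "(ovp_gf \<circ> (\<lambda>t. exp (- t))) holomorphic_on S"
      by (rule holomorphic_on_compose_gen[OF _ holomorphic_ovp_gf])
         (auto intro!: holomorphic_intros simp: S_def)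
    have 2: "(tri_gf \<circ> (\<lambda>t. exp (- of_real (2 * pi\<^sup>2) / t))) holomorphic_on S"
    proof (rule holomorphic_on_compose_gen[OF _ holomorphic_tri_gf])
      show "(\<lambda>t. exp (- of_real (2 * pi\<^sup>2) / t)) holomorphic_on S"
        by (intro holomorphic_intros) (auto simp: S_def)
      show "(\<lambda>t. exp (- of_real (2 * pi\<^sup>2) / t)) ` S \<subseteq> ball 0 1"
      proof
        fix z assume "z \<in> (\<lambda>t. exp (- of_real (2 * pi\<^sup>2) / t)) ` S"
        then obtain t where "Re t > 0" "z = exp (- of_real (2 * pi\<^sup>2) / t)" by (auto simp: S_def)
        then have "norm z < 1" using Re_one_over_pos[of t] by (simp only: norm_exp_inv) simp
        then show "z \<in> ball 0 1" by simp
      qed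
    qed
    show "H holomorphic_on S" unfolding H_def
      using 1 2 holomorphic_main_fun by (intro holomorphic_intros) (simp_all only: o_def S_def)
    show "open S" unfolding S_def by (rule open_halfspace_Re_gt)
    show "connected S" unfolding S_def by (intro convex_connected convex_halfspace_Re_gt)
    show "complex_of_real ` {0<..} \<subseteq> S" "1 \<in> S" "t \<in> S" using t by (auto simp: S_def)
    show "1 islimpt complex_of_real ` {0<..}"
    proof (rule islimptI)
      fix T assume "(1::complex) \<in> T" "open T"
      then obtain e where e: "e > 0" "ball 1 e \<subseteq> T" using open_contains_ball by blast
      have "complex_of_real (1 + e / 2) \<in> ball 1 e" using e by (simp add: dist_norm)
      then show "\<exists>y\<in>complex_of_real ` {0<..}. y \<in> T \<and> y \<noteq> 1"
        using e by (intro bexI[of _ "complex_of_real (1 + e / 2)"] imageI) auto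
    qed
    show "H z = 0" if "z \<in> complex_of_real ` {0<..}" for z
      using that ovp_gf_transformation_real by (auto simp: H_def)
  qed
  then show ?thesis by (simp add: H_def)
qed

section \<open>Bounds for the generating function near and away from t = 0\<close>

lemma norm_main_fun: "norm (main_fun t) = sqrt (norm t) / (2 * sqrt pi) * exp (pi\<^sup>2 / 4 * Re (1 / t))"
proof -
  have "of_real (pi\<^sup>2) / (4 * t) = of_real (pi\<^sup>2 / 4) * (1 / t)" by simp
  then have "Re (of_real (pi\<^sup>2) / (4 * t)) = pi\<^sup>2 / 4 * Re (1 / t)" by (simp only: Re_of_real_mult)
  then show ?thesis by (simp only: main_fun_def norm_mult norm_divide norm_exp_eq_Re) (simp add: norm_mult)
qed

text \<open>With |w| <= 1/4 the dual series is within 4/3 |w| of 1 and at least 2/3 in modulus, so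
  the relative error is at most 2 |w|. As |w| = exp (- 2 pi^2 Re (1 / t)) outweighs the growth exp
  (pi^2 / 4 Re (1 / t)) of the main function, the absolute error stays bounded.\<close>

lemma ovp_gf_near:
  assumes t: "Re t > 0" and \<rho>: "exp (- (2 * pi\<^sup>2) * Re (1 / t)) \<le> 1 / 4"
  shows "norm (ovp_gf (exp (- t)) - main_fun t) \<le> sqrt (norm t)"
proof -
  define w where "w = exp (- of_real (2 * pi\<^sup>2) / t)"
  define r where "r = norm w"
  have r: "r = exp (- (2 * pi\<^sup>2) * Re (1 / t))"
    unfolding r_def w_def by (rule norm_exp_inv)
  have r0: "0 \<le> r" "r \<le> 1 / 4" using \<rho> r by (simp_all only: exp_ge_zero)
  have K: "norm (tri_gf w - 1) \<le> 4 / 3 * r"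
  proof -
    have "norm (tri_gf w - 1) \<le> r / (1 - r)"
      unfolding r_def by (rule tri_gf_minus_1_bound) (use r0 r_def in simp)
    also have "\<dots> \<le> r / (3 / 4)" using r0 by (intro divide_left_mono) auto
    finally show ?thesis by simp
  qed
  then have K2: "norm (tri_gf w) \<ge> 2 / 3"
    using norm_triangle_ineq2[of 1 "1 - tri_gf w"] r0 by (simp add: norm_minus_commute)
  have "ovp_gf (exp (- t)) * tri_gf w = main_fun t" unfolding w_def by (rule ovp_gf_transformation[OF t])
  moreover have "tri_gf w \<noteq> 0" using K2 by auto
  ultimately have "ovp_gf (exp (- t)) = main_fun t / tri_gf w" by (simp add: field_simps)
  then have "ovp_gf (exp (- t)) - main_fun t = main_fun t * ((1 - tri_gf w) / tri_gf w)"
    using \<open>tri_gf w \<noteq> 0\<close> by (simp add: field_simps)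
  then have "norm (ovp_gf (exp (- t)) - main_fun t) = norm (main_fun t) * (norm (tri_gf w - 1) / norm (tri_gf w))"
    by (simp add: norm_mult norm_divide norm_minus_commute)
  also have "\<dots> \<le> norm (main_fun t) * ((4 / 3 * r) / (2 / 3))"
    using K K2 r0 by (intro mult_left_mono frac_le) auto
  also have "\<dots> = sqrt (norm t) / sqrt pi * (exp (pi\<^sup>2 / 4 * Re (1 / t)) * r)"
    by (simp add: norm_main_fun)
  also have "exp (pi\<^sup>2 / 4 * Re (1 / t)) * r = exp (- (7 / 4 * pi\<^sup>2 * Re (1 / t)))"
    unfolding r mult_exp_exp by (simp add: algebra_simps)
  also have "sqrt (norm t) / sqrt pi * \<dots> \<le> sqrt (norm t) / 1 * 1"
  proof (intro mult_mono divide_left_mono)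
    show "1 \<le> sqrt pi" using pi_gt3 by simp
    show "exp (- (7 / 4 * pi\<^sup>2 * Re (1 / t))) \<le> 1" using Re_one_over_pos[OF t] by simp
  qed auto
  finally show ?thesis by simp
qed

text \<open>For real \<open>t\<close> the dual series is at least 1 in modulus, so the main function
  is an upper bound without any error term.\<close>

lemma norm_ovp_gf_real:
  assumes t: "t > 0"
  shows "norm (ovp_gf (of_real (exp (- t)))) \<le> sqrt t / (2 * sqrt pi) * exp (pi\<^sup>2 / (4 * t))"
proof -
  define w where "w = exp (- (2 * pi\<^sup>2) / t)"
  have w: "0 \<le> w" "w < 1" using t by (auto simp: w_def)
  have e: "exp (- of_real t) = complex_of_real (exp (- t))" "exp (- of_real (2 * pi\<^sup>2) / of_real t) = complex_of_real w"
    by (simp_all add: w_def exp_of_real[symmetric])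
  have "norm (ovp_gf (of_real (exp (- t)))) * 1 \<le> norm (ovp_gf (of_real (exp (- t)))) * norm (tri_gf (of_real w))"
    by (intro mult_left_mono norm_tri_gf_ge_1 w) auto
  also have "\<dots> = norm (main_fun (of_real t))"
    using ovp_gf_transformation_real[OF t] unfolding e by (simp flip: norm_mult)
  also have "\<dots> = sqrt t / (2 * sqrt pi) * exp (pi\<^sup>2 / (4 * t))"
    unfolding norm_main_fun using t by (simp add: Re_divide power2_eq_square)
  finally show ?thesis by simp
qed

text \<open>The series ln ((1 + z) / (1 - z)) = 2 (z + z^3 / 3 + ...) has nonnegative coefficients,
  so every term of its value at |z| minus the real part of its value at z is nonnegative. Keeping
  only the linear term gives the exponential factor.\<close>

lemma norm_quot_le:
  fixes z :: complex
  assumes z: "norm z < 1"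
  shows "norm ((1 + z) / (1 - z)) \<le> (1 + norm z) / (1 - norm z) * exp (2 * (Re z - norm z))"
proof -
  define c where "c = (\<lambda>n. (1 - (-1) ^ n) / real n)"
  have ser: "(\<lambda>n. of_real (c n) * w ^ n) sums (ln (1 + w) - ln (1 - w))" if "norm w < 1" for w :: complex
  proof -
    have "(\<lambda>n. (-1)^Suc n / of_nat n * w^n - (-1)^Suc n / of_nat n * (-w)^n) sums (ln (1 + w) - ln (1 + - w))"
      by (intro sums_diff Ln_series) (use that in auto)
    moreover have "(-1)^Suc n / of_nat n * w^n - (-1)^Suc n / of_nat n * (-w)^n = of_real (c n) * w ^ n" for n
      by (cases "even n") (auto simp: c_def field_simps)
    ultimately show ?thesis by simp
  qed
  \<comment> \<open>Only real parts are compared, so the branch of the complex logarithm does not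
    matter.\<close>
  have lnq: "Re (ln (1 + w) - ln (1 - w)) = ln (norm ((1 + w) / (1 - w)))" if "norm w < 1" for w :: complex
  proof -
    have nz: "1 + w \<noteq> 0" "1 - w \<noteq> 0" using that by (auto simp: add_eq_0_iff)
    then show ?thesis by (simp add: Re_Ln norm_divide ln_div)
  qed
  define r where "r = norm z"
  have r: "0 \<le> r" "r < 1" using z by (auto simp: r_def)
  have "(\<lambda>n. of_real (c n) * of_real r ^ n - of_real (c n) * z ^ n) sums
     ((ln (1 + complex_of_real r) - ln (1 - of_real r)) - (ln (1 + z) - ln (1 - z)))"
    by (intro sums_diff ser) (use z r in auto)
  from sums_Re[OF this]
  have "(\<lambda>n. c n * (r ^ n - Re (z ^ n))) sums
     (ln (norm ((1 + complex_of_real r) / (1 - of_real r))) - ln (norm ((1 + z) / (1 - z))))"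
    using lnq[of z] lnq[of "of_real r"] z r by (simp add: algebra_simps flip: of_real_power)
  moreover have nn: "0 \<le> c n * (r ^ n - Re (z ^ n))" for n
  proof (rule mult_nonneg_nonneg)
    show "0 \<le> c n" by (cases "even n") (auto simp: c_def)
    have "Re (z ^ n) \<le> norm (z ^ n)" by (rule complex_Re_le_cmod)
    then show "0 \<le> r ^ n - Re (z ^ n)" by (simp add: norm_power r_def)
  qed
  ultimately have "(\<Sum>n\<in>{1}. c n * (r ^ n - Re (z ^ n))) \<le> ln (norm ((1 + complex_of_real r) / (1 - of_real r))) - ln (norm ((1 + z) / (1 - z)))"
    using sum_le_suminf[of "\<lambda>n. c n * (r ^ n - Re (z ^ n))" "{1}"] by (simp add: sums_iff)
  then have "ln (norm ((1 + z) / (1 - z))) \<le> ln (norm ((1 + complex_of_real r) / (1 - of_real r))) + 2 * (Re z - r)"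
    by (simp add: c_def algebra_simps)
  moreover have "norm ((1 + complex_of_real r) / (1 - of_real r)) = (1 + r) / (1 - r)"
  proof -
    have "(1 + complex_of_real r) / (1 - of_real r) = of_real ((1 + r) / (1 - r))" by simp
    then show ?thesis using r by (simp only: norm_of_real) simp
  qed
  ultimately have "ln (norm ((1 + z) / (1 - z))) \<le> ln ((1 + r) / (1 - r)) + 2 * (Re z - r)" by simp
  then have "exp (ln (norm ((1 + z) / (1 - z)))) \<le> exp (ln ((1 + r) / (1 - r)) + 2 * (Re z - r))" by simp
  also have "\<dots> = (1 + r) / (1 - r) * exp (2 * (Re z - r))"
    using r by (simp add: exp_add)
  also have "exp (ln (norm ((1 + z) / (1 - z)))) = norm ((1 + z) / (1 - z))"
  proof (rule exp_ln)
    have nz: "1 + z \<noteq> 0" "1 - z \<noteq> 0" using z by (auto simp: add_eq_0_iff)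
    then show "0 < norm ((1 + z) / (1 - z))" by simp
  qed
  finally show ?thesis by (simp add: r_def)
qed

lemma euler_quot_Suc: "euler_quot (Suc k) z = euler_quot k z * ((1 + z ^ Suc k) / (1 - z ^ Suc k))"
  by (simp add: euler_quot_def del: power_Suc)

text \<open>The factorwise bound is multiplied up over all factors. The exponents then form
  geometric series in q and |q|, each with limit 1 / (1 - w) - 1, and the two constants
  cancel.\<close>

lemma ovp_gf_far:
  assumes q: "norm q < 1"
  shows "norm (ovp_gf q) \<le> norm (ovp_gf (of_real (norm q))) * exp (2 * (Re (1 / (1 - q)) - 1 / (1 - norm q)))"
proof -
  define r where "r = norm q"
  have r: "0 \<le> r" "r < 1" using q by (auto simp: r_def)
  have fin: "norm (euler_quot k q) \<le> norm (euler_quot k (complex_of_real r)) * exp (2 * (Re (\<Sum>i<k. q ^ Suc i) - (\<Sum>i<k. r ^ Suc i)))" for k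
  proof (induction k)
    case (Suc k)
    have "norm ((1 + q ^ Suc k) / (1 - q ^ Suc k)) \<le> (1 + r ^ Suc k) / (1 - r ^ Suc k) * exp (2 * (Re (q ^ Suc k) - r ^ Suc k))"
      using norm_quot_le[of "q ^ Suc k"] norm_power_lt_1[OF q, of "Suc k"] by (simp add: norm_power norm_mult r_def)
    also have "(1 + r ^ Suc k) / (1 - r ^ Suc k) = norm ((1 + complex_of_real r ^ Suc k) / (1 - complex_of_real r ^ Suc k))"
    proof -
      have "(1 + complex_of_real r ^ Suc k) / (1 - complex_of_real r ^ Suc k) = of_real ((1 + r ^ Suc k) / (1 - r ^ Suc k))" by simp
      moreover have "(1 + r ^ Suc k) / (1 - r ^ Suc k) \<ge> 0" using r norm_power_lt_1[of r "Suc k"] 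
        by (intro divide_nonneg_nonneg) (auto simp del: power_Suc)
      ultimately show ?thesis by (simp only: norm_of_real abs_of_nonneg)
    qed
    finally have A: "norm ((1 + q ^ Suc k) / (1 - q ^ Suc k)) \<le> norm ((1 + complex_of_real r ^ Suc k) / (1 - complex_of_real r ^ Suc k)) * exp (2 * (Re (q ^ Suc k) - r ^ Suc k))" .
    have "norm (euler_quot (Suc k) q) = norm (euler_quot k q) * norm ((1 + q ^ Suc k) / (1 - q ^ Suc k))"
      unfolding euler_quot_Suc norm_mult ..
    also have "\<dots> \<le> (norm (euler_quot k (complex_of_real r)) * exp (2 * (Re (\<Sum>i<k. q ^ Suc i) - (\<Sum>i<k. r ^ Suc i)))) *
       (norm ((1 + complex_of_real r ^ Suc k) / (1 - complex_of_real r ^ Suc k)) * exp (2 * (Re (q ^ Suc k) - r ^ Suc k)))"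
      by (intro mult_mono Suc.IH A) auto
    also have "\<dots> = (norm (euler_quot k (complex_of_real r)) * norm ((1 + complex_of_real r ^ Suc k) / (1 - complex_of_real r ^ Suc k))) *
       (exp (2 * (Re (\<Sum>i<k. q ^ Suc i) - (\<Sum>i<k. r ^ Suc i))) * exp (2 * (Re (q ^ Suc k) - r ^ Suc k)))"
      by (simp only: mult_ac)
    also have "norm (euler_quot k (complex_of_real r)) * norm ((1 + complex_of_real r ^ Suc k) / (1 - complex_of_real r ^ Suc k))
       = norm (euler_quot (Suc k) (complex_of_real r))"
      unfolding euler_quot_Suc norm_mult ..
    also have "exp (2 * (Re (\<Sum>i<k. q ^ Suc i) - (\<Sum>i<k. r ^ Suc i))) * exp (2 * (Re (q ^ Suc k) - r ^ Suc k))
       = exp (2 * (Re (\<Sum>i<Suc k. q ^ Suc i) - (\<Sum>i<Suc k. r ^ Suc i)))"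
      by (simp add: mult_exp_exp algebra_simps del: power_Suc)
    finally show ?case .
  qed (simp add: euler_quot_def)
  have geo: "(\<lambda>k. \<Sum>i<k. w ^ Suc i) \<longlonglongrightarrow> 1 / (1 - w) - 1" if "norm w < 1" for w :: "'a::{real_normed_field, banach}"
  proof -
    have "1 - w \<noteq> 0" using that by auto
    then have "w * (1 / (1 - w)) = 1 / (1 - w) - 1" by (simp add: field_simps)
    then show ?thesis using sums_mult[OF geometric_sums[OF that], of w] by (simp add: sums_def)
  qed
  have "(\<lambda>k. norm (euler_quot k (complex_of_real r)) * exp (2 * (Re (\<Sum>i<k. q ^ Suc i) - (\<Sum>i<k. r ^ Suc i)))) \<longlonglongrightarrow>
    norm (ovp_gf (of_real r)) * exp (2 * (Re (1 / (1 - q) - 1) - (1 / (1 - r) - 1)))"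
    by (intro tendsto_intros euler_quot_tendsto geo) (use q r in auto)
  moreover have "(\<lambda>k. norm (euler_quot k q)) \<longlonglongrightarrow> norm (ovp_gf q)"
    by (intro tendsto_intros euler_quot_tendsto q)
  ultimately have "norm (ovp_gf q) \<le> norm (ovp_gf (of_real r)) * exp (2 * (Re (1 / (1 - q) - 1) - (1 / (1 - r) - 1)))"
    using fin by (intro LIMSEQ_le) auto
  then show ?thesis by (simp add: r_def)
qed

section \<open>The circle method\<close>

text \<open>Cauchy's coefficient formula in the variable q = exp (- t), which maps the segment onto
  a full circle. The series is integrated term by term; for k other than n the primitive of exp ((n
  - k) t) takes equal values at both ends. The factor \<open>\<i>\<close> from dt is divided
  out.\<close>

lemma ovp_contour_integral:
  assumes c: "c > 0"
  shows "((\<lambda>\<theta>. ovp_gf (exp (- Complex c \<theta>)) * exp (of_nat n * Complex c \<theta>)) has_integral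
           of_real (2 * pi * num_overpartitions n)) {-pi..pi}"
proof -
  let ?a = "Complex c (-pi)" and ?b = "Complex c pi"
  define f where "f = (\<lambda>k (t::complex). of_nat (num_overpartitions k) * exp (- t) ^ k * exp (of_nat n * t))"
  have Re: "Re t = c" if t: "t \<in> closed_segment ?a ?b" for t
    using t by (auto simp: closed_segment_same_Re)
  have "uniform_limit (closed_segment ?a ?b) (\<lambda>N t. \<Sum>k<N. f k t) (\<lambda>t. \<Sum>k. f k t) sequentially"
  proof (rule Weierstrass_m_test)
    show "norm (f k t) \<le> num_overpartitions k * exp (- c) ^ k * exp (real n * c)"
      if "t \<in> closed_segment ?a ?b" for k t
      using Re[OF that] by (simp add: f_def norm_mult norm_power)
    show "summable (\<lambda>k. num_overpartitions k * exp (- c) ^ k * exp (real n * c))"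
      by (intro summable_mult2 summable_num_overpartitions) (use c in auto)
  qed
  moreover have sum_eq: "(\<Sum>k. f k t) = ovp_gf (exp (- t)) * exp (of_nat n * t)" if "t \<in> closed_segment ?a ?b" for t
  proof -
    have "(\<lambda>k. f k t) sums (ovp_gf (exp (- t)) * exp (of_nat n * t))"
      unfolding f_def using Re[OF that] c by (intro sums_mult2 ovp_gf_sums) simp
    then show ?thesis by (simp add: sums_iff)
  qed
  ultimately have u: "uniform_limit (closed_segment ?a ?b) (\<lambda>N t. \<Sum>k<N. f k t) (\<lambda>t. ovp_gf (exp (- t)) * exp (of_nat n * t)) sequentially"
    by (subst uniform_limit_cong'[OF refl sum_eq[symmetric]])
  have cont: "continuous_on (closed_segment ?a ?b) (f k)" for k
    unfolding f_def by (intro continuous_intros)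
  obtain J where J: "((\<lambda>t. ovp_gf (exp (- t)) * exp (of_nat n * t)) has_contour_integral J) (linepath ?a ?b)"
     "(\<lambda>k. contour_integral (linepath ?a ?b) (f k)) sums J"
    using contour_integral_sums_linepath[OF u cont] by blast
  have int: "contour_integral (linepath ?a ?b) (f k) = (if k = n then 2 * pi * \<i> * num_overpartitions n else 0)" for k
  proof (cases "k = n")
    case True
    have "f k t = of_nat (num_overpartitions n)" for t
    proof -
      have "exp (- t) ^ n * exp (of_nat n * t) = 1" by (simp flip: exp_of_nat_mult exp_add)
      then show ?thesis unfolding f_def True by (simp add: mult.assoc)
    qed
    then have "f k = (\<lambda>_. of_nat (num_overpartitions n))" by auto
    moreover have "?b - ?a = 2 * pi * \<i>" by (simp add: complex_eq_iff)
    ultimately show ?thesis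
      using True contour_integral_const_linepath[of ?a ?b "of_nat (num_overpartitions n)"] by simp
  next
    case False
    define d where "d = (of_nat n - of_nat k :: complex)"
    have d: "d \<noteq> 0" using False by (simp add: d_def)
    define g where "g = (\<lambda>t. of_nat (num_overpartitions k) * exp (d * t) / d)"
    have fe: "f k t = of_nat (num_overpartitions k) * exp (d * t)" for t
    proof -
      have "exp (- t) ^ k * exp (of_nat n * t) = exp (d * t)"
        by (simp add: d_def algebra_simps flip: exp_of_nat_mult exp_add)
      then show ?thesis unfolding f_def by (simp add: mult.assoc)
    qed
    have "(f k has_contour_integral (g (pathfinish (linepath ?a ?b)) - g (pathstart (linepath ?a ?b)))) (linepath ?a ?b)"
    proof (rule contour_integral_primitive[where S = UNIV])
      show "(g has_field_derivative f k t) (at t within UNIV)" for t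
        unfolding fe g_def using d by (auto intro!: derivative_eq_intros)
    qed auto
    moreover have "g ?b = g ?a"
    proof -
      have "d * ?b = d * ?a + 2 * of_int (int n - int k) * pi * \<i>"
        by (simp add: d_def complex_eq_iff algebra_simps)
      then have "exp (d * ?b) = exp (d * ?a)"
        unfolding exp_eq by (intro exI[of _ "int n - int k"]) simp
      then show ?thesis by (simp add: g_def)
    qed
    ultimately have "(f k has_contour_integral 0) (linepath ?a ?b)" by simp
    then have "contour_integral (linepath ?a ?b) (f k) = 0" by (rule contour_integral_unique)
    with False show ?thesis by simp
  qed
  have "(\<lambda>k. if k = n then 2 * pi * \<i> * num_overpartitions n else 0) sums (2 * pi * \<i> * num_overpartitions n)"
    by (rule sums_single)
  then have "J = 2 * pi * \<i> * num_overpartitions n"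
    using J(2) sums_unique2 unfolding int by blast
  then have "((\<lambda>\<theta>. ovp_gf (exp (- Complex c \<theta>)) * exp (of_nat n * Complex c \<theta>)) has_integral (- \<i> * (2 * pi * \<i> * num_overpartitions n))) {-pi..pi}"
    using J(1) by (subst (asm) has_contour_integral_linepath_same_Re_iff) auto
  moreover have "- \<i> * (2 * pi * \<i> * num_overpartitions n) = of_real (2 * pi * num_overpartitions n)"
    by (simp add: complex_eq_iff)
  ultimately show ?thesis by (simp only:)
qed

section \<open>The main term: contour deformation at the saddle point\<close>

definition integrand :: "nat \<Rightarrow> complex \<Rightarrow> complex" where
  "integrand n t = main_fun t * exp (of_nat n * t)"

context
  fixes x t0 :: real and n :: nat
  assumes n: "n \<ge> 1" and x_def: "x = pi * sqrt (real n)" and t0_def: "t0 = pi\<^sup>2 / (2 * x)"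
begin

lemma x_pos: "x > 0" using n by (simp add: x_def)
lemma t0_pos: "t0 > 0" using x_pos by (simp add: t0_def)
lemma n_t0: "real n * t0 = x / 2"
  using n by (simp add: t0_def x_def power2_eq_square field_simps)
lemma pi_t0: "pi\<^sup>2 / (4 * t0) = x / 2"
  using x_pos by (simp add: t0_def power2_eq_square field_simps)

lemma holomorphic_integrand: "(integrand n) holomorphic_on {t. Re t > 0}"
  unfolding integrand_def by (intro holomorphic_intros holomorphic_main_fun)

text \<open>At distance l t0 on a ray of angle pi / 3 or - pi / 3 the real part of the exponent is x
  / 4 (l + 1 / l). On 1 <= l <= 2 this is largest at l = 2, with value 5 x / 8; the product (l -
  1/2) (l - 2) encodes that inequality.\<close>

lemma norm_integrand_ray:
  assumes l: "1 \<le> l" "l \<le> 2" and \<phi>: "cos \<phi> = 1 / 2"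
  shows "norm ((integrand n) (of_real (l * t0) * cis \<phi>)) \<le> sqrt (2 * t0) / (2 * sqrt pi) * exp (5 / 8 * x)"
proof -
  have "1 / (of_real (l * t0) * cis \<phi>) = of_real (1 / (l * t0)) * cis (- \<phi>)"
    by (simp add: cis_inverse[symmetric] divide_inverse del: cis_inverse)
  then have "Re (1 / (of_real (l * t0) * cis \<phi>)) = 1 / (l * t0) * (1 / 2)"
    using \<phi> by (simp only: Re_of_real_mult cis.sel cos_minus)
  then have "norm ((integrand n) (of_real (l * t0) * cis \<phi>)) =
     sqrt (l * t0) / (2 * sqrt pi) * (exp (pi\<^sup>2 / 4 * (1 / (l * t0) * (1 / 2))) * exp (real n * (l * t0 * (1 / 2))))"
    unfolding integrand_def norm_mult norm_main_fun norm_exp_eq_Re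
    using l t0_pos \<phi> by (simp add: norm_mult)
  also have "exp (pi\<^sup>2 / 4 * (1 / (l * t0) * (1 / 2))) * exp (real n * (l * t0 * (1 / 2))) =
     exp ((pi\<^sup>2 / (4 * t0)) / l / 2 + (real n * t0) * l / 2)"
    unfolding mult_exp_exp using l t0_pos by (simp add: field_simps)
  also have "\<dots> = exp (x / 4 * (1 / l + l))" unfolding pi_t0 n_t0 by (simp add: field_simps)
  also have "sqrt (l * t0) / (2 * sqrt pi) * \<dots> \<le> sqrt (2 * t0) / (2 * sqrt pi) * exp (5 / 8 * x)"
  proof (intro mult_mono divide_right_mono)
    show "sqrt (l * t0) \<le> sqrt (2 * t0)" using l t0_pos by simp
    have "(l - 1 / 2) * (l - 2) \<le> 0" using l by (intro mult_nonneg_nonpos) auto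
    then have "1 / l + l \<le> 5 / 2" using l by (simp add: field_simps)
    then have "x / 4 * (1 / l + l) \<le> x / 4 * (5 / 2)" using x_pos by (intro mult_left_mono) auto
    then show "exp (x / 4 * (1 / l + l)) \<le> exp (5 / 8 * x)" by simp
  qed (use t0_pos in auto)
  finally show ?thesis .
qed

text \<open>The ends of the middle piece of the vertical segment are the outer ends of the two
  rays.\<close>

lemma Complex_cis_third: "Complex t0 (sqrt 3 * t0) = of_real (2 * t0) * cis (pi / 3)"
  "Complex t0 (- (sqrt 3 * t0)) = of_real (2 * t0) * cis (- (pi / 3))"
  by (simp_all add: complex_eq_iff cos_60 sin_60)

lemma ray_integral_bound:
  assumes \<phi>: "\<phi> = pi / 3 \<or> \<phi> = - pi / 3"
  defines "b \<equiv> of_real (2 * t0) * cis \<phi>" and "c \<equiv> of_real t0 * cis \<phi>"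
  shows "norm (contour_integral (linepath b c) (integrand n)) \<le> sqrt (2 * t0) / (2 * sqrt pi) * exp (5 / 8 * x) * t0"
    and "closed_segment b c \<subseteq> {t. Re t > 0}"
proof -
  have "cos (- pi / 3) = 1 / 2" using cos_60 cos_minus[of "pi / 3"] by simp
  then have cos: "cos \<phi> = 1 / 2" using \<phi> cos_60 by blast
  have seg: "\<exists>l. 1 \<le> l \<and> l \<le> 2 \<and> t = of_real (l * t0) * cis \<phi>" if "t \<in> closed_segment b c" for t
  proof -
    have "\<exists>u. 0 \<le> u \<and> u \<le> 1 \<and> t = (1 - u) *\<^sub>R b + u *\<^sub>R c"
      using that by (simp only: in_segment)
    then obtain u where u: "0 \<le> u" "u \<le> 1" "t = (1 - u) *\<^sub>R b + u *\<^sub>R c" by blast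
    have "t = of_real ((2 - u) * t0) * cis \<phi>"
      unfolding u(3) b_def c_def scaleR_conv_of_real by (simp add: algebra_simps)
    then show ?thesis using u by (intro exI[of _ "2 - u"]) auto
  qed
  show sub: "closed_segment b c \<subseteq> {t. Re t > 0}"
  proof
    fix t assume "t \<in> closed_segment b c"
    from seg[OF this] obtain l where "1 \<le> l" "t = of_real (l * t0) * cis \<phi>" by blast
    then show "t \<in> {t. Re t > 0}" using cos t0_pos by simp
  qed
  have "norm (contour_integral (linepath b c) (integrand n)) \<le> sqrt (2 * t0) / (2 * sqrt pi) * exp (5 / 8 * x) * norm (c - b)"
  proof (rule contour_integral_bound_linepath)
    show "(integrand n) contour_integrable_on linepath b c"
      by (intro contour_integrable_continuous_linepath holomorphic_on_imp_continuous_on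
          holomorphic_on_subset[OF holomorphic_integrand sub])
    show "norm ((integrand n) t) \<le> sqrt (2 * t0) / (2 * sqrt pi) * exp (5 / 8 * x)" if "t \<in> closed_segment b c" for t
      using seg[OF that] norm_integrand_ray[OF _ _ cos] by blast
  qed (use t0_pos in auto)
  also have "norm (c - b) = t0"
  proof -
    have "c - b = of_real (- t0) * cis \<phi>" by (simp add: b_def c_def algebra_simps)
    then show ?thesis using t0_pos by (simp add: norm_mult)
  qed
  finally show "norm (contour_integral (linepath b c) (integrand n)) \<le> sqrt (2 * t0) / (2 * sqrt pi) * exp (5 / 8 * x) * t0" .
qed

text \<open>Cauchy's theorem for the closed path up the segment, in along one ray, back along the
  arc and out along the other ray. It stays in the right half-plane, where the integrand is
  holomorphic, so segment and arc differ by two ray integrals of length t0.\<close>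

lemma main_integral_deform:
  "norm (integral {-(sqrt 3 * t0)..sqrt 3 * t0} (\<lambda>\<theta>. (integrand n) (Complex t0 \<theta>))
     - integral {-(pi/3)..pi/3} (\<lambda>\<phi>. (integrand n) (of_real t0 * cis \<phi>) * of_real t0 * cis \<phi>))
   \<le> sqrt (2 * t0) / sqrt pi * exp (5 / 8 * x) * t0"
proof -
  define a where "a = of_real (2 * t0) * cis (- (pi / 3))"
  define b where "b = of_real (2 * t0) * cis (pi / 3)"
  define c where "c = of_real t0 * cis (pi / 3)"
  define d where "d = of_real t0 * cis (- (pi / 3))"
  let ?S = "{t. Re t > 0}"
  define arc where "arc = part_circlepath 0 t0 (- (pi/3)) (pi/3)"
  have S: "convex ?S" "open ?S" by (intro convex_halfspace_Re_gt open_halfspace_Re_gt)+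
  have B: "norm (contour_integral (linepath b c) (integrand n)) \<le> sqrt (2 * t0) / (2 * sqrt pi) * exp (5 / 8 * x) * t0"
    "closed_segment b c \<subseteq> ?S" unfolding b_def c_def by (rule ray_integral_bound; simp)+
  have D: "norm (contour_integral (linepath a d) (integrand n)) \<le> sqrt (2 * t0) / (2 * sqrt pi) * exp (5 / 8 * x) * t0"
    "closed_segment a d \<subseteq> ?S" unfolding a_def d_def by (rule ray_integral_bound; simp)+
  have ab: "closed_segment a b \<subseteq> ?S"
    by (rule closed_segment_subset) (use t0_pos S in \<open>auto simp: a_def b_def cos_60\<close>)
  have arcS: "path_image arc \<subseteq> ?S"
  proof
    fix t assume "t \<in> path_image arc"
    then obtain \<phi> where p: "t = of_real t0 * exp (\<i> * of_real \<phi>)" "- (pi/3) \<le> \<phi>" "\<phi> \<le> pi/3"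
      by (auto simp: arc_def path_image_part_circlepath)
    have "cos \<phi> > 0" by (intro cos_gt_zero_pi) (use p(2,3) pi_gt_zero in linarith)+
    then show "t \<in> ?S" using p t0_pos by (simp add: exp_Euler cos_of_real sin_of_real)
  qed
  have ends: "pathstart arc = d" "pathfinish arc = c"
    by (simp_all add: arc_def d_def c_def cis_conv_exp)
  have va: "valid_path arc" by (simp add: arc_def)
  let ?rarc = "reversepath arc"
  let ?g = "linepath a b +++ linepath b c +++ ?rarc +++ linepath d a"
  have da: "closed_segment d a \<subseteq> ?S" using D(2) by (simp add: closed_segment_commute)
  have "((integrand n) has_contour_integral 0) ?g"
    by (rule Cauchy_theorem_convex_simple[OF holomorphic_integrand S(1)])
       (use ab B(2) arcS da ends va in \<open>auto simp: path_image_join valid_path_join\<close>)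
  then have "0 = contour_integral ?g (integrand n)" by (simp add: contour_integral_unique)
  have int: "(integrand n) contour_integrable_on g" if "valid_path g" "path_image g \<subseteq> ?S" for g
    using contour_integrable_holomorphic_simple[OF holomorphic_integrand S(2) that] .
  have i: "(integrand n) contour_integrable_on linepath a b" "(integrand n) contour_integrable_on linepath b c"
    "(integrand n) contour_integrable_on ?rarc" "(integrand n) contour_integrable_on linepath d a"
    "(integrand n) contour_integrable_on arc"
    using ab B(2) arcS da va by (auto intro!: int)
  have "contour_integral ?g (integrand n) = contour_integral (linepath a b) (integrand n) + (contour_integral (linepath b c) (integrand n) +
     (contour_integral ?rarc (integrand n) + contour_integral (linepath d a) (integrand n)))"
    using i ends va by (simp add: contour_integral_join valid_path_join)
  also have "contour_integral ?rarc (integrand n) = - contour_integral arc (integrand n)"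
    by (rule contour_integral_reversepath[OF va])
  also have "contour_integral (linepath d a) (integrand n) = - contour_integral (linepath a d) (integrand n)"
    using contour_integral_reversepath[of "linepath a d" "integrand n"] by simp
  finally have "contour_integral (linepath a b) (integrand n) - contour_integral arc (integrand n) =
     contour_integral (linepath a d) (integrand n) - contour_integral (linepath b c) (integrand n)"
    using \<open>0 = contour_integral ?g (integrand n)\<close> by (simp add: algebra_simps)
  then have "norm (contour_integral (linepath a b) (integrand n) - contour_integral arc (integrand n)) \<le>
     sqrt (2 * t0) / (2 * sqrt pi) * exp (5 / 8 * x) * t0 + sqrt (2 * t0) / (2 * sqrt pi) * exp (5 / 8 * x) * t0"
    using B(1) D(1) by (simp only:) (intro norm_triangle_le_diff add_mono)
  also have "\<dots> = sqrt (2 * t0) / sqrt pi * exp (5 / 8 * x) * t0" by simp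
  also have "contour_integral (linepath a b) (integrand n) = \<i> * integral {-(sqrt 3 * t0)..sqrt 3 * t0} (\<lambda>\<theta>. (integrand n) (Complex t0 \<theta>))"
  proof -
    have "a = Complex t0 (- (sqrt 3 * t0))" "b = Complex t0 (sqrt 3 * t0)"
      unfolding a_def b_def Complex_cis_third by simp_all
    then have "((\<lambda>\<theta>. (integrand n) (Complex t0 \<theta>)) has_integral (- \<i> * contour_integral (linepath a b) (integrand n))) {-(sqrt 3 * t0)..sqrt 3 * t0}"
      using has_contour_integral_integral[OF i(1)] t0_pos
      by (subst has_contour_integral_linepath_same_Re_iff[symmetric, of a t0 b]) auto
    then have "integral {-(sqrt 3 * t0)..sqrt 3 * t0} (\<lambda>\<theta>. (integrand n) (Complex t0 \<theta>)) = - \<i> * contour_integral (linepath a b) (integrand n)"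
      by (rule integral_unique)
    then show ?thesis by simp
  qed
  also have "contour_integral arc (integrand n) = \<i> * integral {-(pi/3)..pi/3} (\<lambda>\<phi>. (integrand n) (of_real t0 * cis \<phi>) * of_real t0 * cis \<phi>)"
  proof -
    have "contour_integral arc (integrand n) = integral {-(pi/3)..pi/3} (\<lambda>\<phi>. \<i> * ((integrand n) (of_real t0 * cis \<phi>) * of_real t0 * cis \<phi>))"
      unfolding arc_def by (subst contour_integral_part_circlepath_eq) (simp_all add: mult_ac)
    then show ?thesis by (simp only: integral_mult_right)
  qed
  finally show ?thesis by (simp only: right_diff_distrib[symmetric] norm_mult norm_ii mult_1)
qed

text \<open>On |t| = t0 the terms pi^2 / (4 t) and n t are complex conjugates, so the exponent is
  the real number x cos phi. The square root contributes phi / 2 to the argument and the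
  differential phi, hence the angle 3 phi / 2.\<close>

lemma integrand_arc:
  assumes "\<bar>\<phi>\<bar> < pi"
  shows "Re ((integrand n) (of_real t0 * cis \<phi>) * of_real t0 * cis \<phi>) =
    t0 * sqrt t0 / (2 * sqrt pi) * (cos (3 * \<phi> / 2) * exp (x * cos \<phi>))"
proof -
  have "csqrt (of_real t0 * cis \<phi>) = of_real (sqrt t0) * cis (\<phi> / 2)"
  proof (rule csqrt_unique)
    show "(of_real (sqrt t0) * cis (\<phi> / 2))\<^sup>2 = of_real t0 * cis \<phi>"
      using t0_pos by (simp add: power_mult_distrib Complex.DeMoivre flip: of_real_power)
    have "cos (\<phi> / 2) > 0" using assms by (intro cos_gt_zero_pi) auto
    then show "0 < Re (of_real (sqrt t0) * cis (\<phi> / 2)) \<or> Re (of_real (sqrt t0) * cis (\<phi> / 2)) = 0 \<and> 0 \<le> Im (of_real (sqrt t0) * cis (\<phi> / 2))"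
      using t0_pos by simp
  qed
  moreover have "exp (of_real (pi\<^sup>2) / (4 * (of_real t0 * cis \<phi>))) * exp (of_nat n * (of_real t0 * cis \<phi>)) = of_real (exp (x * cos \<phi>))"
  proof -
    have "of_real (pi\<^sup>2) / (4 * (of_real t0 * cis \<phi>)) = of_real (pi\<^sup>2 / (4 * t0)) * cis (- \<phi>)"
      using t0_pos by (simp add: cis_inverse[symmetric] field_simps del: cis_inverse)
    moreover have "of_nat n * (of_real t0 * cis \<phi>) = of_real (real n * t0) * cis \<phi>" by simp
    ultimately have "of_real (pi\<^sup>2) / (4 * (of_real t0 * cis \<phi>)) + of_nat n * (of_real t0 * cis \<phi>) = of_real (x / 2) * (cis (- \<phi>) + cis \<phi>)"
      unfolding pi_t0 n_t0 by (simp only: distrib_left)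
    also have "\<dots> = of_real (x * cos \<phi>)" by (simp add: complex_eq_iff)
    finally show ?thesis unfolding mult_exp_exp by (simp only: exp_of_real)
  qed
  ultimately have "(integrand n) (of_real t0 * cis \<phi>) * of_real t0 * cis \<phi> =
     of_real (t0 * sqrt t0 / (2 * sqrt pi) * exp (x * cos \<phi>)) * (cis (\<phi> / 2) * cis \<phi>)"
    unfolding integrand_def main_fun_def by (simp add: mult.assoc)
  also have "cis (\<phi> / 2) * cis \<phi> = cis (3 * \<phi> / 2)" by (simp add: cis_mult)
  finally show ?thesis by (simp add: Re_of_real_mult mult_ac)
qed

text \<open>With s = sin (phi / 2) one has cos phi = 1 - 2 s^2 and cos (3 phi / 2) = cos (phi / 2)
  (1 - 4 s^2), so the integral becomes 2 e^x times that of (1 - 4 s^2) e^(-2 x s^2). The integrand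
  is the derivative of s e^(-2 x s^2) / x plus (1 - 1 / x) e^(-2 x s^2): this is the origin of the
  factor 1 - 1 / x. The limits become -1/2 and 1/2.\<close>

lemma arc_integral:
  "integral {-(pi/3)..pi/3} (\<lambda>\<phi>. cos (3 * \<phi> / 2) * exp (x * cos \<phi>)) =
     2 * exp x * (exp (- x / 2) / x + (1 - 1 / x) * integral {-1/2..1/2} (\<lambda>u. exp (- (2 * x * u\<^sup>2))))"
proof -
  define e where "e = (\<lambda>u. exp (- (2 * x * u\<^sup>2)))"
  \<comment> \<open>Starting at -1 makes all values of s that occur interior points, where
    \<open>J\<close> is differentiable.\<close>
  define J where "J = (\<lambda>s. integral {-1..s} e)"
  have conte: "continuous_on A e" for A unfolding e_def by (intro continuous_intros)
  have J': "(J has_real_derivative e s) (at s)" if "-1 < s" "s < 1" for s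
    using integral_has_real_derivative[OF conte, of s "-1" 1] that unfolding J_def
    by (simp add: at_within_Icc_at)
  define \<Psi> where "\<Psi> = (\<lambda>\<phi>. 2 * exp x * (sin (\<phi> / 2) * e (sin (\<phi> / 2)) / x + (1 - 1 / x) * J (sin (\<phi> / 2))))"
  have "((\<lambda>\<phi>. cos (3 * \<phi> / 2) * exp (x * cos \<phi>)) has_integral (\<Psi> (pi/3) - \<Psi> (-(pi/3)))) {-(pi/3)..pi/3}"
  proof (rule fundamental_theorem_of_calculus)
    fix \<phi> assume p: "\<phi> \<in> {-(pi/3)..pi/3}"
    define s where "s = sin (\<phi> / 2)"
    have "- (pi/3) \<le> \<phi>" "\<phi> \<le> pi/3" using p by auto
    then have "cos (\<phi> / 2) > 0" by (intro cos_gt_zero_pi) (use pi_gt_zero in linarith)+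
    then have "s\<^sup>2 < 1" unfolding s_def sin_squared_eq by simp
    then have s: "-1 < s" "s < 1" by (auto simp: power2_less_1_iff abs_less_iff)
    have cosp: "cos \<phi> = 1 - 2 * s\<^sup>2" using cos_double_sin[of "\<phi> / 2"] by (simp add: s_def)
    have cos3: "cos (3 * \<phi> / 2) = cos (\<phi> / 2) * (1 - 4 * s\<^sup>2)"
    proof -
      have "cos (3 * \<phi> / 2) = cos (\<phi> / 2 + \<phi>)" by (simp add: field_simps)
      also have "\<dots> = cos (\<phi> / 2) * cos \<phi> - sin (\<phi> / 2) * (2 * sin (\<phi> / 2) * cos (\<phi> / 2))"
        using sin_double[of "\<phi> / 2"] cos_add[of "\<phi> / 2" \<phi>] by simp
      also have "\<dots> = cos (\<phi> / 2) * (1 - 4 * s\<^sup>2)" unfolding cosp by (simp add: s_def power2_eq_square algebra_simps)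
      finally show ?thesis .
    qed
    have Ds: "((\<lambda>\<phi>. sin (\<phi> / 2)) has_real_derivative cos (\<phi> / 2) / 2) (at \<phi>)"
      by (auto intro!: derivative_eq_intros)
    have "(e has_real_derivative e s * (- (4 * x * s))) (at s)"
      unfolding e_def by (auto intro!: derivative_eq_intros)
    then have De: "((\<lambda>\<phi>. e (sin (\<phi> / 2))) has_real_derivative e s * (- (4 * x * s)) * (cos (\<phi> / 2) / 2)) (at \<phi>)"
      unfolding s_def by (rule DERIV_chain2) (rule Ds)
    have DJ: "((\<lambda>\<phi>. J (sin (\<phi> / 2))) has_real_derivative e s * (cos (\<phi> / 2) / 2)) (at \<phi>)"
      using J'[OF s] unfolding s_def by (rule DERIV_chain2) (rule Ds)
    have "(\<Psi> has_real_derivative 2 * exp x * ((s * (e s * (- (4 * x * s)) * (cos (\<phi> / 2) / 2)) + (cos (\<phi> / 2) / 2) * e s) / x + (1 - 1 / x) * (e s * (cos (\<phi> / 2) / 2)))) (at \<phi>)"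
      unfolding \<Psi>_def s_def
      by (intro DERIV_cmult DERIV_add DERIV_cdivide DERIV_mult' Ds De[unfolded s_def] DJ[unfolded s_def])
    also have "2 * exp x * ((s * (e s * (- (4 * x * s)) * (cos (\<phi> / 2) / 2)) + (cos (\<phi> / 2) / 2) * e s) / x + (1 - 1 / x) * (e s * (cos (\<phi> / 2) / 2))) =
      cos (\<phi> / 2) * (1 - 4 * s\<^sup>2) * (exp x * e s)"
      using x_pos by (simp add: field_simps power2_eq_square)
    also have "exp x * e s = exp (x * cos \<phi>)" unfolding e_def mult_exp_exp cosp by (simp add: algebra_simps)
    finally show "(\<Psi> has_vector_derivative cos (3 * \<phi> / 2) * exp (x * cos \<phi>)) (at \<phi> within {-(pi/3)..pi/3})"
      unfolding cos3 has_real_derivative_iff_has_vector_derivative[symmetric]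
      by (rule has_field_derivative_at_within)
  qed auto
  then have "integral {-(pi/3)..pi/3} (\<lambda>\<phi>. cos (3 * \<phi> / 2) * exp (x * cos \<phi>)) = \<Psi> (pi/3) - \<Psi> (-(pi/3))"
    by (rule integral_unique)
  also have "\<dots> = 2 * exp x * (e (1 / 2) / x + (1 - 1 / x) * (J (1/2) - J (-1/2)))"
    by (simp add: \<Psi>_def sin_30 e_def algebra_simps)
  also have "J (1/2) - J (-1/2) = integral {-1/2..1/2} e"
  proof -
    have "integral {-1..-1/2} e + integral {-1/2..1/2} e = integral {-1..1/2} e"
      by (rule Henstock_Kurzweil_Integration.integral_combine) (auto intro!: integrable_continuous_interval conte)
    then show ?thesis by (simp add: J_def)
  qed
  finally show ?thesis by (simp add: e_def power2_eq_square)
qed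

end

section \<open>Gaussian integrals, complete and truncated\<close>

lemma gaussian_has_integral:
  assumes a: "a > 0"
  shows "((\<lambda>u. exp (- (a * u\<^sup>2))) has_integral sqrt (pi / a)) UNIV"
proof -
  define \<sigma> where "\<sigma> = sqrt (1 / (2 * a))"
  have s: "\<sigma> > 0" "\<sigma>\<^sup>2 = 1 / (2 * a)" using a by (auto simp: \<sigma>_def)
  have "(normal_density 0 \<sigma> has_integral (\<integral>u. normal_density 0 \<sigma> u \<partial>lborel)) UNIV"
    by (rule has_integral_integral_lborel) (use s in auto)
  then have "(normal_density 0 \<sigma> has_integral 1) UNIV" using s by simp
  then have "((\<lambda>u. sqrt (pi / a) * normal_density 0 \<sigma> u) has_integral sqrt (pi / a) * 1) UNIV"
    by (rule has_integral_mult_right)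
  moreover have "sqrt (pi / a) * normal_density 0 \<sigma> u = exp (- (a * u\<^sup>2))" for u
  proof -
    have "2 * pi * \<sigma>\<^sup>2 = pi / a" "- (u - 0)\<^sup>2 / (2 * \<sigma>\<^sup>2) = - (a * u\<^sup>2)" using a s(2) by simp_all
    moreover have "sqrt (pi / a) > 0" using a by simp
    ultimately show ?thesis using a unfolding normal_density_def by (simp only:) simp
  qed
  ultimately show ?thesis by simp
qed

text \<open>For |u| >= 1/2, splitting 2 x u^2 = 3/2 x u^2 + x u^2 / 2 bounds the tail by e^(-3 x /
  8) times a wider complete Gaussian.\<close>

lemma gaussian_truncated:
  fixes x :: real
  assumes x: "x > 0"
  defines "I \<equiv> integral {-1/2..1/2} (\<lambda>u. exp (- (2 * x * u\<^sup>2)))"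
  shows "I \<le> sqrt (pi / (2 * x))" and "sqrt (pi / (2 * x)) \<le> I + exp (- (3 / 8 * x)) * sqrt (2 * pi / x)"
proof -
  let ?e = "\<lambda>u. exp (- (2 * x * u\<^sup>2))"
  have full: "(?e has_integral sqrt (pi / (2 * x))) UNIV" using gaussian_has_integral[of "2 * x"] x by simp
  have "(?e has_integral I) {-1/2..1/2}" unfolding I_def
    by (intro integrable_integral integrable_continuous_interval continuous_intros)
  then have inner: "((\<lambda>u. if u \<in> {-1/2..1/2} then ?e u else 0) has_integral I) UNIV"
    by (simp only: has_integral_restrict_UNIV)
  show "I \<le> sqrt (pi / (2 * x))" by (rule has_integral_le[OF inner full]) auto
  have "((\<lambda>u. exp (- (3 / 8 * x)) * exp (- (x / 2 * u\<^sup>2))) has_integral exp (- (3 / 8 * x)) * sqrt (pi / (x / 2))) UNIV"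
    by (intro has_integral_mult_right gaussian_has_integral) (use x in auto)
  from has_integral_add[OF inner this]
  have tot: "((\<lambda>u. (if u \<in> {-1/2..1/2} then ?e u else 0) + exp (- (3 / 8 * x)) * exp (- (x / 2 * u\<^sup>2))) has_integral
     (I + exp (- (3 / 8 * x)) * sqrt (2 * pi / x))) UNIV" by (simp add: mult.commute)
  show "sqrt (pi / (2 * x)) \<le> I + exp (- (3 / 8 * x)) * sqrt (2 * pi / x)"
  proof (rule has_integral_le[OF full tot])
    fix u :: real
    show "?e u \<le> (if u \<in> {-1/2..1/2} then ?e u else 0) + exp (- (3 / 8 * x)) * exp (- (x / 2 * u\<^sup>2))"
    proof (cases "u \<in> {-1/2..1/2}")
      case False
      then have "1 / 2 \<le> \<bar>u\<bar>" by (auto simp: abs_if)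
      then have "(1 / 2)\<^sup>2 \<le> \<bar>u\<bar>\<^sup>2" by (intro power_mono) auto
      then have "1 / 4 \<le> u\<^sup>2" by (simp add: power2_eq_square)
      then have "x * (1 / 4) \<le> x * u\<^sup>2" using x by (intro mult_left_mono) auto
      then have "?e u \<le> exp (- (3 / 8 * x) + - (x / 2 * u\<^sup>2))" by simp
      with False show ?thesis unfolding exp_add by simp
    qed auto
  qed
qed

text \<open>With r = |q|, v = 1 - cos theta and D = |1 - q|^2, the quantity 1 / (1 - r) - Re (1 / (1
  - q)) equals r v (1 + r) / ((1 - r) D). At the cut, v is about 3/2 t0^2 and D about 4 t0^2, which
  makes it about 3 / (4 t0) for small t0; 7 / 10 leaves room for t0 up to 53 / 1000.\<close>

lemma far_exponent:
  assumes t0: "0 < t0" "t0 \<le> 53 / 1000" and \<theta>: "sqrt 3 * t0 \<le> \<bar>\<theta>\<bar>" "\<bar>\<theta>\<bar> \<le> pi"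
  defines "q \<equiv> exp (- Complex t0 \<theta>)"
  shows "2 * (Re (1 / (1 - q)) - 1 / (1 - norm q)) \<le> - (7 / 5 / t0)"
proof -
  define r where "r = exp (- t0)"
  have nq: "norm q = r" by (simp add: q_def r_def)
  have r: "r < 1" "1 - t0 \<le> r" using t0 exp_ge_add_one_self[of "- t0"] by (auto simp: r_def)
  then have r2: "947 / 1000 \<le> r" using t0 by linarith
  define a where "a = Re q"
  have a: "a = r * cos \<theta>" by (simp add: a_def q_def r_def Re_exp)
  define v where "v = 1 - cos \<theta>"
  have v: "r - a = r * v" by (simp add: a v_def algebra_simps)
  have "cos \<bar>\<theta>\<bar> \<le> cos (sqrt 3 * t0)"
    using \<theta> t0 by (intro cos_monotone_0_pi_le) auto
  also have "\<dots> \<le> exp (- (sqrt 3 * t0)\<^sup>2 / 2)"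
  proof (rule cos_le_exp)
    have "sqrt 3 \<le> 2" by (rule real_le_lsqrt) auto
    then have "sqrt 3 * t0 \<le> 2 * (53 / 1000)" using t0 by (intro mult_mono) auto
    then show "sqrt 3 * t0 \<le> pi / 2" using pi_gt3 by linarith
  qed (use t0 in auto)
  also have "\<dots> = exp (- (3 / 2 * t0\<^sup>2))" by (simp add: power_mult_distrib)
  also have "\<dots> \<le> 1 / (1 + 3 / 2 * t0\<^sup>2)"
    using exp_ge_add_one_self[of "3 / 2 * t0\<^sup>2"] t0 by (simp add: exp_minus field_simps add_pos_nonneg)
  finally have "cos \<theta> \<le> 1 / (1 + 3 / 2 * t0\<^sup>2)" by simp
  then have "3 / 2 * t0\<^sup>2 \<le> v * (1 + 3 / 2 * t0\<^sup>2)"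
    unfolding v_def using t0 by (simp add: field_simps add_pos_nonneg)
  also have "\<dots> \<le> v * (101 / 100)"
  proof (rule mult_left_mono)
    have "t0\<^sup>2 \<le> (53 / 1000)\<^sup>2" using t0 by (intro power_mono) auto
    then show "1 + 3 / 2 * t0\<^sup>2 \<le> 101 / 100" by (simp add: power2_eq_square)
  qed (simp add: v_def)
  finally have "3 / 2 * t0\<^sup>2 \<le> v * (101 / 100)" .
  moreover have "v \<ge> 0" by (simp add: v_def)
  ultimately have vt: "t0\<^sup>2 \<le> v * (29 / 40)" by linarith
  have vpos: "v > 0" using vt t0 by (smt (verit) zero_less_power mult_nonpos_nonneg divide_nonneg_nonneg)
  define D where "D = (1 - r)\<^sup>2 + 2 * r * v"
  have D: "D = 1 - 2 * a + r\<^sup>2" using v by (simp add: D_def power2_eq_square algebra_simps)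
  have Dpos: "D > 0" unfolding D_def using r r2 vpos by (intro add_nonneg_pos) auto
  have "Re (1 / (1 - q)) = (1 - a) / D"
  proof -
    have "(Re q)\<^sup>2 + (Im q)\<^sup>2 = r\<^sup>2" using nq by (metis cmod_power2)
    then have "(1 - Re q)\<^sup>2 + (Im q)\<^sup>2 = D" unfolding D a_def by (simp add: power2_eq_square algebra_simps)
    then show ?thesis by (simp add: Re_divide a_def)
  qed
  then have "1 / (1 - r) - Re (1 / (1 - q)) = 1 / (1 - r) - (1 - a) / D" by simp
  also have "\<dots> = (D - (1 - a) * (1 - r)) / ((1 - r) * D)" using r Dpos by (simp add: field_simps)
  also have "D - (1 - a) * (1 - r) = (r - a) * (1 + r)" unfolding D by (simp add: power2_eq_square algebra_simps)
  also have "\<dots> = r * v * (1 + r)" unfolding v ..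
  also have "7 / 10 / t0 \<le> r * v * (1 + r) / ((1 - r) * D)"
  proof -
    have "(1 - r)\<^sup>2 \<le> t0\<^sup>2" using r by (intro power_mono) auto
    then have "(1 - r)\<^sup>2 \<le> v * (29 / 40)" using vt by linarith
    \<comment> \<open>This is 7/10 D <= r v (1 + r) after the part 2 r v of D has been moved to the
      right, where r (1 + r) - 7/5 r = r (r - 2/5).\<close>
    moreover have "v * (29 / 40) * (7 / 10) \<le> v * (r * (r - 2 / 5))"
    proof -
      have "(947 / 1000) * (547 / 1000) \<le> r * (r - 2 / 5)" using r2 by (intro mult_mono) auto
      then have "29 / 40 * (7 / 10) \<le> r * (r - 2 / 5)" by simp
      then have "v * (29 / 40 * (7 / 10)) \<le> v * (r * (r - 2 / 5))" using vpos by (intro mult_left_mono) auto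
      then show ?thesis by (simp only: mult.assoc)
    qed
    ultimately have "7 / 10 * D \<le> r * v * (1 + r)" unfolding D_def by (simp add: algebra_simps)
    then have "7 / 10 * D * (1 - r) \<le> r * v * (1 + r) * t0"
      by (rule mult_mono) (use r r2 vpos t0 in auto)
    then show ?thesis using r Dpos t0 by (simp add: field_simps)
  qed
  finally show ?thesis unfolding nq by simp
qed

text \<open>The budget in units of exp (18 x / 25): 0.225 for each of the two outer pieces, 0.063
  for replacing the generating function by the main function in the middle, 0.011 for the rays, and
  0.02 for the boundary term and the Gaussian tail on the arc. The bound n >= 900 enters through
  sqrt n >= 30, which gives x >= 90 and t0 <= 53 / 1000.\<close>

lemma ovp_circle_estimate:
  assumes n: "n \<ge> 900"
  defines "x \<equiv> pi * sqrt (real n)"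
  shows "\<bar>2 * pi * num_overpartitions n - pi / (4 * real n) * exp x * (1 - 1 / x)\<bar> \<le> 55 / 100 * exp (18 / 25 * x)"
proof -
  define t0 where "t0 = pi\<^sup>2 / (2 * x)"
  have n1: "n \<ge> 1" using n by simp
  have xe: "x = pi * sqrt (real n)" by (simp add: x_def)
  have xp: "x > 0" using n by (simp add: x_def)
  have tp: "t0 > 0" using xp by (simp add: t0_def)
  have nt: "real n * t0 = x / 2" by (rule n_t0[OF n1 xe t0_def])
  have pt: "pi\<^sup>2 / (4 * t0) = x / 2" by (rule pi_t0[OF n1 xe t0_def])
  have y30: "30 \<le> sqrt (real n)" using n by (intro real_le_rsqrt) auto
  have x90: "90 \<le> x" using mult_mono[of 3 pi 30 "sqrt (real n)"] y30 pi_gt3 by (simp add: x_def)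
  have pi4: "pi < 315 / 100" using pi_approx by simp
  have tb: "t0 \<le> 53 / 1000"
  proof -
    have "t0 = pi / (2 * sqrt (real n))" using n by (simp add: t0_def x_def power2_eq_square)
    also have "\<dots> \<le> (315 / 100) / (2 * 30)" using y30 pi4 by (intro frac_le) auto
    finally show ?thesis by simp
  qed
  have st: "sqrt t0 \<le> 1 / 4" using tb by (intro real_le_lsqrt) (auto simp: power2_eq_square)
  have s2t: "sqrt (2 * t0) \<le> 1 / 3" using tb by (intro real_le_lsqrt) (auto simp: power2_eq_square)
  have spi: "17 / 10 \<le> sqrt pi" "sqrt pi \<le> 18 / 10"
  proof -
    show "17 / 10 \<le> sqrt pi" by (rule real_le_rsqrt) (use pi_gt3 in \<open>simp add: power2_eq_square\<close>)
    show "sqrt pi \<le> 18 / 10" by (rule real_le_lsqrt) (use pi4 in \<open>simp_all add: power2_eq_square\<close>)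
  qed
  have s3: "sqrt 3 \<le> 174 / 100" by (rule real_le_lsqrt) (auto simp: power2_eq_square)
  define \<theta>1 where "\<theta>1 = sqrt 3 * t0"
  have th: "0 < \<theta>1" "\<theta>1 < pi" "\<theta>1 \<le> 93 / 1000"
  proof -
    show "0 < \<theta>1" using tp by (simp add: \<theta>1_def)
    have "\<theta>1 \<le> 174 / 100 * (53 / 1000)" unfolding \<theta>1_def using s3 tb tp by (intro mult_mono) auto
    then show "\<theta>1 < pi" "\<theta>1 \<le> 93 / 1000" using pi_gt3 by auto
  qed
  define F where "F = (\<lambda>\<theta>. ovp_gf (exp (- Complex t0 \<theta>)) * exp (of_nat n * Complex t0 \<theta>))"
  define N where "N = (\<lambda>\<theta>. integrand n (Complex t0 \<theta>))"
  define E where "E = exp (18 / 25 * x)"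
  have E: "exp (x / 2) \<le> E" "exp (5 / 8 * x) \<le> E" "E > 0" using xp by (auto simp: E_def)
  have "(F has_integral of_real (2 * pi * num_overpartitions n)) {-pi..pi}"
    unfolding F_def by (rule ovp_contour_integral[OF tp])
  then have Fint: "F integrable_on {-pi..pi}" "integral {-pi..pi} F = of_real (2 * pi * num_overpartitions n)"
    by (auto simp: integral_unique has_integral_integrable)
  have Fsub: "F integrable_on {a..b}" if "-pi \<le> a" "b \<le> pi" for a b
    by (rule integrable_on_subinterval[OF Fint(1)]) (use that in auto)
  have far: "norm (integral {a..b} F) \<le> 45 / 200 * E"
    if ab: "-pi \<le> a" "b \<le> pi" "a \<le> b" "b - a \<le> pi" "\<And>\<theta>. a \<le> \<theta> \<Longrightarrow> \<theta> \<le> b \<Longrightarrow> \<theta>1 \<le> \<bar>\<theta>\<bar>" for a b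
  proof -
    have bd: "norm (F \<theta>) \<le> sqrt t0 / (2 * sqrt pi) * E" if "\<theta> \<in> {a..b}" for \<theta>
    proof -
      have th: "sqrt 3 * t0 \<le> \<bar>\<theta>\<bar>" "\<bar>\<theta>\<bar> \<le> pi" using ab that by (auto simp: \<theta>1_def abs_le_iff)
      define q where "q = exp (- Complex t0 \<theta>)"
      have q: "norm q = exp (- t0)" by (simp add: q_def)
      have "norm (ovp_gf q) \<le> norm (ovp_gf (of_real (norm q))) * exp (2 * (Re (1 / (1 - q)) - 1 / (1 - norm q)))"
        by (rule ovp_gf_far) (use q tp in simp)
      also have "\<dots> \<le> (sqrt t0 / (2 * sqrt pi) * exp (pi\<^sup>2 / (4 * t0))) * exp (- (7 / 5 / t0))"
        unfolding q_def
        by (intro mult_mono) (use norm_ovp_gf_real[OF tp] far_exponent[OF tp tb th] q tp in \<open>auto simp: q_def\<close>)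
      finally have "norm (F \<theta>) \<le> (sqrt t0 / (2 * sqrt pi) * exp (x / 2)) * exp (- (7 / 5 / t0)) * exp (x / 2)"
        unfolding F_def norm_mult q_def[symmetric] pt by (intro mult_mono) (use tp in \<open>auto simp: nt\<close>)
      also have "\<dots> = sqrt t0 / (2 * sqrt pi) * exp (x - 7 / 5 / t0)"
        by (simp add: mult.assoc mult_exp_exp)
      also have "\<dots> \<le> sqrt t0 / (2 * sqrt pi) * E"
      proof (intro mult_left_mono)
        \<comment> \<open>Origin of 18 / 25: as 1 / t0 = 2 x / pi^2 >= x / 5, the saving 7 / (5 t0)
          is at least 7 x / 25.\<close>
        have "pi\<^sup>2 \<le> 10" using power_mono[of pi "315/100" 2] pi4 pi_gt_zero by (simp add: power2_eq_square)
        then have "pi\<^sup>2 / (2 * t0) * (7 / 25) \<le> 10 / (2 * t0) * (7 / 25)"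
          using tp by (intro mult_right_mono divide_right_mono) auto
        moreover have "pi\<^sup>2 / (2 * t0) = x" using pt tp by (simp add: field_simps)
        ultimately have "x * (7 / 25) \<le> 7 / 5 / t0" by simp
        then show "exp (x - 7 / 5 / t0) \<le> E" by (simp add: E_def)
      qed (use tp in auto)
      finally show ?thesis .
    qed
    have "norm (integral {a..b} F) \<le> integral {a..b} (\<lambda>_. sqrt t0 / (2 * sqrt pi) * E)"
      by (rule integral_norm_bound_integral) (use Fsub ab bd in auto)
    also have "\<dots> = (b - a) * (sqrt t0 / (2 * sqrt pi) * E)" using ab by simp
    also have "\<dots> \<le> pi * ((1 / 4) / (2 * sqrt pi) * E)"
      using ab st tp E by (intro mult_mono divide_right_mono) auto
    also have "\<dots> = sqrt pi / 8 * E" by (simp add: field_simps)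
    also have "\<dots> \<le> 45 / 200 * E" using spi E by (intro mult_right_mono) auto
    finally show ?thesis .
  qed
  have Ncont: "continuous_on {-\<theta>1..\<theta>1} N"
    unfolding N_def
    by (rule continuous_on_compose2[OF holomorphic_on_imp_continuous_on[OF holomorphic_integrand[OF n1 xe t0_def]]])
       (use tp in \<open>auto intro!: continuous_intros simp: Complex_eq\<close>)
  have near: "norm (integral {-\<theta>1..\<theta>1} F - integral {-\<theta>1..\<theta>1} N) \<le> 63 / 1000 * E"
  proof -
    have bd: "norm (F \<theta> - N \<theta>) \<le> sqrt (2 * t0) * exp (x / 2)" if "\<theta> \<in> {-\<theta>1..\<theta>1}" for \<theta>
    proof -
      define t where "t = Complex t0 \<theta>"
      \<comment> \<open>Up to the cut |t| <= 2 t0, hence Re (1 / t) >= 1 / (4 t0), and the dual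
        variable has modulus at most e^(-x).\<close>
      have "\<bar>\<theta>\<bar> \<le> sqrt 3 * t0" using that by (auto simp: \<theta>1_def)
      then have "\<theta>\<^sup>2 \<le> (sqrt 3 * t0)\<^sup>2" using power_mono[of "\<bar>\<theta>\<bar>" "sqrt 3 * t0" 2] by simp
      then have th2: "t0\<^sup>2 + \<theta>\<^sup>2 \<le> (2 * t0)\<^sup>2" by (simp add: power_mult_distrib)
      have nt2: "norm t \<le> 2 * t0" unfolding t_def using th2 tp by (simp add: cmod_def real_sqrt_le_iff real_le_lsqrt)
      have "Re (1 / t) = t0 / (t0\<^sup>2 + \<theta>\<^sup>2)" by (simp add: t_def Re_divide)
      also have "\<dots> \<ge> t0 / (2 * t0)\<^sup>2" using th2 tp by (intro divide_left_mono mult_pos_pos) (auto intro: add_pos_nonneg)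
      also have "t0 / (2 * t0)\<^sup>2 = 1 / (4 * t0)" using tp by (simp add: power2_eq_square)
      finally have "2 * pi\<^sup>2 * (1 / (4 * t0)) \<le> 2 * pi\<^sup>2 * Re (1 / t)" by (intro mult_left_mono) auto
      moreover have "2 * pi\<^sup>2 * (1 / (4 * t0)) = x" using pt by (simp add: field_simps)
      ultimately have "exp (- (2 * pi\<^sup>2) * Re (1 / t)) \<le> exp (- x)" by simp
      also have "\<dots> \<le> 1 / 4"
      proof -
        have "4 \<le> exp x" using exp_ge_add_one_self[of x] x90 by linarith
        then show ?thesis by (simp add: exp_minus field_simps)
      qed
      finally have "norm (ovp_gf (exp (- t)) - main_fun t) \<le> sqrt (norm t)"
        by (intro ovp_gf_near) (use tp in \<open>simp_all add: t_def\<close>)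
      also have "\<dots> \<le> sqrt (2 * t0)" using nt2 by simp
      finally have "norm (ovp_gf (exp (- t)) - main_fun t) * norm (exp (of_nat n * t)) \<le> sqrt (2 * t0) * exp (x / 2)"
        by (intro mult_mono) (auto simp: t_def nt tp less_imp_le)
      moreover have "F \<theta> - N \<theta> = (ovp_gf (exp (- t)) - main_fun t) * exp (of_nat n * t)"
        by (simp add: F_def N_def integrand_def t_def left_diff_distrib)
      ultimately show ?thesis by (simp only: norm_mult)
    qed
    have Fi: "F integrable_on {-\<theta>1..\<theta>1}" by (rule Fsub) (use th in auto)
    have Ni: "N integrable_on {-\<theta>1..\<theta>1}" by (intro integrable_continuous_interval Ncont)
    have "integral {-\<theta>1..\<theta>1} F - integral {-\<theta>1..\<theta>1} N = integral {-\<theta>1..\<theta>1} (\<lambda>\<theta>. F \<theta> - N \<theta>)"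
      by (rule integral_diff[OF Fi Ni, symmetric])
    also have "norm \<dots> \<le> integral {-\<theta>1..\<theta>1} (\<lambda>_. sqrt (2 * t0) * exp (x / 2))"
      by (rule integral_norm_bound_integral) (use Fi Ni bd in \<open>auto intro: integrable_diff\<close>)
    also have "\<dots> = (2 * \<theta>1) * (sqrt (2 * t0) * exp (x / 2))" using th by simp
    also have "\<dots> \<le> (2 * (93 / 1000)) * (1 / 3 * E)"
      using th s2t E tp by (intro mult_mono) auto
    also have "\<dots> \<le> 63 / 1000 * E" using E by simp
    finally show ?thesis .
  qed
  define A where "A = integral {-(pi/3)..pi/3} (\<lambda>\<phi>. integrand n (of_real t0 * cis \<phi>) * of_real t0 * cis \<phi>)"
  have deform: "norm (integral {-\<theta>1..\<theta>1} N - A) \<le> 11 / 1000 * E"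
  proof -
    have "norm (integral {-\<theta>1..\<theta>1} N - A) \<le> sqrt (2 * t0) / sqrt pi * exp (5 / 8 * x) * t0"
      unfolding N_def A_def \<theta>1_def by (rule main_integral_deform[OF n1 xe t0_def])
    also have "\<dots> \<le> (1 / 3) / (17 / 10) * E * (53 / 1000)"
      using s2t spi E tb tp by (intro mult_mono frac_le) auto
    also have "\<dots> \<le> 11 / 1000 * E" using E by simp
    finally show ?thesis .
  qed
  define I where "I = integral {-1/2..1/2} (\<lambda>u. exp (- (2 * x * u\<^sup>2)))"
  define C where "C = t0 * sqrt t0 / sqrt pi"
  have C: "0 \<le> C" "C \<le> 1 / 100"
  proof -
    show "0 \<le> C" using tp by (simp add: C_def)
    have "C \<le> (53 / 1000 * (1 / 4)) / (17 / 10)"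
      unfolding C_def using st spi tb tp by (intro frac_le mult_mono) auto
    then show "C \<le> 1 / 100" by simp
  qed
  have ReA: "Re A = C * exp x * (exp (- x / 2) / x + (1 - 1 / x) * I)"
  proof -
    let ?f = "\<lambda>\<phi>. integrand n (of_real t0 * cis \<phi>) * of_real t0 * cis \<phi>"
    have cosp: "cos \<phi> > 0" "\<bar>\<phi>\<bar> < pi" if "\<phi> \<in> {-(pi/3)..pi/3}" for \<phi>
    proof -
      have "- (pi/3) \<le> \<phi>" "\<phi> \<le> pi/3" using that by auto
      then show "cos \<phi> > 0" by (intro cos_gt_zero_pi) (use pi_gt_zero in linarith)+
      show "\<bar>\<phi>\<bar> < pi" using \<open>- (pi/3) \<le> \<phi>\<close> \<open>\<phi> \<le> pi/3\<close> pi_gt_zero by linarith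
    qed
    have c1: "continuous_on {-(pi/3)..pi/3} (\<lambda>\<phi>. of_real t0 * cis \<phi>)" by (intro continuous_intros)
    have "continuous_on {-(pi/3)..pi/3} (\<lambda>\<phi>. integrand n (of_real t0 * cis \<phi>))"
      by (rule continuous_on_compose2[OF holomorphic_on_imp_continuous_on[OF holomorphic_integrand[OF n1 xe t0_def]] c1])
         (use tp cosp in auto)
    then have "?f integrable_on {-(pi/3)..pi/3}"
      by (intro integrable_continuous_interval continuous_intros)
    from integral_linear[OF this bounded_linear_Re]
    have "Re A = integral {-(pi/3)..pi/3} (\<lambda>\<phi>. Re (?f \<phi>))" unfolding A_def by (simp add: o_def)
    also have "\<dots> = integral {-(pi/3)..pi/3} (\<lambda>\<phi>. t0 * sqrt t0 / (2 * sqrt pi) * (cos (3 * \<phi> / 2) * exp (x * cos \<phi>)))"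
      by (intro Henstock_Kurzweil_Integration.integral_cong integrand_arc[OF n1 xe t0_def] cosp)
    also have "\<dots> = t0 * sqrt t0 / (2 * sqrt pi) * integral {-(pi/3)..pi/3} (\<lambda>\<phi>. cos (3 * \<phi> / 2) * exp (x * cos \<phi>))"
      by (rule integral_mult_right)
    also have "\<dots> = t0 * sqrt t0 / (2 * sqrt pi) * (2 * exp x * (exp (- x / 2) / x + (1 - 1 / x) * I))"
      unfolding I_def by (subst arc_integral[OF n1 xe t0_def]) (rule refl)
    also have "\<dots> = C * exp x * (exp (- x / 2) / x + (1 - 1 / x) * I)" by (simp add: C_def)
    finally show ?thesis .
  qed
  define g where "g = sqrt (pi / (2 * x))"
  have g: "I \<le> g" "g \<le> I + exp (- (3 / 8 * x)) * sqrt (2 * pi / x)"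
    using gaussian_truncated[OF xp] by (simp_all add: g_def I_def)
  \<comment> \<open>The prefactor of the arc times the complete Gaussian integral is exactly pi / (4
    n).\<close>
  have main: "pi / (4 * real n) * exp x * (1 - 1 / x) = C * exp x * ((1 - 1 / x) * g)"
  proof -
    have "sqrt t0 / sqrt pi * g = sqrt (t0 / pi * (pi / (2 * x)))" by (simp only: g_def real_sqrt_mult real_sqrt_divide)
    also have "t0 / pi * (pi / (2 * x)) = (t0 / pi)\<^sup>2" using xp by (simp add: t0_def power2_eq_square)
    also have "sqrt \<dots> = t0 / pi" using tp by simp
    finally have h: "sqrt t0 / sqrt pi * g = t0 / pi" .
    have "C * g = t0 * (sqrt t0 / sqrt pi * g)" by (simp add: C_def)
    also note h
    finally have "C * g = t0 * (t0 / pi)" .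
    also have "t0 * (t0 / pi) = pi / (4 * real n)" using n by (simp add: t0_def x_def power2_eq_square)
    finally have "C * g = pi / (4 * real n)" .
    then have "C * exp x * ((1 - 1 / x) * g) = pi / (4 * real n) * exp x * (1 - 1 / x)"
      by (metis mult.assoc mult.commute)
    then show ?thesis by simp
  qed
  have arc: "\<bar>Re A - pi / (4 * real n) * exp x * (1 - 1 / x)\<bar> \<le> 2 / 100 * E"
  proof -
    have "Re A - pi / (4 * real n) * exp x * (1 - 1 / x) = C * (exp x * (exp (- x / 2) / x) - exp x * ((1 - 1 / x) * (g - I)))"
      unfolding ReA main by (simp add: algebra_simps diff_divide_distrib)
    also have "\<bar>\<dots>\<bar> \<le> C * (E + E)"
    proof -
      have "exp x * (exp (- x / 2) / x) = exp (x / 2) / x" by (simp add: mult_exp_exp)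
      also have "\<dots> \<le> E / 1" using E x90 by (intro frac_le) auto
      finally have 1: "exp x * (exp (- x / 2) / x) \<le> E" by simp
      have "sqrt (2 * pi / x) \<le> 1" using x90 pi4 by (simp add: divide_le_eq)
      then have "exp (- (3 / 8 * x)) * sqrt (2 * pi / x) \<le> exp (- (3 / 8 * x)) * 1" by (intro mult_left_mono) auto
      then have "g - I \<le> exp (- (3 / 8 * x))" using g by linarith
      then have "exp x * ((1 - 1 / x) * (g - I)) \<le> exp x * (1 * exp (- (3 / 8 * x)))"
        using g x90 by (intro mult_left_mono mult_mono) auto
      also have "\<dots> = exp (5 / 8 * x)" by (simp add: mult_exp_exp)
      also have "\<dots> \<le> E" by (rule E)
      finally have 2: "exp x * ((1 - 1 / x) * (g - I)) \<le> E" .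
      have 3: "0 \<le> exp x * (exp (- x / 2) / x)" "0 \<le> exp x * ((1 - 1 / x) * (g - I))"
        using xp g x90 by (auto intro!: mult_nonneg_nonneg)
      have "\<bar>exp x * (exp (- x / 2) / x) - exp x * ((1 - 1 / x) * (g - I))\<bar> \<le> E + E"
      proof -
        have "\<bar>u - v\<bar> \<le> E + E" if "0 \<le> u" "u \<le> E" "0 \<le> v" "v \<le> E" for u v :: real using that by linarith
        from this[OF 3(1) 1 3(2) 2] show ?thesis .
      qed
      then show ?thesis unfolding abs_mult using C by (simp add: mult_left_mono)
    qed
    also have "\<dots> \<le> 1 / 100 * (E + E)" using C E by (intro mult_right_mono) auto
    finally show ?thesis by simp
  qed
  have split: "complex_of_real (2 * pi * num_overpartitions n) =
     integral {-pi..-\<theta>1} F + integral {-\<theta>1..\<theta>1} F + integral {\<theta>1..pi} F"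
  proof -
    have "integral {-pi..-\<theta>1} F + integral {-\<theta>1..\<theta>1} F = integral {-pi..\<theta>1} F"
      by (rule Henstock_Kurzweil_Integration.integral_combine) (use th Fsub[of "-pi" "\<theta>1"] in auto)
    moreover have "integral {-pi..\<theta>1} F + integral {\<theta>1..pi} F = integral {-pi..pi} F"
      by (rule Henstock_Kurzweil_Integration.integral_combine) (use th Fint in auto)
    ultimately show ?thesis using Fint(2) by simp
  qed
  have f1: "norm (integral {-pi..-\<theta>1} F) \<le> 45 / 200 * E" by (rule far) (use th in auto)
  have f2: "norm (integral {\<theta>1..pi} F) \<le> 45 / 200 * E" by (rule far) (use th in auto)
  define z1 where "z1 = integral {-pi..-\<theta>1} F"
  define z2 where "z2 = integral {\<theta>1..pi} F"
  define w where "w = integral {-\<theta>1..\<theta>1} F"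
  define u where "u = integral {-\<theta>1..\<theta>1} N"
  have "complex_of_real (2 * pi * num_overpartitions n) - A = z1 + z2 + (w - u) + (u - A)"
    unfolding split z1_def z2_def w_def u_def by simp
  then have "norm (complex_of_real (2 * pi * num_overpartitions n) - A) \<le> norm z1 + norm z2 + norm (w - u) + norm (u - A)"
    by (metis norm_triangle_ineq add_right_mono order_trans)
  then have "norm (complex_of_real (2 * pi * num_overpartitions n) - A) \<le> 53 / 100 * E"
    using f1 f2 near deform E(3) unfolding z1_def z2_def w_def u_def by linarith
  then have "\<bar>Re (complex_of_real (2 * pi * num_overpartitions n) - A)\<bar> \<le> 53 / 100 * E"
    using abs_Re_le_cmod order_trans by blast
  then have "\<bar>2 * pi * num_overpartitions n - Re A\<bar> \<le> 53 / 100 * E"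
    by (simp only: minus_complex.sel Re_complex_of_real)
  moreover have "\<bar>u - w\<bar> \<le> 55 / 100 * E" if "\<bar>u - v\<bar> \<le> 53 / 100 * E" "\<bar>v - w\<bar> \<le> 2 / 100 * E" for u v w :: real
    using that by linarith
  ultimately show ?thesis unfolding E_def[symmetric] using arc by blast
qed

section \<open>Third differences of the logarithm\<close>

text \<open>The mean value theorem is applied to the second difference of \<open>f\<close>, then to
  the first difference of \<open>f1\<close>, then to \<open>f2\<close>; the third difference becomes
  a single value of \<open>f3\<close> inside the interval.\<close>

lemma third_difference_ge:
  fixes f :: "real \<Rightarrow> real"
  assumes f1: "\<And>y. a \<le> y \<Longrightarrow> y \<le> a + 3 \<Longrightarrow> (f has_real_derivative f1 y) (at y)"
    and f2: "\<And>y. a \<le> y \<Longrightarrow> y \<le> a + 3 \<Longrightarrow> (f1 has_real_derivative f2 y) (at y)"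
    and f3: "\<And>y. a \<le> y \<Longrightarrow> y \<le> a + 3 \<Longrightarrow> (f2 has_real_derivative f3 y) (at y)"
    and K: "\<And>y. a \<le> y \<Longrightarrow> y \<le> a + 3 \<Longrightarrow> K \<le> f3 y"
  shows "K \<le> f (a + 3) - 3 * f (a + 2) + 3 * f (a + 1) - f a"
proof -
  have shift: "((\<lambda>y. g (y + c)) has_real_derivative g' (y + c)) (at y)"
    if "(g has_real_derivative g' (y + c)) (at (y + c))" for g g' :: "real \<Rightarrow> real" and y c
    using that by (simp add: DERIV_shift)
  have "\<exists>z>a. z < a + 1 \<and> (f (a + 1 + 2) - 2 * f (a + 1 + 1) + f (a + 1)) - (f (a + 2) - 2 * f (a + 1) + f a) =
    (a + 1 - a) * (f1 (z + 2) - 2 * f1 (z + 1) + f1 z)"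
    by (rule MVT2[of a "a + 1" "\<lambda>y. f (y + 2) - 2 * f (y + 1) + f y" "\<lambda>y. f1 (y + 2) - 2 * f1 (y + 1) + f1 y"])
       (auto intro!: DERIV_add DERIV_diff DERIV_cmult shift f1)
  then obtain z where z: "a < z" "z < a + 1"
    "f (a + 3) - 3 * f (a + 2) + 3 * f (a + 1) - f a = f1 (z + 2) - 2 * f1 (z + 1) + f1 z"
    by (auto simp: algebra_simps)
  have "\<exists>w>z. w < z + 1 \<and> (f1 (z + 1 + 1) - f1 (z + 1)) - (f1 (z + 1) - f1 z) = (z + 1 - z) * (f2 (w + 1) - f2 w)"
    by (rule MVT2[of z "z + 1" "\<lambda>y. f1 (y + 1) - f1 y" "\<lambda>y. f2 (y + 1) - f2 y"])
       (use z in \<open>auto intro!: DERIV_diff shift f2\<close>)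
  then obtain w where w: "z < w" "w < z + 1" "f1 (z + 2) - 2 * f1 (z + 1) + f1 z = f2 (w + 1) - f2 w"
    by (auto simp: algebra_simps)
  have "\<exists>v>w. v < w + 1 \<and> f2 (w + 1) - f2 w = (w + 1 - w) * f3 v"
    by (rule MVT2) (use z w in \<open>auto intro!: f3\<close>)
  then obtain v where v: "w < v" "v < w + 1" "f2 (w + 1) - f2 w = f3 v" by auto
  show ?thesis unfolding z(3) w(3) v(3) by (rule K) (use z w v in auto)
qed

text \<open>The logarithm of e^x / (8 y) (1 - 1 / x) at x = pi sqrt y. The coefficient 3 collects ln
  y = 2 ln (sqrt y) and the ln (sqrt y) contained in ln x.\<close>

definition log_main :: "real \<Rightarrow> real" where
  "log_main y = pi * sqrt y - 3 * ln (sqrt y) + ln (pi * sqrt y - 1) - ln (8 * pi)"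

lemma DERIV_sqrt_comp:
  assumes "(K has_real_derivative D) (at (sqrt y))" "y > 0"
  shows "((\<lambda>y. K (sqrt y)) has_real_derivative D / (2 * sqrt y)) (at y)"
  using DERIV_chain2[OF assms(1) DERIV_real_sqrt[OF assms(2)]]
  by (simp add: field_simps)

text \<open>This and the next two are the successive derivatives with respect to y, written in s =
  sqrt y so that each is rational in s; differentiation by y is differentiation by s followed by
  division by 2 s.\<close>

definition log_main1 :: "real \<Rightarrow> real" where
  "log_main1 s = pi / (2 * s) - 3 / (2 * s ^ 2) + pi / (2 * s * (pi * s - 1))"

definition log_main2 :: "real \<Rightarrow> real" where
  "log_main2 s = - pi / (4 * s ^ 3) + 3 / (2 * s ^ 4) - pi * (2 * pi * s - 1) / (4 * s ^ 3 * (pi * s - 1) ^ 2)"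

definition log_main3 :: "real \<Rightarrow> real" where
  "log_main3 s = 3 * pi / (8 * s ^ 5) - 3 / s ^ 6 + pi * (8 * (pi * s)\<^sup>2 - 9 * (pi * s) + 3) / (8 * s ^ 5 * (pi * s - 1) ^ 3)"

context
  fixes y s p :: real
  assumes y: "y \<ge> 1"
  defines "s \<equiv> sqrt y" and "p \<equiv> pi * s - 1"
begin

lemma s_p: "s \<ge> 1" "p > 0" "y > 0"
proof -
  show "s \<ge> 1" using y by (simp add: s_def)
  then have "pi * s \<ge> 3 * 1" using pi_gt3 by (intro mult_mono) auto
  then show "p > 0" by (simp add: p_def)
qed (use y in simp)

lemma DERIV_log_main: "(log_main has_real_derivative log_main1 (sqrt y)) (at y)"
proof -
  have nz: "s \<noteq> 0" "p \<noteq> 0" "s > 0" "p > 0" using s_p by auto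
  have "((\<lambda>s. pi * s - 3 * ln s + ln (pi * s - 1) - ln (8 * pi)) has_real_derivative pi - 3 / s + pi / p) (at (sqrt y))"
    using nz unfolding p_def s_def by (auto intro!: derivative_eq_intros simp: divide_inverse)
  from DERIV_sqrt_comp[OF this s_p(3)]
  have "(log_main has_real_derivative (pi - 3 / s + pi / p) / (2 * s)) (at y)"
    unfolding log_main_def s_def .
  also have "(pi - 3 / s + pi / p) / (2 * s) = log_main1 s"
    using nz unfolding log_main1_def p_def[symmetric] by (simp add: add_divide_distrib diff_divide_distrib power2_eq_square mult_ac)
  finally show ?thesis by (simp add: s_def)
qed

lemma DERIV_log_main1: "((\<lambda>y. log_main1 (sqrt y)) has_real_derivative log_main2 (sqrt y)) (at y)"
proof -
  have nz: "s \<noteq> 0" "p \<noteq> 0" "s > 0" "p > 0" using s_p by auto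
  have "(log_main1 has_real_derivative - (pi * 2) / (2 * s)\<^sup>2 + 3 * (4 * s) / (2 * s ^ 2)\<^sup>2 - pi * (2 * p + 2 * s * pi) / (2 * s * p)\<^sup>2) (at (sqrt y))"
    using nz unfolding log_main1_def p_def s_def
    by (auto intro!: derivative_eq_intros simp: power2_eq_square)
  from DERIV_sqrt_comp[OF this s_p(3)]
  have "((\<lambda>y. log_main1 (sqrt y)) has_real_derivative (- (pi * 2) / (2 * s)\<^sup>2 + 3 * (4 * s) / (2 * s ^ 2)\<^sup>2 - pi * (2 * p + 2 * s * pi) / (2 * s * p)\<^sup>2) / (2 * s)) (at y)"
    unfolding s_def .
  also have "(- (pi * 2) / (2 * s)\<^sup>2 + 3 * (4 * s) / (2 * s ^ 2)\<^sup>2 - pi * (2 * p + 2 * s * pi) / (2 * s * p)\<^sup>2) / (2 * s) = log_main2 s"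
  proof -
    have e: "2 * pi * s - 1 = p + pi * s" by (simp add: p_def)
    show ?thesis unfolding log_main2_def p_def[symmetric] e using nz
      by (simp add: divide_simps) (simp add: eval_nat_numeral algebra_simps)
  qed
  finally show ?thesis by (simp add: s_def)
qed

lemma DERIV_log_main2: "((\<lambda>y. log_main2 (sqrt y)) has_real_derivative log_main3 (sqrt y)) (at y)"
proof -
  have nz: "s \<noteq> 0" "p \<noteq> 0" "s > 0" "p > 0" using s_p by auto
  have "(log_main2 has_real_derivative pi * (12 * s\<^sup>2) / (4 * s ^ 3)\<^sup>2 - 3 * (8 * s ^ 3) / (2 * s ^ 4)\<^sup>2
     - (pi * (2 * pi) * (4 * s ^ 3 * p\<^sup>2) - pi * (2 * pi * s - 1) * (12 * s\<^sup>2 * p\<^sup>2 + 4 * s ^ 3 * (2 * p * pi))) / (4 * s ^ 3 * p\<^sup>2)\<^sup>2) (at (sqrt y))"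
    using nz unfolding log_main2_def p_def s_def
    by (auto intro!: derivative_eq_intros simp: power2_eq_square)
  from DERIV_sqrt_comp[OF this s_p(3)]
  have "((\<lambda>y. log_main2 (sqrt y)) has_real_derivative (pi * (12 * s\<^sup>2) / (4 * s ^ 3)\<^sup>2 - 3 * (8 * s ^ 3) / (2 * s ^ 4)\<^sup>2
     - (pi * (2 * pi) * (4 * s ^ 3 * p\<^sup>2) - pi * (2 * pi * s - 1) * (12 * s\<^sup>2 * p\<^sup>2 + 4 * s ^ 3 * (2 * p * pi))) / (4 * s ^ 3 * p\<^sup>2)\<^sup>2) / (2 * s)) (at y)"
    unfolding s_def .
  also have "(pi * (12 * s\<^sup>2) / (4 * s ^ 3)\<^sup>2 - 3 * (8 * s ^ 3) / (2 * s ^ 4)\<^sup>2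
     - (pi * (2 * pi) * (4 * s ^ 3 * p\<^sup>2) - pi * (2 * pi * s - 1) * (12 * s\<^sup>2 * p\<^sup>2 + 4 * s ^ 3 * (2 * p * pi))) / (4 * s ^ 3 * p\<^sup>2)\<^sup>2) / (2 * s) = log_main3 s"
  proof -
    have e: "2 * pi * s - 1 = 2 * p + 1" "pi * s = p + 1" by (simp_all add: p_def)
    have 1: "pi * (12 * s\<^sup>2) / (4 * s ^ 3)\<^sup>2 / (2 * s) = 3 * pi / (8 * s ^ 5)"
      using nz by (simp add: divide_simps) (simp add: eval_nat_numeral algebra_simps)
    have 2: "3 * (8 * s ^ 3) / (2 * s ^ 4)\<^sup>2 / (2 * s) = 3 / s ^ 6"
      using nz by (simp add: divide_simps) (simp add: eval_nat_numeral algebra_simps)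
    have "pi * (2 * pi) * (4 * s ^ 3 * p\<^sup>2) - pi * (2 * pi * s - 1) * (12 * s\<^sup>2 * p\<^sup>2 + 4 * s ^ 3 * (2 * p * pi))
      = 4 * pi * s\<^sup>2 * p * (2 * (pi * s) * p - (2 * p + 1) * (3 * p + 2 * (pi * s)))"
      unfolding e(1) by (simp add: eval_nat_numeral algebra_simps)
    also have "\<dots> = - (4 * pi * s\<^sup>2 * p * (8 * (pi * s)\<^sup>2 - 9 * (pi * s) + 3))"
      unfolding e(2) by (simp add: eval_nat_numeral algebra_simps)
    finally have "(pi * (2 * pi) * (4 * s ^ 3 * p\<^sup>2) - pi * (2 * pi * s - 1) * (12 * s\<^sup>2 * p\<^sup>2 + 4 * s ^ 3 * (2 * p * pi))) / (4 * s ^ 3 * p\<^sup>2)\<^sup>2 / (2 * s)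
      = - (4 * pi * s\<^sup>2 * p * (8 * (pi * s)\<^sup>2 - 9 * (pi * s) + 3)) / (4 * s ^ 3 * p\<^sup>2)\<^sup>2 / (2 * s)" by (simp only:)
    also have "\<dots> = - (pi * (8 * (pi * s)\<^sup>2 - 9 * (pi * s) + 3) / (8 * s ^ 5 * p ^ 3))"
    proof -
      have "- (4 * pi * s\<^sup>2 * p * X) / (4 * s ^ 3 * p\<^sup>2)\<^sup>2 / (2 * s) = - (pi * X / (8 * s ^ 5 * p ^ 3))" for X
        using nz by (simp add: divide_simps) (simp add: eval_nat_numeral algebra_simps)
      then show ?thesis .
    qed
    finally have 3: "(pi * (2 * pi) * (4 * s ^ 3 * p\<^sup>2) - pi * (2 * pi * s - 1) * (12 * s\<^sup>2 * p\<^sup>2 + 4 * s ^ 3 * (2 * p * pi))) / (4 * s ^ 3 * p\<^sup>2)\<^sup>2 / (2 * s)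
      = - (pi * (8 * (pi * s)\<^sup>2 - 9 * (pi * s) + 3) / (8 * s ^ 5 * p ^ 3))" .
    have 4: "(a - b - c) / d = a / d - b / d - c / d" for a b c d :: real by (simp add: diff_divide_distrib)
    show ?thesis unfolding 4 1 2 3 log_main3_def p_def[symmetric] by (simp only: diff_minus_eq_add)
  qed
  finally show ?thesis by (simp add: s_def)
qed

text \<open>The last summand of \<open>log_main3\<close> is dropped. It is nonnegative, since its
  quadratic is 8 p^2 + 7 p + 2 in terms of p = pi s - 1 > 0.\<close>

lemma log_main3_ge: "(3 * pi / 8 - 3 / sqrt y) / sqrt y ^ 5 \<le> log_main3 (sqrt y)"
proof -
  have "0 \<le> 8 * (pi * s)\<^sup>2 - 9 * (pi * s) + 3"
  proof -
    have "8 * (pi * s)\<^sup>2 - 9 * (pi * s) + 3 = 8 * p\<^sup>2 + 7 * p + 2" by (simp add: p_def power2_eq_square algebra_simps)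
    moreover have "0 \<le> 8 * p\<^sup>2 + 7 * p + 2" using s_p by (intro add_nonneg_nonneg) auto
    ultimately show ?thesis by (simp only:)
  qed
  then have "0 \<le> pi * (8 * (pi * s)\<^sup>2 - 9 * (pi * s) + 3) / (8 * s ^ 5 * p ^ 3)"
    using s_p by (intro divide_nonneg_nonneg mult_nonneg_nonneg) auto
  moreover have "(3 * pi / 8 - 3 / s) / s ^ 5 = 3 * pi / (8 * s ^ 5) - 3 / s ^ 6"
    using s_p by (simp add: diff_divide_distrib power_Suc[symmetric] eval_nat_numeral mult_ac)
  ultimately show ?thesis unfolding log_main3_def p_def s_def by simp
qed

end

text \<open>This requirement fixes the threshold 900: at y = 30 the sides are within a factor of 2,
  and at y = 29 the inequality fails. Beyond 30 the seventh power grows at a logarithmic rate of at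
  most 7 / 30, far below 7 / 8, and 25 / 8 <= pi makes the exponent rational.\<close>

lemma exp_beats_power:
  assumes y: "30 \<le> (y::real)"
  shows "715 / 100 * y ^ 7 \<le> exp (7 / 25 * (pi * y))"
proof -
  have "y / 30 \<le> exp (y / 30 - 1)" using exp_ge_add_one_self[of "y / 30 - 1"] by simp
  then have "(y / 30) ^ 7 \<le> exp (y / 30 - 1) ^ 7" using y by (intro power_mono) auto
  also have "\<dots> = exp (7 / 30 * (y - 30))" unfolding exp_of_nat_mult[symmetric] by (simp add: field_simps)
  also have "\<dots> \<le> exp (7 / 8 * (y - 30))" using y by simp
  finally have "y ^ 7 \<le> 30 ^ 7 * exp (7 / 8 * (y - 30))" by (simp add: power_divide field_simps)
  then have "715 / 100 * y ^ 7 \<le> 715 / 100 * 30 ^ 7 * exp (7 / 8 * (y - 30))" by simp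
  \<comment> \<open>The value at y = 30: 7/8 * 30 is 210/8, and 145 / 128 = 1 + 1/8 + 1/128 is the
    quadratic Taylor bound for e^(1/8).\<close>
  also have "715 / 100 * 30 ^ 7 \<le> exp (1 / 8 :: real) ^ 210"
  proof -
    have "145 / 128 \<le> exp (1 / 8 :: real)"
      using exp_lower_Taylor_quadratic[of "1 / 8"] by (simp add: power2_eq_square)
    then have "(145 / 128) ^ 210 \<le> exp (1 / 8 :: real) ^ 210" by (intro power_mono) auto
    moreover have "715 / 100 * 30 ^ 7 \<le> (145 / 128 :: real) ^ 210"
      by (simp add: power_divide divide_simps)
    ultimately show ?thesis by linarith
  qed
  also have "exp (1 / 8 :: real) ^ 210 = exp (7 / 8 * 30)" unfolding exp_of_nat_mult[symmetric] by simp
  also have "exp (7 / 8 * 30) * exp (7 / 8 * (y - 30)) = exp (7 / 8 * y)" unfolding mult_exp_exp by (simp add: right_diff_distrib)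
  also have "\<dots> \<le> exp (7 / 25 * (pi * y))"
  proof -
    have "25 / 8 \<le> pi" using pi_approx by simp
    then have "25 / 8 * y \<le> pi * y" using y by (intro mult_right_mono) auto
    then show ?thesis by simp
  qed
  finally show ?thesis by simp
qed

text \<open>Dividing the absolute error by the main term gives a relative error
  \<open>\<epsilon>\<close> of at most 0.1 / y^5; as pi / 4 (1 - 1 / x) >= 0.776, this needs 5.5 /
  0.776 y^7 <= e^(7 x / 25), and 5.5 / 0.776 is below 7.15. Passing to the logarithm costs a factor
  of at most 1.02, because \<open>\<epsilon>\<close> is at most 1 / 100.\<close>

lemma ln_num_overpartitions_approx:
  assumes n: "n \<ge> 900"
  shows "\<bar>ln (num_overpartitions n) - log_main n\<bar> \<le> 11 / 100 / sqrt (real n) ^ 5"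
proof -
  define y where "y = sqrt (real n)"
  define x where "x = pi * y"
  have y30: "30 \<le> y" unfolding y_def using n by (intro real_le_rsqrt) auto
  have ny: "real n = y\<^sup>2" by (simp add: y_def)
  have x90: "90 \<le> x" using mult_mono[of 3 pi 30 y] y30 pi_gt3 by (simp add: x_def)
  define T where "T = pi / (4 * real n) * exp x * (1 - 1 / x)"
  have Tpos: "T > 0" unfolding T_def using n x90 by (intro mult_pos_pos) auto
  define \<epsilon> where "\<epsilon> = 2 * pi * num_overpartitions n / T - 1"
  have "\<bar>2 * pi * num_overpartitions n - T\<bar> \<le> 55 / 100 * exp (18 / 25 * x)"
    using ovp_circle_estimate[OF n] by (simp only: T_def x_def y_def)
  moreover have "2 * pi * num_overpartitions n - T = \<epsilon> * T" using Tpos by (simp add: \<epsilon>_def field_simps)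
  ultimately have "\<bar>\<epsilon>\<bar> * T \<le> 55 / 100 * exp (18 / 25 * x)" using Tpos by (simp add: abs_mult)
  also have "\<dots> \<le> 1 / 10 / y ^ 5 * T"
  proof -
    have "715 / 100 * y ^ 7 * exp (18 / 25 * x) \<le> exp (7 / 25 * x) * exp (18 / 25 * x)"
      using exp_beats_power[OF y30] by (intro mult_right_mono) (auto simp: x_def)
    also have "\<dots> = exp x" unfolding mult_exp_exp by simp
    finally have 1: "715 / 100 * y ^ 7 * exp (18 / 25 * x) \<le> exp x" .
    have "1 / x \<le> 1 / 90" using x90 by (intro divide_left_mono) auto
    then have "314 / 100 / 4 * (89 / 90) \<le> pi / 4 * (1 - 1 / x)"
      using pi_approx by (intro mult_mono) auto
    moreover have "776 / 1000 \<le> 314 / 100 / 4 * (89 / 90 :: real)" by simp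
    ultimately have 2: "776 / 1000 \<le> pi / 4 * (1 - 1 / x)" by (rule order_trans[rotated])
    have "55 / 100 * exp (18 / 25 * x) * (10 * y ^ 7) \<le> 776 / 1000 * exp x"
    proof -
      have "55 / 100 * exp (18 / 25 * x) * (10 * y ^ 7) = 55 / 10 * (y ^ 7 * exp (18 / 25 * x))" by simp
      moreover have "715 / 100 * (y ^ 7 * exp (18 / 25 * x)) \<le> exp x" using 1 by (simp only: mult.assoc)
      ultimately show ?thesis using exp_gt_zero[of x] by linarith
    qed
    also have "\<dots> \<le> pi / 4 * (1 - 1 / x) * exp x" using 2 by (intro mult_right_mono) auto
    finally have "55 / 100 * exp (18 / 25 * x) \<le> pi / 4 * (1 - 1 / x) * exp x / (10 * y ^ 7)"
      using y30 by (subst pos_le_divide_eq) auto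
    also have "\<dots> = 1 / 10 / y ^ 5 * T"
      unfolding T_def ny using y30 by (simp add: divide_simps)
    finally show ?thesis .
  qed
  finally have e: "\<bar>\<epsilon>\<bar> \<le> 1 / 10 / y ^ 5" using Tpos by (simp only: mult_le_cancel_right_pos)
  have "30 ^ 5 \<le> y ^ 5" using y30 by (intro power_mono) auto
  then have "1 / 10 / y ^ 5 \<le> 1 / 10 / 30 ^ 5" using y30 by (intro divide_left_mono) auto
  then have e2: "\<bar>\<epsilon>\<bar> \<le> 1 / 100" using e by simp
  have P: "num_overpartitions n = T / (2 * pi) * (1 + \<epsilon>)" using Tpos by (simp add: \<epsilon>_def)
  have lnT: "ln (T / (2 * pi)) = log_main n"
  proof -
    have "T / (2 * pi) = exp x * (x - 1) / (8 * pi * y ^ 3)"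
      unfolding T_def ny using x90 y30 by (simp add: x_def divide_simps) (simp add: eval_nat_numeral algebra_simps)
    also have "ln \<dots> = x + ln (x - 1) - (ln (8 * pi) + 3 * ln y)"
      using x90 y30 by (simp add: ln_div ln_mult ln_realpow)
    also have "\<dots> = log_main n" unfolding log_main_def y_def[symmetric] x_def by simp
    finally show ?thesis .
  qed
  have "ln (num_overpartitions n) = ln (T / (2 * pi)) + ln (1 + \<epsilon>)"
    unfolding P using Tpos e2 by (subst ln_mult) auto
  then have "\<bar>ln (num_overpartitions n) - log_main n\<bar> = \<bar>ln (1 + \<epsilon>)\<bar>" unfolding lnT by simp
  also have "\<dots> \<le> \<bar>ln (1 + \<epsilon>) - \<epsilon>\<bar> + \<bar>\<epsilon>\<bar>" by linarith
  also have "\<dots> \<le> 2 * \<epsilon>\<^sup>2 + \<bar>\<epsilon>\<bar>" using abs_ln_one_plus_x_minus_x_bound[of \<epsilon>] e2 by simp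
  also have "2 * \<epsilon>\<^sup>2 = 2 * \<bar>\<epsilon>\<bar> * \<bar>\<epsilon>\<bar>" by (simp add: power2_eq_square)
  also have "\<dots> \<le> 2 * (1 / 100) * \<bar>\<epsilon>\<bar>" using e2 by (intro mult_right_mono mult_left_mono) auto
  also have "2 * (1 / 100) * \<bar>\<epsilon>\<bar> + \<bar>\<epsilon>\<bar> \<le> 11 / 10 * (1 / 10 / y ^ 5)" using e by simp
  finally show "\<bar>ln (num_overpartitions n) - log_main n\<bar> \<le> 11 / 100 / sqrt (real n) ^ 5" by (simp add: y_def)
qed

text \<open>The weights 1, 3, 3, 1 turn the four errors into at most 8 * 0.11 = 0.88 over s^5. The
  main part is at least 3 pi / 8 - 1 / 10 > 1.07 over S^5, and S <= 1.01 s loses only a factor of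
  about 1.05. The shift from 900 to 901 is due to the entry at n - 1.\<close>

lemma third_log_difference_large:
  assumes n: "n \<ge> 901"
  shows "ln (real (num_overpartitions (n + 2))) - 3 * ln (real (num_overpartitions (n + 1)))
        + 3 * ln (real (num_overpartitions n)) - ln (real (num_overpartitions (n - 1))) \<ge> 0"
proof -
  define a where "a = real (n - 1)"
  have a: "real n = a + 1" "real (n + 1) = a + 2" "real (n + 2) = a + 3" "a \<ge> 900"
    using n by (auto simp: a_def of_nat_diff)
  define s where "s = sqrt a"
  define S where "S = sqrt (a + 3)"
  have s: "s \<ge> 30" unfolding s_def using a by (intro real_le_rsqrt) auto
  have sS: "s \<le> S" unfolding s_def S_def by simp
  have Ss: "S \<le> 101 / 100 * s"
  proof -
    have "sqrt (a + 3) \<le> sqrt ((101 / 100)\<^sup>2 * a)" using a by (simp add: power2_eq_square)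
    also have "\<dots> = 101 / 100 * s" unfolding real_sqrt_mult s_def by simp
    finally show ?thesis by (simp add: S_def)
  qed
  have err: "\<bar>ln (num_overpartitions m) - log_main m\<bar> \<le> 11 / 100 / s ^ 5" if "real m \<ge> a" for m
  proof -
    have "m \<ge> 900" using that a by linarith
    then have "\<bar>ln (num_overpartitions m) - log_main m\<bar> \<le> 11 / 100 / sqrt (real m) ^ 5"
      by (rule ln_num_overpartitions_approx)
    also have "\<dots> \<le> 11 / 100 / s ^ 5"
      using s that a(4) by (intro divide_left_mono power_mono mult_pos_pos zero_less_power) (auto simp: s_def)
    finally show ?thesis .
  qed
  have main: "107 / 100 / S ^ 5 \<le> log_main (a + 3) - 3 * log_main (a + 2) + 3 * log_main (a + 1) - log_main a"
  proof (rule third_difference_ge)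
    fix y assume y: "a \<le> y" "y \<le> a + 3"
    then have y1: "1 \<le> y" using a by simp
    show "(log_main has_real_derivative log_main1 (sqrt y)) (at y)" by (rule DERIV_log_main[OF y1])
    show "((\<lambda>y. log_main1 (sqrt y)) has_real_derivative log_main2 (sqrt y)) (at y)" by (rule DERIV_log_main1[OF y1])
    show "((\<lambda>y. log_main2 (sqrt y)) has_real_derivative log_main3 (sqrt y)) (at y)" by (rule DERIV_log_main2[OF y1])
    have sy: "30 \<le> sqrt y" "sqrt y \<le> S" using y s by (auto simp: s_def S_def intro: order_trans[OF s[unfolded s_def]])
    have "3 / sqrt y \<le> 3 / 30" using sy y1 by (intro divide_left_mono) auto
    then have "107 / 100 \<le> 3 * pi / 8 - 3 / sqrt y" using pi_approx by simp
    then have "107 / 100 / S ^ 5 \<le> (3 * pi / 8 - 3 / sqrt y) / sqrt y ^ 5"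
      using sy s sS y1 by (intro frac_le power_mono) auto
    also have "\<dots> \<le> log_main3 (sqrt y)" by (rule log_main3_ge[OF y1])
    finally show "107 / 100 / S ^ 5 \<le> log_main3 (sqrt y)" .
  qed
  have "88 / 100 / s ^ 5 \<le> 107 / 100 / S ^ 5"
  proof -
    have "S ^ 5 \<le> (101 / 100 * s) ^ 5" using Ss sS s by (intro power_mono) auto
    also have "\<dots> \<le> 107 / 88 * s ^ 5" unfolding power_mult_distrib using s by (intro mult_right_mono) (auto simp: power_divide)
    finally have "88 * S ^ 5 \<le> 107 * s ^ 5" by simp
    then show ?thesis using s sS by (simp add: divide_simps)
  qed
  then have "8 * (11 / 100 / s ^ 5) \<le> 107 / 100 / S ^ 5" by simp
  moreover have "\<bar>ln (num_overpartitions (n + 2)) - log_main (a + 3)\<bar> \<le> 11 / 100 / s ^ 5"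
    "\<bar>ln (num_overpartitions (n + 1)) - log_main (a + 2)\<bar> \<le> 11 / 100 / s ^ 5"
    "\<bar>ln (num_overpartitions n) - log_main (a + 1)\<bar> \<le> 11 / 100 / s ^ 5"
    "\<bar>ln (num_overpartitions (n - 1)) - log_main a\<bar> \<le> 11 / 100 / s ^ 5"
    using err[of "n + 2"] err[of "n + 1"] err[of n] err[of "n - 1"] unfolding a(1-3) a_def[symmetric] by simp_all
  ultimately show ?thesis using main by linarith
qed

section \<open>The finite check\<close>

text \<open>The coefficients of Gauss's theta series. Since k^2 and k have the same parity, the sign
  (-1)^k can be read off from the exponent itself.\<close>

definition square_coeff :: "nat \<Rightarrow> int" where
  "square_coeff n = (if n = 0 then 1 else if n \<in> range (\<lambda>k. (Suc k)\<^sup>2) then 2 * (-1) ^ n else 0)"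

lemma square_coeff_0 [simp]: "square_coeff 0 = 1"
  by (simp add: square_coeff_def)

lemma square_coeff_square: "square_coeff ((Suc k)\<^sup>2) = 2 * (-1) ^ Suc k"
proof -
  have "(-1 :: int) ^ ((Suc k)\<^sup>2) = (-1) ^ Suc k"
    by (cases "even k") (simp_all add: power2_eq_square)
  then show ?thesis by (auto simp: square_coeff_def)
qed

lemma square_coeff_between: "k\<^sup>2 < n \<Longrightarrow> n < (Suc k)\<^sup>2 \<Longrightarrow> square_coeff n = 0"
proof -
  assume n: "k\<^sup>2 < n" "n < (Suc k)\<^sup>2"
  have "n \<noteq> (Suc j)\<^sup>2" for j
  proof
    assume "n = (Suc j)\<^sup>2"
    then have "k < Suc j" "Suc j < Suc k" using n power2_less_imp_less[of k "Suc j"] power2_less_imp_less[of "Suc j" "Suc k"] by auto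
    then show False by simp
  qed
  then show ?thesis using n by (auto simp: square_coeff_def)
qed

definition square_fps :: "complex fps" where "square_fps = Abs_fps (\<lambda>n. of_int (square_coeff n))"

lemma square_fps_sums:
  fixes q :: complex
  assumes q: "norm q < 1"
  shows "(\<lambda>n. of_int (square_coeff n) * q ^ n) sums (1 + 2 * (\<Sum>k. (-1) ^ Suc k * q ^ (Suc k)\<^sup>2))"
proof -
  define f where "f = (\<lambda>n. if n = 0 then 0 else of_int (square_coeff n) * q ^ n)"
  have sm: "strict_mono (\<lambda>k. (Suc k)\<^sup>2)" by (rule strict_monoI) (simp add: power_strict_mono)
  have "summable (\<lambda>k. norm ((-1) ^ Suc k * q ^ (Suc k)\<^sup>2))"
    using summable_power_square[OF q] by (simp only: norm_mult norm_power) simp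
  then have "(\<lambda>k. 2 * ((-1) ^ Suc k * q ^ (Suc k)\<^sup>2)) sums (2 * (\<Sum>k. (-1) ^ Suc k * q ^ (Suc k)\<^sup>2))"
    by (rule sums_mult[OF summable_sums[OF summable_norm_cancel]])
  moreover have "f ((Suc k)\<^sup>2) = 2 * ((-1) ^ Suc k * q ^ (Suc k)\<^sup>2)" for k
    unfolding f_def square_coeff_square by simp
  ultimately have "(\<lambda>k. f ((Suc k)\<^sup>2)) sums (2 * (\<Sum>k. (-1) ^ Suc k * q ^ (Suc k)\<^sup>2))" by (simp only:)
  then have "f sums (2 * (\<Sum>k. (-1) ^ Suc k * q ^ (Suc k)\<^sup>2))"
    by (subst (asm) sums_mono_reindex[OF sm]) (auto simp: f_def square_coeff_def)
  from sums_add[OF sums_single[of 0 "\<lambda>_. 1"] this]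
  show ?thesis by (rule back_subst[of "\<lambda>f. f sums _"]) (auto simp: f_def fun_eq_iff)
qed

lemma square_fps_conv_radius: "fps_conv_radius square_fps \<ge> 1"
  unfolding fps_conv_radius_def
proof (rule conv_radius_geI_ex)
  fix r :: real assume r: "0 < r" "ereal r < 1"
  then have "norm (complex_of_real r) < 1" by simp
  from square_fps_sums[OF this]
  show "\<exists>z. norm z = r \<and> summable (\<lambda>n. fps_nth square_fps n * z ^ n)"
    using r by (intro exI[of _ "of_real r"]) (auto simp: square_fps_def sums_iff)
qed

text \<open>Gauss's identity holds as an identity of functions near 0; uniqueness of power series
  transfers it to the coefficients.\<close>

lemma square_fps_mult_ovp_fps: "square_fps * ovp_fps = 1"
proof (rule eval_fps_eqD)
  have pos: "(0::ereal) < 1" by simp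
  have "1 \<le> min (fps_conv_radius square_fps) (fps_conv_radius ovp_fps)"
    using square_fps_conv_radius ovp_fps_conv_radius by simp
  also have "\<dots> \<le> fps_conv_radius (square_fps * ovp_fps)" by (rule fps_conv_radius_mult)
  finally show "fps_conv_radius (square_fps * ovp_fps) > 0" using pos less_le_trans by blast
  have "eventually (\<lambda>z::complex. z \<in> ball 0 1) (nhds 0)" by (intro eventually_nhds_in_open) auto
  then show "eventually (\<lambda>z. eval_fps (square_fps * ovp_fps) z = eval_fps 1 z) (nhds 0)"
  proof eventually_elim
    case (elim z)
    then have z: "norm z < 1" by simp
    then have "ereal (norm z) < 1" by simp
    then have r: "ereal (norm z) < fps_conv_radius square_fps" "ereal (norm z) < fps_conv_radius ovp_fps"
      using square_fps_conv_radius ovp_fps_conv_radius less_le_trans by blast+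
    have "eval_fps square_fps z = 1 + 2 * (\<Sum>k. (-1) ^ Suc k * z ^ (Suc k)\<^sup>2)"
      using square_fps_sums[OF z] by (simp add: eval_fps_def square_fps_def sums_iff)
    then show ?case using gauss_identity[OF z] eval_fps_mult[OF r] by (simp add: ovp_gf_def)
  qed
qed simp

lemma num_overpartitions_recurrence:
  assumes "n > 0"
  shows "int (num_overpartitions n) = - (\<Sum>i<n. square_coeff (Suc i) * int (num_overpartitions (n - Suc i)))"
proof -
  have "fps_nth (square_fps * ovp_fps) n = 0" unfolding square_fps_mult_ovp_fps using assms by simp
  then have "(\<Sum>i=0..n. of_int (square_coeff i * int (num_overpartitions (n - i)))) = (0 :: complex)"
    by (simp add: fps_mult_nth square_fps_def ovp_fps_def)
  then have "complex_of_int (\<Sum>i=0..n. square_coeff i * int (num_overpartitions (n - i))) = of_int 0"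
    by (simp only: of_int_sum) simp
  then have "(\<Sum>i=0..n. square_coeff i * int (num_overpartitions (n - i))) = 0"
    by (simp only: of_int_eq_iff)
  also have "{0..n} = insert 0 (Suc ` {..<n})"
    by (auto simp: image_iff) (metis Suc_le_eq not0_implies_Suc lessThan_iff)
  finally have "int (num_overpartitions n) + (\<Sum>i\<in>Suc ` {..<n}. square_coeff i * int (num_overpartitions (n - i))) = 0"
    by (subst (asm) sum.insert) auto
  then show ?thesis by (subst (asm) sum.reindex) (auto simp: eq_neg_iff_add_eq_0)
qed

text \<open>Walks through \<open>[p(n-1), \<dots>, p(0)]\<close>, picking up the entries at distance \<open>1\<^sup>2, 2\<^sup>2, \<dots>\<close> from \<open>n\<close>
  with alternating signs: \<open>c\<close> entries are skipped first, and consecutive gaps grow by \<open>2\<close>.\<close>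

fun alt_sum :: "nat \<Rightarrow> nat \<Rightarrow> int list \<Rightarrow> int" where
  "alt_sum g c [] = 0"
| "alt_sum g 0 (x # xs) = x - alt_sum (Suc (Suc g)) g xs"
| "alt_sum g (Suc c) (x # xs) = alt_sum g c xs"

text \<open>The invariant of the walk: \<open>i\<close> entries have been passed, the next one to be
  picked up is at distance (j + 1)^2, and \<open>i \<ge> j\<^sup>2\<close> places the skipped ones
  strictly between two squares. Between (j + 1)^2 and (j + 2)^2 there are 2 (j + 1) numbers, hence
  \<open>g\<close>. The nested subtractions account for (-1)^j.\<close>

lemma alt_sum_eq:
  assumes "i + c + 1 = (Suc j)\<^sup>2" "i \<ge> j\<^sup>2" "g = 2 * Suc j"
  shows "2 * alt_sum g c xs = - ((-1) ^ j * (\<Sum>p<length xs. square_coeff (Suc (i + p)) * xs ! p))"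
  using assms
proof (induction g c xs arbitrary: i j rule: alt_sum.induct)
  case (2 g x xs)
  have "Suc i + g + 1 = (Suc (Suc j))\<^sup>2" "Suc i \<ge> (Suc j)\<^sup>2" "Suc (Suc g) = 2 * Suc (Suc j)"
    using 2(2-4) by (simp_all add: power2_eq_square)
  from "2.IH"[OF this]
  have IH: "2 * alt_sum (Suc (Suc g)) g xs = (-1) ^ j * (\<Sum>p<length xs. square_coeff (Suc (Suc i + p)) * xs ! p)" by simp
  have "square_coeff (Suc i) = 2 * (-1) ^ Suc j" using 2(2) square_coeff_square[of j] by simp
  then have "- ((-1) ^ j * (square_coeff (Suc i) * x)) = 2 * x"
    by (simp flip: mult.assoc power_mult_distrib)
  then show ?case using IH
    by (simp add: sum.lessThan_Suc_shift ring_distribs del: sum.lessThan_Suc)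
next
  case (3 g c x xs)
  have "Suc i + c + 1 = (Suc j)\<^sup>2" "j\<^sup>2 \<le> Suc i" using 3(2-4) by auto
  from "3.IH"[OF this 3(4)]
  have IH: "2 * alt_sum g c xs = - ((-1) ^ j * (\<Sum>p<length xs. square_coeff (Suc (Suc i + p)) * xs ! p))" .
  have "square_coeff (Suc i) = 0" by (rule square_coeff_between[of j]) (use 3(2-4) in auto)
  then show ?case using IH by (simp add: sum.lessThan_Suc_shift del: sum.lessThan_Suc)
qed auto

text \<open>Newest value first: extending is a single cons, and positions count the distance from
  the value to be computed.\<close>

definition ovp_list :: "nat \<Rightarrow> int list" where
  "ovp_list n = rev (map (\<lambda>k. int (num_overpartitions k)) [0..<n])"

lemma length_ovp_list [simp]: "length (ovp_list n) = n"
  by (simp add: ovp_list_def)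

lemma nth_ovp_list: "i < n \<Longrightarrow> ovp_list n ! i = int (num_overpartitions (n - Suc i))"
  by (simp add: ovp_list_def rev_nth)

definition extend :: "int list \<Rightarrow> int list" where
  "extend L = (2 * alt_sum 2 0 L) # L"

lemma ovp_list_Suc: "ovp_list (Suc n) = int (num_overpartitions n) # ovp_list n"
  by (simp add: ovp_list_def)

lemma extend_ovp_list:
  assumes "n > 0"
  shows "extend (ovp_list n) = ovp_list (Suc n)"
proof -
  have "2 * alt_sum 2 0 (ovp_list n) = - (\<Sum>p<n. square_coeff (Suc p) * ovp_list n ! p)"
    using alt_sum_eq[of 0 0 0 2 "ovp_list n"] by simp
  also have "\<dots> = int (num_overpartitions n)"
    unfolding num_overpartitions_recurrence[OF assms] by (intro arg_cong[of _ _ uminus] sum.cong) (auto simp: nth_ovp_list)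
  finally show ?thesis by (simp add: extend_def ovp_list_Suc)
qed

section \<open>The inequality in integers, checked with truncated numerals\<close>

fun half_num :: "num \<Rightarrow> num" where
  "half_num num.One = num.One" | "half_num (num.Bit0 n) = n" | "half_num (num.Bit1 n) = n"

text \<open>Certifies \<open>b\<^sup>3 d \<le> a c\<^sup>3\<close>, discarding one bit (rounding \<open>a, c\<close> down and \<open>b, d\<close> up) for every bit
  of the first argument, which is an arbitrary fuel.\<close>

fun cube_check :: "num \<Rightarrow> num \<Rightarrow> num \<Rightarrow> num \<Rightarrow> num \<Rightarrow> bool" where
  "cube_check num.One a b c d = (b * b * (b * d) \<le> a * c * (c * c))"
| "cube_check (num.Bit0 k) a b c d = (a \<noteq> num.One \<and> c \<noteq> num.One \<and>
     cube_check k (half_num a) (Num.inc (half_num b)) (half_num c) (Num.inc (half_num d)))"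
| "cube_check (num.Bit1 k) a b c d = (a \<noteq> num.One \<and> c \<noteq> num.One \<and>
     cube_check k (half_num a) (Num.inc (half_num b)) (half_num c) (Num.inc (half_num d)))"

text \<open>As \<open>num\<close> has no zero, \<open>half_num\<close> fixes \<open>num.One\<close>;
  \<open>cube_check\<close> tests for this case wherever it rounds down.\<close>

lemma half_num_le: "a \<noteq> num.One \<Longrightarrow> 2 * nat_of_num (half_num a) \<le> nat_of_num a"
  by (cases a) auto

lemma half_num_ge: "nat_of_num a \<le> 2 * nat_of_num (Num.inc (half_num a))"
  by (cases a) (auto simp: nat_of_num_inc)

text \<open>Both sides are homogeneous of degree 4, so undoing one halving multiplies both by 16,
  and the roundings only make the tested inequality harder.\<close>

lemma cube_check_sound:
  "cube_check k a b c d \<Longrightarrow> nat_of_num b ^ 3 * nat_of_num d \<le> nat_of_num a * nat_of_num c ^ 3"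
proof -
  have *: "B ^ 3 * D \<le> A * C ^ 3"
    if "B' ^ 3 * D' \<le> A' * C' ^ 3" "2 * A' \<le> A" "B \<le> 2 * B'" "2 * C' \<le> C" "D \<le> 2 * D'"
    for A B C D A' B' C' D' :: nat
  proof -
    have "B ^ 3 * D \<le> (2 * B') ^ 3 * (2 * D')" using that by (intro mult_mono power_mono) auto
    also have "\<dots> = 16 * (B' ^ 3 * D')" by (simp add: power_mult_distrib)
    also have "\<dots> \<le> 16 * (A' * C' ^ 3)" using that by simp
    also have "\<dots> = (2 * A') * (2 * C') ^ 3" by (simp add: power_mult_distrib)
    also have "\<dots> \<le> A * C ^ 3" using that by (intro mult_mono power_mono) auto
    finally show ?thesis .
  qed
  show "cube_check k a b c d \<Longrightarrow> ?thesis"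
  proof (induction k a b c d rule: cube_check.induct)
    case (1 a b c d)
    then show ?case by (simp add: less_eq_num_def nat_of_num_mult power3_eq_cube mult_ac)
  next
    case (2 k a b c d)
    then show ?case using half_num_le half_num_ge by (intro *[OF "2.IH"]) auto
  next
    case (3 k a b c d)
    then show ?case using half_num_le half_num_ge by (intro *[OF "3.IH"]) auto
  qed
qed

definition num_of_int :: "int \<Rightarrow> num" where "num_of_int z = num_of_nat (nat z)"

lemma num_of_int_code [code]: "num_of_int (Int.Pos k) = k"
  by (simp add: num_of_int_def num_of_nat_numeral_eq)

lemma nat_of_num_of_int: "z > 0 \<Longrightarrow> int (nat_of_num (num_of_int z)) = z"
  by (simp add: num_of_int_def num_of_nat_inverse)

text \<open>Dropping \<open>32\<close> bits of \<open>a\<close> yields the fuel that leaves about \<open>32\<close> significant bits.\<close>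

definition half_num4 :: "num \<Rightarrow> num" where
  "half_num4 x = half_num (half_num (half_num (half_num x)))"

definition half_num32 :: "num \<Rightarrow> num" where
  "half_num32 x = half_num4 (half_num4 (half_num4 (half_num4 (half_num4 (half_num4 (half_num4 (half_num4 x)))))))"

text \<open>On \<open>ovp_list (n + 3)\<close> the entries \<open>a\<close>, \<open>b\<close>,
  \<open>c\<close>, \<open>d\<close> are the values at n + 2, n + 1, n and n - 1.\<close>

fun head_check :: "int list \<Rightarrow> bool" where
  "head_check (a # b # c # d # L) = cube_check (half_num32 (num_of_int a)) (num_of_int a) (num_of_int b) (num_of_int c) (num_of_int d)"
| "head_check L = True"

text \<open>All cases share one computed list: every suffix of an \<open>ovp_list\<close> is again
  an \<open>ovp_list\<close>, and its head decides one value of n.\<close>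

fun suffix_checks :: "nat \<Rightarrow> int list \<Rightarrow> bool" where
  "suffix_checks (Suc k) (x # L) = (head_check (x # L) \<and> suffix_checks k L)"
| "suffix_checks k L = True"

lemma suffix_checks_ovp_list:
  "suffix_checks k (ovp_list n) \<Longrightarrow> 0 < m \<Longrightarrow> m \<le> n \<Longrightarrow> n < m + k \<Longrightarrow> head_check (ovp_list m)"
proof (induction k arbitrary: n)
  case (Suc k)
  then obtain n' where "n = Suc n'" by (cases n) auto
  with Suc show ?case by (cases "m = n") (auto simp: ovp_list_Suc)
qed auto

fun extend_times :: "nat \<Rightarrow> int list \<Rightarrow> int list" where
  "extend_times 0 L = L"
| "extend_times (Suc k) L = extend_times k (extend L)"

lemma extend_times_ovp_list: "n > 0 \<Longrightarrow> extend_times k (ovp_list n) = ovp_list (n + k)"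
  by (induction k arbitrary: n) (simp_all add: extend_ovp_list)

lemma num_overpartitions_pos: "num_overpartitions n > 0"
proof -
  have "overpartition n (replicate n (1, False))"
    by (auto simp: overpartition_def sorted_wrt_iff_nth_less sum_list_replicate map_replicate)
  then show ?thesis unfolding num_overpartitions_def using finite_overpartitions[of n]
    by (subst card_gt_0_iff) auto
qed

text \<open>Exponentiated, the claim says that p(n+1)^3 p(n-1) <= p(n+2) p(n)^3, which is what the
  check certifies.\<close>

lemma third_log_difference_if_head_check:
  assumes "head_check (ovp_list (n + 3))" "n \<ge> 1"
  shows "ln (real (num_overpartitions (n + 2))) - 3 * ln (real (num_overpartitions (n + 1)))
        + 3 * ln (real (num_overpartitions n)) - ln (real (num_overpartitions (n - 1))) \<ge> 0"
proof -
  define f where "f = num_overpartitions"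
  have f0: "f k > 0" for k unfolding f_def by (rule num_overpartitions_pos)
  obtain m where m: "n = Suc m" using assms(2) by (cases n) auto
  have "ovp_list (n + 3) = int (f (n + 2)) # int (f (n + 1)) # int (f n) # int (f (n - 1)) # ovp_list m"
    unfolding m f_def by (simp add: numeral_eq_Suc ovp_list_Suc)
  then have "cube_check (half_num32 (num_of_int (int (f (n + 2))))) (num_of_int (int (f (n + 2)))) (num_of_int (int (f (n + 1))))
     (num_of_int (int (f n))) (num_of_int (int (f (n - 1))))" using assms(1) by simp
  from cube_check_sound[OF this]
  have "f (n + 1) ^ 3 * f (n - 1) \<le> f (n + 2) * f n ^ 3"
    using f0 nat_of_num_of_int[of "int (f _)"] by (simp only: of_nat_0_less_iff of_nat_eq_iff)
  then have "real (f (n + 1)) ^ 3 * real (f (n - 1)) \<le> real (f (n + 2)) * real (f n) ^ 3"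
    by (metis of_nat_le_iff of_nat_mult of_nat_power)
  then have "ln (real (f (n + 1)) ^ 3 * real (f (n - 1))) \<le> ln (real (f (n + 2)) * real (f n) ^ 3)"
    using f0 by (subst ln_le_cancel_iff) auto
  then have "3 * ln (real (f (n + 1))) + ln (real (f (n - 1))) \<le> ln (real (f (n + 2))) + 3 * ln (real (f n))"
    using f0 by (simp add: ln_mult ln_realpow)
  then show ?thesis unfolding f_def by linarith
qed

lemma ovp_list_1: "ovp_list 1 = [1]"
  by (simp add: ovp_list_def num_overpartitions_0)

text \<open>From p(0) alone, 902 extensions give p(0), ..., p(902). The 883 suffixes have lengths
  903 down to 21, that is n + 3 for n from 900 down to 18. The evaluation proceeds by rewriting,
  hence the care about operand sizes.\<close>

lemma suffix_checks_eval: "suffix_checks 883 (extend_times 902 [1])"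
  by code_simp

lemma third_log_difference_small:
  assumes "18 \<le> n" "n \<le> 900"
  shows "ln (real (num_overpartitions (n + 2))) - 3 * ln (real (num_overpartitions (n + 1)))
        + 3 * ln (real (num_overpartitions n)) - ln (real (num_overpartitions (n - 1))) \<ge> 0"
proof (rule third_log_difference_if_head_check)
  show "head_check (ovp_list (n + 3))"
  proof (rule suffix_checks_ovp_list[of 883 903])
    show "suffix_checks 883 (ovp_list 903)"
      using suffix_checks_eval extend_times_ovp_list[of 1 902] unfolding ovp_list_1 by simp
  qed (use assms in auto)
qed (use assms in auto)

theorem corollary1p10:
  shows "ratio_log_convex_from 17 (\<lambda>n. real (num_overpartitions n)) \<and>
    (\<forall>n::nat. n \<ge> 18 \<longrightarrow>
      ln (real (num_overpartitions (n + 2))) - 3 * ln (real (num_overpartitions (n + 1)))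
        + 3 * ln (real (num_overpartitions n)) - ln (real (num_overpartitions (n - 1))) \<ge> 0)"
proof -
  let ?a = "\<lambda>n. real (num_overpartitions n)"
  have log: "ln (?a (n + 2)) - 3 * ln (?a (n + 1)) + 3 * ln (?a n) - ln (?a (n - 1)) \<ge> 0" if "n \<ge> 18" for n
    using that third_log_difference_small third_log_difference_large by (cases "n \<le> 900") auto
  moreover have "ratio_log_convex_from 17 ?a"
    by (subst ratio_log_convex_from_iff) (use log num_overpartitions_pos in auto)
  ultimately show ?thesis by blast
qed

end
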